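(* Let $G=N\rtimes H$ be a locally compact group which is the semi-direct product of a closed normal subgroup $N$ and a closed subgroup $H$, and assume that $N$ is abelian. Let the groups $\widehat{N}^{H-\mathrm{per}}$ and $\widehat{N}_{\mathrm{finite}}^{H-\mathrm{per}}$ be equipped with the discrete topology, and let $A$ and $B$ be their respective (compact) Pontryagin dual groups. Then, as topological groups, $$\mathrm{Bohr}(G)\cong A\rtimes\mathrm{Bohr}(H)\qquad\text{and}\qquad \mathrm{Prof}(G)\cong B\rtimes\mathrm{Prof}(H),$$ where $\mathrm{Bohr}(H)$ acts on $A$, and $\mathrm{Prof}(H)$ acts on $B$, by the continuous actions by automorphisms induced by the natural action of $H$.
   Context: Compact groups are Hausdorff. A Bohr compactification (respectively, a profinite completion) of a topological group $G$ is a pair $(\mathrm{Bohr}(G),\beta_G)$ (respectively, $(\mathrm{Prof}(G),\alpha_G)$) consisting of a compact (respectively, profinite) group and a continuous homomorphism from $G$ to it with dense image, such that every continuous homomorphism from $G$ to a compact (respectively, profinite) group $L$ factors through it via a continuous homomorphism. They exist and are unique up to isomorphism. $\widehat{N}$ is the group of continuous homomorphisms from $N$ to the circle group $\mathbf{S}^1$. $H$ acts on $\widehat{N}$ by $\chi\mapsto\chi^h$, $\chi^h(n)=\chi(h^{-1}nh)$. $\widehat{N}^{H-\mathrm{per}}$ is the subgroup of $\chi\in\widehat{N}$ with finite $H$-orbit, and $\widehat{N}_{\mathrm{finite}}^{H-\mathrm{per}}$ is the subgroup of those $\chi\in\widehat{N}^{H-\mathrm{per}}$ with finite image $\chi(N)$.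 The natural action of $H$ on $A$ (and likewise on $B$) is the dual action $(h\cdot a)(\chi)=a(\chi^{h^{-1}})$ for $h\in H$, $a\in A$, $\chi\in\widehat{N}^{H-\mathrm{per}}$. The induced action of $\mathrm{Bohr}(H)$ on $A$ is the continuous action for which $\beta_H(h)$ acts as $h$ for every $h\in H$; the induced action of $\mathrm{Prof}(H)$ on $B$ is the continuous action for which $\alpha_H(h)$ acts as $h$ for every $h\in H$. *)

theory Defs
  imports "HOL-Analysis.Analysis" "HOL-Algebra.Algebra"
begin

section \<open>Topological groups\<close>

locale topological_group = group G for G (structure) +
  fixes T :: "'a topology"
  assumes topspace_eq: "topspace T = carrier G"
    and continuous_mult: "continuous_map (prod_topology T T) T (\<lambda>(x, y). x \<otimes> y)"
    and continuous_inv: "continuous_map T T (\<lambda>x. inv x)"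

definition compact_group :: "('a, 'm) monoid_scheme \<Rightarrow> 'a topology \<Rightarrow> bool" where
  "compact_group G T \<longleftrightarrow> topological_group G T \<and> compact_space T \<and> Hausdorff_space T"

definition totally_disconnected_space :: "'a topology \<Rightarrow> bool" where
  "totally_disconnected_space T \<longleftrightarrow> (\<forall>S. connectedin T S \<longrightarrow> (\<exists>x. S \<subseteq> {x}))"

definition profinite_group :: "('a, 'm) monoid_scheme \<Rightarrow> 'a topology \<Rightarrow> bool" where
  "profinite_group G T \<longleftrightarrow> compact_group G T \<and> totally_disconnected_space T"

definition continuous_hom ::
  "('a, 'm) monoid_scheme \<Rightarrow> 'a topology \<Rightarrow> ('b, 'n) monoid_scheme \<Rightarrow> 'b topology
    \<Rightarrow> ('a \<Rightarrow> 'b) \<Rightarrow> bool" where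
  "continuous_hom G T G' T' f \<longleftrightarrow> f \<in> hom G G' \<and> continuous_map T T' f"

definition topological_group_isomorphic ::
  "('a, 'm) monoid_scheme \<Rightarrow> 'a topology \<Rightarrow> ('b, 'n) monoid_scheme \<Rightarrow> 'b topology \<Rightarrow> bool" where
  "topological_group_isomorphic G T G' T' \<longleftrightarrow>
     (\<exists>f. f \<in> iso G G' \<and> homeomorphic_map T T' f)"

section \<open>Bohr compactification and profinite completion\<close>

text \<open>HOL has no quantifier over types inside a definition, so the universal property is tested
  on groups \<open>L\<close> over the type \<^typ>\<open>'g set set\<close>. This is no restriction: a Hausdorff group in
  which the image of \<open>G\<close> is dense has at most \<open>2 ^ 2 ^ card G\<close> elements. The theorems
  \<open>bohr_compactification_universal\<close> and \<open>profinite_completion_universal\<close> at the end of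
  this theory derive the universal property for groups \<open>L\<close> over an arbitrary type.\<close>

definition bohr_compactification ::
  "('g, 'm) monoid_scheme \<Rightarrow> 'g topology \<Rightarrow> ('k, 'n) monoid_scheme \<Rightarrow> 'k topology
    \<Rightarrow> ('g \<Rightarrow> 'k) \<Rightarrow> bool" where
  "bohr_compactification G T K TK \<beta> \<longleftrightarrow>
     compact_group K TK \<and>
     continuous_hom G T K TK \<beta> \<and>
     TK closure_of (\<beta> ` carrier G) = topspace TK \<and>
     (\<forall>(L :: 'g set set monoid) TL f.
        compact_group L TL \<and> continuous_hom G T L TL f \<longrightarrow>
        (\<exists>\<phi>. continuous_hom K TK L TL \<phi> \<and> (\<forall>x \<in> carrier G. \<phi> (\<beta> x) = f x)))"

definition profinite_completion ::
  "('g, 'm) monoid_scheme \<Rightarrow> 'g topology \<Rightarrow> ('k, 'n) monoid_scheme \<Rightarrow> 'k topology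
    \<Rightarrow> ('g \<Rightarrow> 'k) \<Rightarrow> bool" where
  "profinite_completion G T K TK \<alpha> \<longleftrightarrow>
     profinite_group K TK \<and>
     continuous_hom G T K TK \<alpha> \<and>
     TK closure_of (\<alpha> ` carrier G) = topspace TK \<and>
     (\<forall>(L :: 'g set set monoid) TL f.
        profinite_group L TL \<and> continuous_hom G T L TL f \<longrightarrow>
        (\<exists>\<phi>. continuous_hom K TK L TL \<phi> \<and> (\<forall>x \<in> carrier G. \<phi> (\<alpha> x) = f x)))"

section \<open>Semidirect products\<close>

text \<open>Internal semidirect products are understood in the topological sense: besides the algebraic
  conditions, \<open>G\<close> carries the product topology of \<open>N\<close> and \<open>H\<close>. For closed subgroups this does
  not follow from the algebraic conditions alone.\<close>

definition topological_semidirect_product ::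
  "('g, 'm) monoid_scheme \<Rightarrow> 'g topology \<Rightarrow> 'g set \<Rightarrow> 'g set \<Rightarrow> bool" where
  "topological_semidirect_product G T N H \<longleftrightarrow>
     N \<lhd> G \<and> closedin T N \<and> subgroup H G \<and> closedin T H \<and>
     N \<inter> H = {\<one>\<^bsub>G\<^esub>} \<and> N <#>\<^bsub>G\<^esub> H = carrier G \<and>
     homeomorphic_map (prod_topology (subtopology T N) (subtopology T H)) T
       (\<lambda>(n, h). n \<otimes>\<^bsub>G\<^esub> h)"

definition continuous_action ::
  "('k, 'm) monoid_scheme \<Rightarrow> 'k topology \<Rightarrow> ('a, 'n) monoid_scheme \<Rightarrow> 'a topology
    \<Rightarrow> ('k \<Rightarrow> 'a \<Rightarrow> 'a) \<Rightarrow> bool" where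
  "continuous_action K TK A TA \<theta> \<longleftrightarrow>
     (\<forall>k \<in> carrier K. \<theta> k \<in> iso A A) \<and>
     (\<forall>a \<in> carrier A. \<theta> \<one>\<^bsub>K\<^esub> a = a) \<and>
     (\<forall>k \<in> carrier K. \<forall>l \<in> carrier K. \<forall>a \<in> carrier A. \<theta> (k \<otimes>\<^bsub>K\<^esub> l) a = \<theta> k (\<theta> l a)) \<and>
     continuous_map (prod_topology TK TA) TA (\<lambda>(k, a). \<theta> k a)"

definition semidirect_product ::
  "('a, 'm) monoid_scheme \<Rightarrow> ('k, 'n) monoid_scheme \<Rightarrow> ('k \<Rightarrow> 'a \<Rightarrow> 'a) \<Rightarrow> ('a \<times> 'k) monoid" where
  "semidirect_product A K \<theta> =
     \<lparr>carrier = carrier A \<times> carrier K,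
      monoid.mult = (\<lambda>(a, k) (b, l). (a \<otimes>\<^bsub>A\<^esub> \<theta> k b, k \<otimes>\<^bsub>K\<^esub> l)),
      one = (\<one>\<^bsub>A\<^esub>, \<one>\<^bsub>K\<^esub>)\<rparr>"

section \<open>Pontryagin duality\<close>

definition circle_group :: "complex monoid" where
  "circle_group = \<lparr>carrier = sphere 0 1, monoid.mult = (*), one = 1\<rparr>"

definition circle_topology :: "complex topology" where
  "circle_topology = top_of_set (sphere 0 1)"

text \<open>Characters are made extensional (\<^const>\<open>undefined\<close> off the carrier), so that they are
  determined by their values on the group.\<close>

definition dual_group :: "('a, 'm) monoid_scheme \<Rightarrow> 'a topology \<Rightarrow> ('a \<Rightarrow> complex) monoid" where
  "dual_group G T =
     \<lparr>carrier = {\<xi> \<in> extensional (carrier G). continuous_hom G T circle_group circle_topology \<xi>},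
      monoid.mult = (\<lambda>\<xi> \<psi>. \<lambda>x \<in> carrier G. \<xi> x * \<psi> x),
      one = (\<lambda>x \<in> carrier G. 1)\<rparr>"

text \<open>The compact-open topology.\<close>

definition dual_topology :: "('a, 'm) monoid_scheme \<Rightarrow> 'a topology \<Rightarrow> ('a \<Rightarrow> complex) topology" where
  "dual_topology G T =
     topology_generated_by
       {{\<xi> \<in> carrier (dual_group G T). \<xi> ` K \<subseteq> U} | K U. compactin T K \<and> openin circle_topology U}"

section \<open>Characters with finite orbit\<close>

definition conj_char ::
  "('g, 'm) monoid_scheme \<Rightarrow> 'g set \<Rightarrow> 'g \<Rightarrow> ('g \<Rightarrow> complex) \<Rightarrow> ('g \<Rightarrow> complex)" where
  "conj_char G N h \<xi> = (\<lambda>n \<in> N. \<xi> (inv\<^bsub>G\<^esub> h \<otimes>\<^bsub>G\<^esub> n \<otimes>\<^bsub>G\<^esub> h))"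

definition periodic_chars ::
  "('g, 'm) monoid_scheme \<Rightarrow> 'g topology \<Rightarrow> 'g set \<Rightarrow> 'g set \<Rightarrow> ('g \<Rightarrow> complex) set" where
  "periodic_chars G T N H =
     {\<xi> \<in> carrier (dual_group (G\<lparr>carrier := N\<rparr>) (subtopology T N)).
        finite ((\<lambda>h. conj_char G N h \<xi>) ` H)}"

definition finite_periodic_chars ::
  "('g, 'm) monoid_scheme \<Rightarrow> 'g topology \<Rightarrow> 'g set \<Rightarrow> 'g set \<Rightarrow> ('g \<Rightarrow> complex) set" where
  "finite_periodic_chars G T N H = {\<xi> \<in> periodic_chars G T N H. finite (\<xi> ` N)}"

text \<open>For a subgroup \<open>D\<close> of the character group of \<open>N\<close>: the Pontryagin dual of the discrete
  group \<open>D\<close>.\<close>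

definition discrete_dual_group ::
  "('g, 'm) monoid_scheme \<Rightarrow> 'g topology \<Rightarrow> 'g set \<Rightarrow> ('g \<Rightarrow> complex) set
    \<Rightarrow> (('g \<Rightarrow> complex) \<Rightarrow> complex) monoid" where
  "discrete_dual_group G T N D =
     dual_group ((dual_group (G\<lparr>carrier := N\<rparr>) (subtopology T N))\<lparr>carrier := D\<rparr>)
       (discrete_topology D)"

definition discrete_dual_topology ::
  "('g, 'm) monoid_scheme \<Rightarrow> 'g topology \<Rightarrow> 'g set \<Rightarrow> ('g \<Rightarrow> complex) set
    \<Rightarrow> (('g \<Rightarrow> complex) \<Rightarrow> complex) topology" where
  "discrete_dual_topology G T N D =
     dual_topology ((dual_group (G\<lparr>carrier := N\<rparr>) (subtopology T N))\<lparr>carrier := D\<rparr>)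
       (discrete_topology D)"

definition dual_action ::
  "('g, 'm) monoid_scheme \<Rightarrow> 'g set \<Rightarrow> ('g \<Rightarrow> complex) set
    \<Rightarrow> 'g \<Rightarrow> (('g \<Rightarrow> complex) \<Rightarrow> complex) \<Rightarrow> (('g \<Rightarrow> complex) \<Rightarrow> complex)" where
  "dual_action G N D h a = (\<lambda>\<xi> \<in> D. a (conj_char G N (inv\<^bsub>G\<^esub> h) \<xi>))"

text \<open>\<open>\<theta>\<close> is a continuous action of \<open>K\<close> on the dual of \<open>D\<close> which extends the dual action of
  \<open>H\<close> along \<open>\<iota> : H \<rightarrow> K\<close>. When \<open>\<iota>\<close> has dense image, the values of \<open>\<theta>\<close> on \<open>K\<close> and the dual
  of \<open>D\<close> are determined by this.\<close>

definition induced_action ::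
  "('g, 'm) monoid_scheme \<Rightarrow> 'g topology \<Rightarrow> 'g set \<Rightarrow> 'g set \<Rightarrow> ('g \<Rightarrow> complex) set
    \<Rightarrow> ('k, 'n) monoid_scheme \<Rightarrow> 'k topology \<Rightarrow> ('g \<Rightarrow> 'k)
    \<Rightarrow> ('k \<Rightarrow> (('g \<Rightarrow> complex) \<Rightarrow> complex) \<Rightarrow> (('g \<Rightarrow> complex) \<Rightarrow> complex)) \<Rightarrow> bool" where
  "induced_action G T N H D K TK \<iota> \<theta> \<longleftrightarrow>
     continuous_action K TK (discrete_dual_group G T N D) (discrete_dual_topology G T N D) \<theta> \<and>
     (\<forall>h \<in> H. \<forall>a \<in> carrier (discrete_dual_group G T N D). \<theta> (\<iota> h) a = dual_action G N D h a)"

section \<open>The universal properties over arbitrary types\<close>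

lemma (in topological_group) topological_group_subgroup:
  assumes "subgroup S G"
  shows "topological_group (G\<lparr>carrier := S\<rparr>) (subtopology T S)"
proof -
  interpret S: group "G\<lparr>carrier := S\<rparr>" using assms by (rule subgroup_imp_group)
  have sub: "S \<subseteq> carrier G" using assms by (rule subgroup.subset)
  have inv: "inv\<^bsub>G\<lparr>carrier := S\<rparr>\<^esub> x = inv x" if "x \<in> S" for x
    using m_inv_consistent[OF assms that] .
  show ?thesis
  proof
    show "topspace (subtopology T S) = carrier (G\<lparr>carrier := S\<rparr>)"
      using sub topspace_eq by auto
    have "continuous_map (subtopology (prod_topology T T) (S \<times> S)) T (\<lambda>(x, y). x \<otimes> y)"
      by (rule continuous_map_from_subtopology[OF continuous_mult])
    then have "continuous_map (prod_topology (subtopology T S) (subtopology T S)) T (\<lambda>(x, y). x \<otimes> y)"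
      by (simp add: subtopology_Times)
    then show "continuous_map (prod_topology (subtopology T S) (subtopology T S)) (subtopology T S)
        (\<lambda>(x, y). x \<otimes>\<^bsub>G\<lparr>carrier := S\<rparr>\<^esub> y)"
      using subgroup.m_closed[OF assms] by (auto simp: continuous_map_in_subtopology)
    have "continuous_map (subtopology T S) (subtopology T S) (\<lambda>x. inv x)"
      using continuous_map_from_subtopology[OF continuous_inv] subgroup.m_inv_closed[OF assms]
      by (auto simp: continuous_map_in_subtopology)
    then show "continuous_map (subtopology T S) (subtopology T S) (\<lambda>x. inv\<^bsub>G\<lparr>carrier := S\<rparr>\<^esub> x)"
      by (rule continuous_map_eq) (auto simp: inv)
  qed
qed

lemma (in topological_group) subgroup_closure_of:
  assumes "subgroup S G"
  shows "subgroup (T closure_of S) G"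
proof
  have S: "S \<subseteq> carrier G" using assms by (rule subgroup.subset)
  have SC: "S \<subseteq> T closure_of S" using S by (simp add: closure_of_subset topspace_eq)
  show "T closure_of S \<subseteq> carrier G"
    using closure_of_subset_topspace[of T S] by (simp add: topspace_eq)
  show "\<one> \<in> T closure_of S" using SC subgroup.one_closed[OF assms] by blast
  show "x \<otimes> y \<in> T closure_of S" if "x \<in> T closure_of S" "y \<in> T closure_of S" for x y
  proof -
    have "(\<lambda>(x, y). x \<otimes> y) ` (prod_topology T T closure_of (S \<times> S))
        \<subseteq> T closure_of ((\<lambda>(x, y). x \<otimes> y) ` (S \<times> S))"
      by (rule continuous_map_image_closure_subset[OF continuous_mult])
    also have "\<dots> \<subseteq> T closure_of S"
      using subgroup.m_closed[OF assms] by (intro closure_of_mono) auto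
    finally show ?thesis using that by (auto simp: closure_of_Times)
  qed
  show "inv x \<in> T closure_of S" if "x \<in> T closure_of S" for x
  proof -
    have "(\<lambda>x. inv x) ` (T closure_of S) \<subseteq> T closure_of ((\<lambda>x. inv x) ` S)"
      by (rule continuous_map_image_closure_subset[OF continuous_inv])
    also have "\<dots> \<subseteq> T closure_of S"
      using subgroup.m_inv_closed[OF assms] by (intro closure_of_mono) auto
    finally show ?thesis using that by auto
  qed
qed

lemma totally_disconnected_space_subtopology:
  "totally_disconnected_space T \<Longrightarrow> totally_disconnected_space (subtopology T S)"
  unfolding totally_disconnected_space_def by (simp add: connectedin_subtopology)

lemma totally_disconnected_space_inj:
  assumes T: "totally_disconnected_space T" and f: "continuous_map T' T f"
    and inj: "inj_on f (topspace T')"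
  shows "totally_disconnected_space T'"
  unfolding totally_disconnected_space_def
proof (intro allI impI)
  fix S assume S: "connectedin T' S"
  then have sub: "S \<subseteq> topspace T'" by (rule connectedin_subset_topspace)
  have "connectedin T (f ` S)" using f S by (rule connectedin_continuous_map_image)
  then obtain y where y: "f ` S \<subseteq> {y}" using T unfolding totally_disconnected_space_def by blast
  show "\<exists>x. S \<subseteq> {x}"
  proof (cases "S = {}")
    case False
    then obtain x where "x \<in> S" by blast
    then have "S \<subseteq> {x}" using y sub inj unfolding inj_on_def by blast
    then show ?thesis by blast
  qed simp
qed

text \<open>Transport of a topological group along an injection of its carrier into another type.\<close>

lemma (in topological_group) transport:
  fixes e :: "'a \<Rightarrow> 'c"
  assumes inj: "inj_on e (carrier G)"
  defines "d \<equiv> inv_into (carrier G) e"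
  defines "M \<equiv> \<lparr>carrier = e ` carrier G, monoid.mult = (\<lambda>x y. e (d x \<otimes> d y)), one = e \<one>\<rparr>"
  defines "TM \<equiv> pullback_topology (e ` carrier G) d T"
  shows "topological_group M TM" "continuous_hom G T M TM e" "continuous_hom M TM G T d"
    "homeomorphic_map T TM e"
proof -
  have de [simp]: "d (e x) = x" if "x \<in> carrier G" for x using inj that by (simp add: d_def)
  have tM: "topspace TM = e ` carrier G"
    by (auto simp: TM_def topspace_pullback_topology topspace_eq)
  have ce: "continuous_map T TM e"
    unfolding TM_def
  proof (rule continuous_map_pullback')
    show "continuous_map T T (d \<circ> e)"
      by (rule continuous_map_eq[OF continuous_map_id[of T]]) (auto simp: topspace_eq)
    show "topspace T \<subseteq> e -` e ` carrier G" by (auto simp: topspace_eq)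
  qed
  have cd: "continuous_map TM T d"
    unfolding TM_def using continuous_map_pullback[OF continuous_map_id[of T]] by simp
  have "homeomorphic_maps T TM e d"
    unfolding homeomorphic_maps_def using ce cd by (auto simp: tM topspace_eq)
  then show "homeomorphic_map T TM e" by (rule homeomorphic_maps_imp_map)
  have gM: "group M"
  proof (rule groupI)
    fix x assume "x \<in> carrier M"
    then obtain a where a: "a \<in> carrier G" "x = e a" by (auto simp: M_def)
    show "\<exists>y\<in>carrier M. y \<otimes>\<^bsub>M\<^esub> x = \<one>\<^bsub>M\<^esub>"
      using a by (intro bexI[of _ "e (inv a)"]) (auto simp: M_def)
  qed (auto simp: M_def m_assoc)
  interpret M: group M by (rule gM)
  have carM: "carrier M = e ` carrier G" by (simp add: M_def)
  have inv: "inv\<^bsub>M\<^esub> x = e (inv (d x))" if x: "x \<in> carrier M" for x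
  proof (rule M.inv_equality[OF _ x])
    show "e (inv (d x)) \<otimes>\<^bsub>M\<^esub> x = \<one>\<^bsub>M\<^esub>" "e (inv (d x)) \<in> carrier M"
      using x by (auto simp: M_def)
  qed
  show "continuous_hom G T M TM e"
    unfolding continuous_hom_def using ce by (auto simp: hom_def M_def)
  show "continuous_hom M TM G T d"
    unfolding continuous_hom_def using cd by (auto simp: hom_def M_def)
  show "topological_group M TM"
  proof
    show "topspace TM = carrier M" by (simp add: tM M_def)
    have "continuous_map (prod_topology TM TM) (prod_topology T T) (\<lambda>(x, y). (d x, d y))"
      using cd by (simp add: continuous_map_prod_top)
    then have "continuous_map (prod_topology TM TM) TM
        (e \<circ> ((\<lambda>(x, y). x \<otimes> y) \<circ> (\<lambda>(x, y). (d x, d y))))"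
      by (intro continuous_map_compose[OF _ ce] continuous_map_compose[OF _ continuous_mult])
    then show "continuous_map (prod_topology TM TM) TM (\<lambda>(x, y). x \<otimes>\<^bsub>M\<^esub> y)"
      by (rule continuous_map_eq) (auto simp: M_def)
    have "continuous_map TM TM (e \<circ> ((\<lambda>x. inv x) \<circ> d))"
      by (intro continuous_map_compose[OF _ ce] continuous_map_compose[OF cd continuous_inv])
    then show "continuous_map TM TM (\<lambda>x. inv\<^bsub>M\<^esub> x)"
      by (rule continuous_map_eq) (auto simp: inv tM carM)
  qed
qed

text \<open>The closure of the image of \<open>G\<close> injects into the double power set of \<open>G\<close>.\<close>

lemma inj_on_closure_image:
  assumes "Hausdorff_space TL" and f: "f ` A \<subseteq> topspace TL"
  shows "inj_on (\<lambda>y. {S. S \<subseteq> A \<and> y \<in> TL closure_of (f ` S)}) (TL closure_of (f ` A))"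
proof (rule inj_onI, rule ccontr)
  fix y z
  assume y: "y \<in> TL closure_of (f ` A)" and z: "z \<in> TL closure_of (f ` A)"
    and eq: "{S. S \<subseteq> A \<and> y \<in> TL closure_of (f ` S)} = {S. S \<subseteq> A \<and> z \<in> TL closure_of (f ` S)}"
    and "y \<noteq> z"
  moreover have "y \<in> topspace TL" "z \<in> topspace TL" using y z by (auto simp: in_closure_of)
  ultimately obtain U V where UV: "openin TL U" "openin TL V" "y \<in> U" "z \<in> V" "disjnt U V"
    using assms(1) unfolding Hausdorff_space_def by metis
  define S where "S = {x \<in> A. f x \<in> U}"
  have "y \<in> TL closure_of (f ` S)"
    unfolding in_closure_of
  proof (intro conjI allI impI)
    show "y \<in> topspace TL" by fact
    fix W assume W: "y \<in> W \<and> openin TL W"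
    then have "y \<in> U \<inter> W" "openin TL (U \<inter> W)" using UV by auto
    then obtain w where "w \<in> f ` A" "w \<in> U \<inter> W" using y unfolding in_closure_of by blast
    then show "\<exists>w. w \<in> f ` S \<and> w \<in> W" unfolding S_def by blast
  qed
  moreover have "S \<subseteq> A" by (auto simp: S_def)
  ultimately have "z \<in> TL closure_of (f ` S)" using eq by blast
  then obtain w where "w \<in> f ` S" "w \<in> V" using UV unfolding in_closure_of by blast
  then show False using UV by (auto simp: S_def disjnt_iff)
qed

lemma compact_group_closure_image:
  fixes f :: "'g \<Rightarrow> 'l"
  assumes T: "topological_group G T" and L: "compact_group L TL" and f: "continuous_hom G T L TL f"
  obtains M :: "'g set set monoid" and TM and e and d
  where "compact_group M TM" "continuous_hom G T M TM (e \<circ> f)" "continuous_hom M TM L TL d"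
    "\<And>x. x \<in> carrier G \<Longrightarrow> d (e (f x)) = f x"
    "totally_disconnected_space TL \<Longrightarrow> totally_disconnected_space TM"
proof -
  have G: "group G" using T by (simp add: topological_group_def)
  interpret L: topological_group L TL using L by (simp add: compact_group_def)
  have hf: "f \<in> hom G L" and cf: "continuous_map T TL f" using f by (auto simp: continuous_hom_def)
  have fG: "f ` carrier G \<subseteq> carrier L" using hf by (auto simp: hom_def)
  have sI: "subgroup (f ` carrier G) L"
    using group_hom.img_is_subgroup[of G L f] G L.group_axioms hf
    by (simp add: group_hom_def group_hom_axioms_def)
  define C where "C = TL closure_of (f ` carrier G)"
  have sC: "subgroup C L" unfolding C_def by (rule L.subgroup_closure_of[OF sI])
  have CL: "C \<subseteq> carrier L" using sC by (rule subgroup.subset)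
  interpret C: topological_group "L\<lparr>carrier := C\<rparr>" "subtopology TL C"
    by (rule L.topological_group_subgroup[OF sC])
  have fC: "f ` carrier G \<subseteq> C"
    unfolding C_def using fG by (simp add: closure_of_subset L.topspace_eq)
  obtain e :: "'l \<Rightarrow> 'g set set" where inj: "inj_on e (carrier (L\<lparr>carrier := C\<rparr>))"
  proof
    show "inj_on (\<lambda>y. {S. S \<subseteq> carrier G \<and> y \<in> TL closure_of (f ` S)})
        (carrier (L\<lparr>carrier := C\<rparr>))"
      unfolding C_def using inj_on_closure_image[of TL f "carrier G"] L fG
      by (simp add: compact_group_def L.topspace_eq)
  qed
  define d where "d = inv_into (carrier (L\<lparr>carrier := C\<rparr>)) e"
  obtain M :: "'g set set monoid" and TM where
    M: "topological_group M TM" "continuous_hom (L\<lparr>carrier := C\<rparr>) (subtopology TL C) M TM e"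
      "continuous_hom M TM (L\<lparr>carrier := C\<rparr>) (subtopology TL C) d"
      "homeomorphic_map (subtopology TL C) TM e"
    by (rule that[OF C.transport[OF inj, folded d_def]])
  have homeo: "subtopology TL C homeomorphic_space TM"
    using M(4) homeomorphic_map_imp_homeomorphic_space by blast
  have "compact_space (subtopology TL C)"
    using L unfolding C_def compact_group_def
    by (simp add: closedin_compact_space compact_space_subtopology)
  moreover have "Hausdorff_space (subtopology TL C)"
    using L by (simp add: compact_group_def Hausdorff_space_subtopology)
  ultimately have cM: "compact_group M TM"
    using M(1) homeo homeomorphic_compact_space homeomorphic_Hausdorff_space
    unfolding compact_group_def by blast
  have fT: "f ` topspace T \<subseteq> C"
    using fC T by (auto simp: topological_group.topspace_eq)
  have "continuous_map T (subtopology TL C) f"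
    using cf fT by (auto simp: continuous_map_in_subtopology)
  then have ch: "continuous_hom G T M TM (e \<circ> f)"
    using M(2) hf fC unfolding continuous_hom_def
    by (auto simp: hom_def image_subset_iff intro: continuous_map_compose)
  have dL: "continuous_hom M TM L TL d"
    using M(3) CL unfolding continuous_hom_def
    by (auto simp: hom_def continuous_map_in_subtopology)
  have de: "d (e (f x)) = f x" if "x \<in> carrier G" for x
    using inv_into_f_f[OF inj, of "f x"] fC that by (auto simp: d_def)
  have td: "totally_disconnected_space TM" if "totally_disconnected_space TL"
  proof -
    obtain g where g: "homeomorphic_maps (subtopology TL C) TM e g"
      using M(4) homeomorphic_map_maps by blast
    have "inj_on g (topspace TM)"
      using g unfolding homeomorphic_maps_def by (metis inj_on_inverseI)
    then show ?thesis
      using totally_disconnected_space_inj[OF totally_disconnected_space_subtopology[OF that]] g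
      unfolding homeomorphic_maps_def by blast
  qed
  show thesis by (rule that[OF cM ch dL de td])
qed

lemma continuous_hom_compose:
  assumes "continuous_hom G T G' T' f" "continuous_hom G' T' G'' T'' g"
  shows "continuous_hom G T G'' T'' (g \<circ> f)"
  using assms unfolding continuous_hom_def
  by (auto simp: hom_def Pi_iff intro: continuous_map_compose)

theorem bohr_compactification_universal:
  fixes G :: "('g, 'n) monoid_scheme" and L :: "('l, 'm) monoid_scheme"
  assumes G: "topological_group G T" and K: "bohr_compactification G T K TK \<beta>"
    and L: "compact_group L TL" and f: "continuous_hom G T L TL f"
  shows "\<exists>\<phi>. continuous_hom K TK L TL \<phi> \<and> (\<forall>x \<in> carrier G. \<phi> (\<beta> x) = f x)"
proof (rule compact_group_closure_image[OF G L f])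
  fix M :: "'g set set monoid" and TM e d
  assume M: "compact_group M TM" "continuous_hom G T M TM (e \<circ> f)" "continuous_hom M TM L TL d"
    and de: "\<And>x. x \<in> carrier G \<Longrightarrow> d (e (f x)) = f x"
  obtain \<phi> where \<phi>: "continuous_hom K TK M TM \<phi>" "\<forall>x \<in> carrier G. \<phi> (\<beta> x) = (e \<circ> f) x"
    using K M(1,2) unfolding bohr_compactification_def by blast
  show ?thesis
    using continuous_hom_compose[OF \<phi>(1) M(3)] \<phi>(2) de by (intro exI[of _ "d \<circ> \<phi>"]) auto
qed

theorem profinite_completion_universal:
  fixes G :: "('g, 'n) monoid_scheme" and L :: "('l, 'm) monoid_scheme"
  assumes G: "topological_group G T" and K: "profinite_completion G T K TK \<alpha>"
    and L: "profinite_group L TL" and f: "continuous_hom G T L TL f"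
  shows "\<exists>\<phi>. continuous_hom K TK L TL \<phi> \<and> (\<forall>x \<in> carrier G. \<phi> (\<alpha> x) = f x)"
proof -
  have L': "compact_group L TL" "totally_disconnected_space TL"
    using L by (auto simp: profinite_group_def)
  show ?thesis
  proof (rule compact_group_closure_image[OF G L'(1) f])
    fix M :: "'g set set monoid" and TM e d
    assume M: "compact_group M TM" "continuous_hom G T M TM (e \<circ> f)" "continuous_hom M TM L TL d"
      and de: "\<And>x. x \<in> carrier G \<Longrightarrow> d (e (f x)) = f x"
      and td: "totally_disconnected_space TL \<Longrightarrow> totally_disconnected_space TM"
    have "profinite_group M TM" using M(1) td L'(2) by (simp add: profinite_group_def)
    then obtain \<phi> where \<phi>: "continuous_hom K TK M TM \<phi>" "\<forall>x \<in> carrier G. \<phi> (\<alpha> x) = (e \<circ> f) x"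
      using K M(2) unfolding profinite_completion_def by blast
    show ?thesis
      using continuous_hom_compose[OF \<phi>(1) M(3)] \<phi>(2) de by (intro exI[of _ "d \<circ> \<phi>"]) auto
  qed
qed

end

theory Submission
  imports Defs
begin

text \<open>Both isomorphisms come from one comparison map. Let \<open>K\<close> be the given compactification of \<open>G\<close>,
\<open>L\<close> that of \<open>H\<close>, and \<open>D\<close> the group of characters of \<open>N\<close> in question, with dual \<open>A\<close>. The
homomorphism \<open>n h \<mapsto> (\<xi> \<mapsto> \<xi> n, \<beta>\<^sub>H h)\<close> from \<open>G\<close> to the compact group \<open>A \<rtimes> L\<close> extends to
\<open>\<Phi> : K \<rightarrow> A \<rtimes> L\<close>, and the point is that \<open>\<Phi>\<close> is bijective (theorem \<open>comparison\<close>).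

\<^item> Surjectivity. The image of \<open>\<Phi>\<close> is closed, so it is enough that the evaluations at points of \<open>N\<close>
  are dense in \<open>A\<close>. They are, because no nontrivial element of \<open>D\<close> is killed by all of them:
  a subgroup of the dual of a discrete group with trivial annihilator is dense
  (\<open>dense_in_ddual\<close>).
\<^item> Injectivity. Let \<open>M\<close> be the closure of the image of \<open>N\<close> in \<open>K\<close>. Then \<open>K = M j(L)\<close>, where
  \<open>j : L \<rightarrow> K\<close> comes from the universal property of \<open>L\<close>, and the second coordinate of \<open>\<Phi>\<close> shows
  that the kernel lies in \<open>M\<close>. Every continuous character of \<open>M\<close> restricts to a character of \<open>N\<close>
  which belongs to \<open>D\<close>, so on \<open>M\<close> the first coordinate of \<open>\<Phi>\<close> records the values of all
  characters of \<open>M\<close>; these separate the points of the compact abelian group \<open>M\<close>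
  (\<open>characters_separate_points\<close>).

That restrictions from \<open>M\<close> have finite orbits (\<open>restricted_character_periodic\<close>) is compactness
of \<open>K\<close>: it acts on \<open>M\<close> by conjugation, nearby elements move a character to uniformly close
characters, and uniformly close characters are equal because the circle has no small subgroups. In
the profinite case the restrictions have finite image too (\<open>profinite_character_finite_image\<close>), and
\<open>A\<close> is totally disconnected because characters with finite image have finite order.

The action of \<open>L\<close> on \<open>A\<close> exists because all \<open>H\<close>-orbits in \<open>D\<close> are finite: \<open>H\<close> acts on \<open>D\<close> through
the profinite group of orbit-preserving permutations, to which the universal property of \<open>L\<close>
applies (\<open>induced_action_exists\<close>).

The two facts of harmonic analysis both rest on the invariant mean of a continuous function on a
compact abelian group, which is obtained as a limit of averages of finitely many translates. Density
is proved by comparing the means of the powers of a peaked trigonometric polynomial over the group and over the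
closed subgroup. Separation of points is proved in the convolution algebra: the powers of a hermitian
kernel, suitably normalised, converge to an idempotent, and a minimal idempotent is a multiple of a
character.\<close>

section \<open>Uniformity from compactness\<close>

lemma continuous_map_mult_algebra:
  fixes f g :: "'a \<Rightarrow> 'b::real_normed_algebra"
  assumes "continuous_map Z euclidean f" "continuous_map Z euclidean g"
  shows "continuous_map Z euclidean (\<lambda>x. f x * g x)"
  using assms by (simp add: continuous_map_atin tendsto_mult)

lemma continuous_map_cnj:
  assumes "continuous_map Z euclidean f"
  shows "continuous_map Z euclidean (\<lambda>x. cnj (f x))"
  using assms by (simp add: continuous_map_atin tendsto_cnj)

lemma continuous_map_Re:
  assumes "continuous_map Z euclidean f"
  shows "continuous_map Z euclidean (\<lambda>x. Re (f x))"
  using assms by (simp add: continuous_map_atin tendsto_Re)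

lemma continuous_map_Im:
  assumes "continuous_map Z euclidean f"
  shows "continuous_map Z euclidean (\<lambda>x. Im (f x))"
  using assms by (simp add: continuous_map_atin tendsto_Im)

lemma continuous_map_dist:
  assumes "continuous_map Z euclidean f" "continuous_map Z euclidean g"
  shows "continuous_map Z euclideanreal (\<lambda>x. dist (f x) (g x))"
  using assms by (simp add: continuous_map_atin tendsto_dist)

lemma continuous_map_cmult:
  fixes f :: "'a \<Rightarrow> 'b::real_normed_algebra"
  assumes "continuous_map Z euclidean f"
  shows "continuous_map Z euclidean (\<lambda>x. c * f x)"
  using assms by (simp add: continuous_map_atin tendsto_mult)

lemma openin_dist_less:
  assumes "continuous_map Z euclidean f" "continuous_map Z euclidean g"
  shows "openin Z {x \<in> topspace Z. dist (f x) (g x) < \<epsilon>}"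
  using openin_continuous_map_preimage[OF continuous_map_dist[OF assms], of "{..<\<epsilon>}"] by simp

lemma continuous_map_compose2:
  assumes "continuous_map Y W g" "continuous_map Z Y f"
  shows "continuous_map Z W (\<lambda>x. g (f x))"
  using continuous_map_compose[OF assms(2,1)] by (simp add: o_def)

text \<open>A tube lemma argument: \<open>dist (F x y) (F x0 y) < \<epsilon>\<close> defines an open set containing
  \<open>{x0} \<times> Y\<close>, hence a tube around it.\<close>
lemma compact_uniform_neighbourhood:
  fixes F :: "'x \<Rightarrow> 'y \<Rightarrow> 'z::metric_space"
  assumes Y: "compact_space Y" and F: "continuous_map (prod_topology Z Y) euclidean (\<lambda>(x, y). F x y)"
    and x0: "x0 \<in> topspace Z" and "\<epsilon> > 0"
  obtains U where "openin Z U" "x0 \<in> U" "\<forall>x\<in>U. \<forall>y\<in>topspace Y. dist (F x y) (F x0 y) < \<epsilon>"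
proof -
  have "continuous_map (prod_topology Z Y) (prod_topology Z Y) (\<lambda>z. (x0, snd z))"
    using x0 by (intro continuous_map_pairedI continuous_map_snd) simp
  from continuous_map_compose2[OF F this]
  have F0: "continuous_map (prod_topology Z Y) euclidean (\<lambda>z. F x0 (snd z))" by simp
  have F1: "continuous_map (prod_topology Z Y) euclidean (\<lambda>z. F (fst z) (snd z))"
    using F by (simp add: case_prod_unfold)
  define W where "W = {z \<in> topspace (prod_topology Z Y). dist (F (fst z) (snd z)) (F x0 (snd z)) < \<epsilon>}"
  have W: "openin (prod_topology Z Y) W"
    unfolding W_def by (rule openin_dist_less[OF F1 F0])
  have "{x0} \<times> topspace Y \<subseteq> W" using x0 \<open>\<epsilon> > 0\<close> by (auto simp: W_def)
  from tube_lemma_right[OF W _ x0 this] Y obtain U V where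
    "openin Z U" "x0 \<in> U" "topspace Y \<subseteq> V" "U \<times> V \<subseteq> W" by (auto simp: compact_space_def)
  then show thesis unfolding W_def by (intro that[of U]) fastforce+
qed

lemma continuous_section:
  assumes F: "continuous_map (prod_topology Z Y) W (\<lambda>(z, x). F z x)" and z: "z \<in> topspace Z"
  shows "continuous_map Y W (F z)"
proof -
  have "continuous_map Y (prod_topology Z Y) (\<lambda>x. (z, x))"
    using z by (intro continuous_map_pairedI) auto
  from continuous_map_compose2[OF F this] show ?thesis by simp
qed

lemma (in topological_group) continuous_map_mult:
  assumes "continuous_map Z T f" "continuous_map Z T g"
  shows "continuous_map Z T (\<lambda>x. f x \<otimes> g x)"
  using continuous_map_compose2[OF continuous_mult continuous_map_pairedI[OF assms]] by simp

lemma (in topological_group) continuous_map_inverse: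
  "continuous_map Z T f \<Longrightarrow> continuous_map Z T (\<lambda>x. inv (f x))"
  by (rule continuous_map_compose2[OF continuous_inv])

section \<open>The mean of a continuous function on a compact abelian group\<close>

locale compact_abelian_group = topological_group G T + comm_group G
  for G :: "('a, 'm) monoid_scheme" (structure) and T :: "'a topology" +
  assumes compact: "compact_space T" and Hausdorff: "Hausdorff_space T"
begin

lemma continuous_map_translate:
  assumes "continuous_map T Y f" "a \<in> carrier G"
  shows "continuous_map T Y (\<lambda>x. f (x \<otimes> a))"
  using assms topspace_eq
  by (intro continuous_map_compose2[OF assms(1)] continuous_map_mult) auto

lemma uniformly_continuous:
  fixes f :: "'a \<Rightarrow> 'b::metric_space"
  assumes f: "continuous_map T euclidean f" and "\<epsilon> > 0"
  obtains U where "openin T U" "\<one> \<in> U"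
    "\<And>x u. x \<in> carrier G \<Longrightarrow> u \<in> U \<Longrightarrow> dist (f (x \<otimes> u)) (f x) < \<epsilon>"
proof -
  have "continuous_map (prod_topology T T) euclidean (\<lambda>z. f (snd z \<otimes> fst z))"
    by (intro continuous_map_compose2[OF f] continuous_map_mult continuous_map_fst continuous_map_snd)
  then have F: "continuous_map (prod_topology T T) euclidean (\<lambda>(u, x). f (x \<otimes> u))"
    by (simp add: case_prod_unfold)
  have one: "\<one> \<in> topspace T" by (simp add: topspace_eq)
  obtain U where "openin T U" "\<one> \<in> U"
    "\<forall>u\<in>U. \<forall>x\<in>topspace T. dist (f (x \<otimes> u)) (f (x \<otimes> \<one>)) < \<epsilon>"
    using compact_uniform_neighbourhood[OF compact F one \<open>\<epsilon> > 0\<close>] .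
  then show thesis using topspace_eq by (intro that[of U]) auto
qed

text \<open>The quotient of \<open>x\<close> by \<open>y\<close> lies in one of finitely many translates of \<open>U\<close> that cover the group, so
  one of finitely many translations, the same for all \<open>x\<close> and \<open>y\<close>, carries \<open>x\<close> into the
  neighbourhood \<open>y U\<close> of \<open>y\<close>.\<close>
lemma finite_translates_cover:
  assumes U: "openin T U" "U \<noteq> {}"
  obtains F where "finite F" "F \<noteq> {}" "F \<subseteq> carrier G"
    "\<And>x y. x \<in> carrier G \<Longrightarrow> y \<in> carrier G \<Longrightarrow> \<exists>a\<in>F. \<exists>u\<in>U. x \<otimes> a = y \<otimes> u"
proof -
  obtain u0 where u0: "u0 \<in> U" using U by blast
  have UG: "U \<subseteq> carrier G" using openin_subset[OF U(1)] topspace_eq by simp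
  define V where "V a = {x \<in> topspace T. x \<otimes> a \<in> U}" for a
  have "openin T (V a)" if "a \<in> carrier G" for a
    unfolding V_def by (rule openin_continuous_map_preimage[OF continuous_map_translate[OF continuous_map_id[unfolded id_def] that] U(1)])
  moreover have "\<Union> (V ` carrier G) = topspace T"
  proof (intro equalityI subsetI)
    fix x assume "x \<in> topspace T"
    then have x: "x \<in> carrier G" by (simp add: topspace_eq)
    have "x \<otimes> (inv x \<otimes> u0) = u0" using x u0 UG by (metis inv_solve_left subsetD m_closed inv_closed)
    then show "x \<in> \<Union> (V ` carrier G)"
      using x u0 UG unfolding V_def topspace_eq by (intro UN_I[of "inv x \<otimes> u0"]) auto
  qed (auto simp: V_def)
  ultimately have "\<exists>\<F>. finite \<F> \<and> \<F> \<subseteq> V ` carrier G \<and> topspace T \<subseteq> \<Union>\<F>"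
    using compact[unfolded compact_space_alt, rule_format, of "V ` carrier G"] by blast
  then obtain \<F> where F: "finite \<F>" "\<F> \<subseteq> V ` carrier G" "topspace T \<subseteq> \<Union>\<F>" by blast
  obtain F where F2: "finite F" "F \<subseteq> carrier G" "\<F> = V ` F"
    using finite_subset_image[OF F(1,2)] by blast
  have "\<exists>a\<in>F. \<exists>u\<in>U. x \<otimes> a = y \<otimes> u" if "x \<in> carrier G" "y \<in> carrier G" for x y
  proof -
    have "inv y \<otimes> x \<in> topspace T" using that by (simp add: topspace_eq)
    then obtain a where a: "a \<in> F" "inv y \<otimes> x \<otimes> a \<in> U" using F(3) F2(3) by (auto simp: V_def)
    have "x \<otimes> a = y \<otimes> (inv y \<otimes> x \<otimes> a)"
      using that a F2(2) by (simp add: m_assoc[symmetric] subset_iff)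
    then show ?thesis using a by blast
  qed
  moreover have "F \<noteq> {}" using calculation[of \<one> \<one>] by auto
  ultimately show thesis using F2 that by blast
qed

text \<open>Translations are listed with repetition, indexed by a finite set of natural numbers, so that the
  composition of two averages is again an average.\<close>
definition translates :: "nat set \<Rightarrow> (nat \<Rightarrow> 'a) \<Rightarrow> bool" where
  "translates I a \<longleftrightarrow> finite I \<and> I \<noteq> {} \<and> a ` I \<subseteq> carrier G"

definition average :: "nat set \<Rightarrow> (nat \<Rightarrow> 'a) \<Rightarrow> ('a \<Rightarrow> 'b::real_normed_vector) \<Rightarrow> 'a \<Rightarrow> 'b" where
  "average I a f x = (\<Sum>i\<in>I. f (x \<otimes> a i)) /\<^sub>R card I"

lemma average_diff: "average I a (\<lambda>x. f x - g x) x = average I a f x - average I a g x"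
  by (simp add: average_def sum_subtractf scaleR_right_diff_distrib)

lemma average_add: "average I a (\<lambda>x. f x + g x) x = average I a f x + average I a g x"
  by (simp add: average_def sum.distrib scaleR_right_distrib)

lemma average_const: "translates I a \<Longrightarrow> average I a (\<lambda>x. c) x = c"
  by (simp add: average_def translates_def scaleR_conv_of_real sum_constant_scaleR)

lemma average_cong:
  "\<lbrakk>translates I a; x \<in> carrier G; \<And>x. x \<in> carrier G \<Longrightarrow> f x = g x\<rbrakk> \<Longrightarrow> average I a f x = average I a g x"
  unfolding average_def translates_def by (auto intro!: sum.cong simp: image_subset_iff)

lemma norm_average_le:
  assumes "translates I a" "x \<in> carrier G" "\<And>x. x \<in> carrier G \<Longrightarrow> norm (f x) \<le> \<epsilon>"
  shows "norm (average I a f x) \<le> \<epsilon>"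
proof -
  have "norm (\<Sum>i\<in>I. f (x \<otimes> a i)) \<le> (\<Sum>i\<in>I. \<epsilon>)"
    using assms by (intro sum_norm_le) (auto simp: translates_def image_subset_iff)
  moreover have "card I > 0" using assms(1) by (auto simp: translates_def card_gt_0_iff)
  ultimately show ?thesis by (simp add: average_def field_simps)
qed

lemma norm_average_diff_le:
  assumes "translates I a" "x \<in> carrier G" "\<And>x. x \<in> carrier G \<Longrightarrow> norm (f x - c) \<le> \<epsilon>"
  shows "norm (average I a f x - c) \<le> \<epsilon>"
  using norm_average_le[OF assms(1,2), of "\<lambda>x. f x - c"] assms
  by (simp add: average_diff average_const)

lemma average_ge:
  fixes f :: "'a \<Rightarrow> real"
  assumes "translates I a" "x \<in> carrier G" "\<And>x. x \<in> carrier G \<Longrightarrow> m \<le> f x"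
  shows "m \<le> average I a f x"
proof -
  have "(\<Sum>i\<in>I. m) \<le> (\<Sum>i\<in>I. f (x \<otimes> a i))"
    using assms by (intro sum_mono) (auto simp: translates_def image_subset_iff)
  moreover have "card I > 0" using assms(1) by (auto simp: translates_def card_gt_0_iff)
  ultimately show ?thesis by (simp add: average_def field_simps)
qed

lemma average_commute:
  assumes "translates I a" "translates J b" "x \<in> carrier G"
  shows "average I a (average J b f) x = average J b (average I a f) x"
proof -
  have "x \<otimes> a i \<otimes> b j = x \<otimes> b j \<otimes> a i" if "i \<in> I" "j \<in> J" for i j
    using assms that by (auto simp: translates_def image_subset_iff m_ac)
  then have "(\<Sum>i\<in>I. \<Sum>j\<in>J. f (x \<otimes> a i \<otimes> b j)) = (\<Sum>j\<in>J. \<Sum>i\<in>I. f (x \<otimes> b j \<otimes> a i))"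
    by (subst sum.swap) (auto intro!: sum.cong)
  then show ?thesis by (simp add: average_def scaleR_sum_right[symmetric] mult.commute)
qed

text \<open>The composition is indexed by codes of pairs of indices.\<close>
lemma average_compose:
  assumes "translates I a" "translates J b"
  obtains K c where "translates K c"
    "\<And>(f :: 'a \<Rightarrow> 'b::real_normed_vector) x. x \<in> carrier G \<Longrightarrow> average K c f x = average I a (average J b f) x"
proof -
  define K where "K = prod_encode ` (I \<times> J)"
  define c where "c k = a (fst (prod_decode k)) \<otimes> b (snd (prod_decode k))" for k
  have K: "translates K c" using assms by (auto simp: translates_def K_def c_def image_subset_iff)
  have card: "card K = card I * card J"
    unfolding K_def by (simp add: card_image inj_prod_encode card_cartesian_product)
  have "average K c f x = average I a (average J b f) x" if x: "x \<in> carrier G" for f :: "'a \<Rightarrow> 'b" and x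
  proof -
    have "(\<Sum>k\<in>K. f (x \<otimes> c k)) = (\<Sum>(i, j)\<in>I \<times> J. f (x \<otimes> (a i \<otimes> b j)))"
      unfolding K_def by (subst sum.reindex) (auto simp: inj_prod_encode c_def intro!: sum.cong)
    also have "\<dots> = (\<Sum>i\<in>I. \<Sum>j\<in>J. f (x \<otimes> (a i \<otimes> b j)))" by (simp add: sum.cartesian_product)
    also have "\<dots> = (\<Sum>i\<in>I. \<Sum>j\<in>J. f (x \<otimes> a i \<otimes> b j))"
      using assms x by (intro sum.cong refl) (auto simp: translates_def image_subset_iff m_assoc)
    finally show ?thesis by (simp add: average_def card scaleR_sum_right[symmetric] mult.commute)
  qed
  with K show thesis by (rule that)
qed

lemma translates_of_finite_set:
  assumes "finite F" "F \<noteq> {}" "F \<subseteq> carrier G"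
  obtains I a where "translates I a" "a ` I = F" "inj_on a I"
proof -
  obtain a :: "nat \<Rightarrow> 'a" and n where "F = a ` {i. i < n}" "inj_on a {i. i < n}"
    using finite_imp_nat_seg_image_inj_on[OF assms(1)] by blast
  then show thesis using assms by (intro that[of "{i. i < n}" a]) (auto simp: translates_def)
qed

text \<open>Let \<open>\<delta>\<close> be the infimum of the oscillations of the averages of \<open>f\<close>. All averages share the modulus of
  continuity of \<open>f\<close>. If an average \<open>g\<close> has oscillation close to \<open>\<delta> > 0\<close>, then \<open>g\<close> comes
  close to its lower bound, as otherwise this bound could be raised; so \<open>g\<close> is small on a translate
  of a fixed neighbourhood of the unit, and finitely many translations, in a number
  \<open>n\<close> that does not depend on \<open>g\<close>, carry every point into this region. Averaging over them lowers
  the upper bound of \<open>g\<close> by \<open>\<delta> / (2 n)\<close>, which contradicts the choice of \<open>\<delta>\<close>.\<close>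
lemma small_oscillation:
  fixes f :: "'a \<Rightarrow> real"
  assumes f: "continuous_map T euclidean f" and "\<epsilon> > 0"
  obtains I a c where "translates I a" "\<And>x. x \<in> carrier G \<Longrightarrow> \<bar>average I a f x - c\<bar> \<le> \<epsilon>"
proof -
  define \<Delta> where "\<Delta> = {d. \<exists>I a m. translates I a \<and> (\<forall>x\<in>carrier G. m \<le> average I a f x \<and> average I a f x \<le> m + d)}"
  have nonneg: "d \<ge> 0" if d: "d \<in> \<Delta>" for d
  proof -
    obtain I a m where "\<forall>x\<in>carrier G. m \<le> average I a f x \<and> average I a f x \<le> m + d"
      using d unfolding \<Delta>_def by blast
    from bspec[OF this one_closed] show ?thesis by linarith
  qed
  have "compactin euclidean (f ` topspace T)"
    using compact f unfolding compact_space_def by (rule image_compactin)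
  then have "bounded (f ` carrier G)"
    by (simp add: topspace_eq compact_imp_bounded)
  then obtain B where B: "\<And>x. x \<in> carrier G \<Longrightarrow> \<bar>f x\<bar> \<le> B" by (auto simp: bounded_iff)
  have "2 * B \<in> \<Delta>"
  proof -
    have "translates {0} (\<lambda>_. \<one>)" by (simp add: translates_def)
    moreover have "\<forall>x\<in>carrier G. - B \<le> average {0} (\<lambda>_. \<one>) f x \<and> average {0} (\<lambda>_. \<one>) f x \<le> - B + 2 * B"
      using B by (auto simp: average_def abs_le_iff minus_le_iff)
    ultimately show ?thesis unfolding \<Delta>_def by blast
  qed
  define \<delta> where "\<delta> = Inf \<Delta>"
  have bdd: "bdd_below \<Delta>" using nonneg by (intro bdd_belowI) auto
  have le: "\<delta> \<le> d" if "d \<in> \<Delta>" for d unfolding \<delta>_def using that bdd by (rule cInf_lower)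
  have approx: "\<exists>d\<in>\<Delta>. d < \<delta> + e" if "e > 0" for e
    using cInf_lessD[of \<Delta> "\<delta> + e"] \<open>2 * B \<in> \<Delta>\<close> that unfolding \<delta>_def by auto
  have "\<delta> \<le> 0"
  proof (rule ccontr)
    assume "\<not> \<delta> \<le> 0"
    then have \<delta>: "\<delta> > 0" by simp
    obtain U where U: "openin T U" "\<one> \<in> U"
      "\<And>x u. x \<in> carrier G \<Longrightarrow> u \<in> U \<Longrightarrow> dist (f (x \<otimes> u)) (f x) < \<delta> / 4"
      using uniformly_continuous[OF f, of "\<delta> / 4"] \<delta> by auto
    have UG: "U \<subseteq> carrier G" using openin_subset[OF U(1)] topspace_eq by simp
    obtain F where F: "finite F" "F \<noteq> {}" "F \<subseteq> carrier G"
      "\<And>x y. x \<in> carrier G \<Longrightarrow> y \<in> carrier G \<Longrightarrow> \<exists>a\<in>F. \<exists>u\<in>U. x \<otimes> a = y \<otimes> u"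
      using finite_translates_cover[OF U(1)] U(2) by blast
    obtain J b where J: "translates J b" "b ` J = F" "inj_on b J"
      using translates_of_finite_set[OF F(1-3)] .
    define n where "n = card J"
    have n: "n > 0" using J(1) by (auto simp: n_def translates_def card_gt_0_iff)
    \<comment> \<open>half of the gain \<open>\<delta> / (2 * n)\<close> is spent on \<open>d\<close> exceeding \<open>\<delta>\<close>\<close>
    obtain d where d: "d \<in> \<Delta>" "d < \<delta> + \<delta> / (4 * n)" using approx[of "\<delta> / (4 * n)"] \<delta> n by auto
    obtain I a m where I: "translates I a"
      and m: "\<And>x. x \<in> carrier G \<Longrightarrow> m \<le> average I a f x" "\<And>x. x \<in> carrier G \<Longrightarrow> average I a f x \<le> m + d"
      using d(1) unfolding \<Delta>_def by blast
    define g where "g = average I a f"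
    have gU: "dist (g (x \<otimes> u)) (g x) \<le> \<delta> / 4" if "x \<in> carrier G" "u \<in> U" for x u
    proof -
      have u: "u \<in> carrier G" using that UG by blast
      have "g (x \<otimes> u) - g x = average I a (\<lambda>x. f (x \<otimes> u) - f x) x"
        using I that u unfolding g_def average_diff average_def
        by (auto simp: translates_def image_subset_iff m_ac intro!: arg_cong2[where f="(-)"] sum.cong arg_cong2[where f="(*)"])
      also have "norm \<dots> \<le> \<delta> / 4"
        using U(3) that by (intro norm_average_le[OF I that(1)]) (simp add: dist_norm less_imp_le)
      finally show ?thesis by (simp add: dist_norm)
    qed
    have dn: "\<delta> / (4 * n) \<le> \<delta> / 4" using \<delta> n by (simp add: field_simps)
    show False
    proof (cases "\<exists>y\<in>carrier G. g y \<le> m + \<delta> / 4")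
      case False
      then have "d - \<delta> / 4 \<in> \<Delta>"
        using I m unfolding \<Delta>_def g_def
        by (intro CollectI exI[of _ I] exI[of _ a] exI[of _ "m + \<delta> / 4"]) (auto intro: less_imp_le)
      then show False using le[of "d - \<delta> / 4"] d(2) dn \<delta> by linarith
    next
      case True
      then obtain y where y: "y \<in> carrier G" "g y \<le> m + \<delta> / 4" by blast
      have up: "average J b g x \<le> m + (d - \<delta> / (2 * n))" if x: "x \<in> carrier G" for x
      proof -
        obtain c u where cu: "c \<in> F" "u \<in> U" "x \<otimes> c = y \<otimes> u" using F(4)[OF x y(1)] by blast
        then obtain j where j: "j \<in> J" "b j = c" using J(2) by blast
        have "g (x \<otimes> b j) \<le> m + \<delta> / 2"
          using gU[OF y(1) cu(2)] y(2) unfolding j(2) cu(3) dist_real_def by linarith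
        moreover have "(\<Sum>i\<in>J - {j}. g (x \<otimes> b i)) \<le> (\<Sum>i\<in>J - {j}. m + d)"
          using m x J F(3) unfolding g_def by (intro sum_mono m(2)) auto
        moreover have "(\<Sum>i\<in>J. g (x \<otimes> b i)) = g (x \<otimes> b j) + (\<Sum>i\<in>J - {j}. g (x \<otimes> b i))"
          using J(1) j(1) by (intro sum.remove) (auto simp: translates_def)
        moreover have "card (J - {j}) = n - 1" using j(1) J(1) by (simp add: n_def translates_def)
        ultimately have "(\<Sum>i\<in>J. g (x \<otimes> b i)) \<le> m + \<delta> / 2 + (real n - 1) * (m + d)"
          using n by (simp add: of_nat_diff)
        also have "\<dots> = n * (m + d) + \<delta> / 2 - d" by (simp add: algebra_simps)
        also have "\<dots> \<le> n * (m + d) - \<delta> / 2" using le[OF d(1)] by linarith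
        finally show ?thesis
          using n unfolding average_def n_def[symmetric] by (simp add: field_simps)
      qed
      obtain K c where K: "translates K c"
        "\<And>(h :: 'a \<Rightarrow> real) x. x \<in> carrier G \<Longrightarrow> average K c h x = average J b (average I a h) x"
        using average_compose[OF J(1) I] by blast
      have "d - \<delta> / (2 * n) \<in> \<Delta>"
        using K up m(1) average_ge[OF J(1), of _ m g] unfolding \<Delta>_def g_def
        by (intro CollectI exI[of _ K] exI[of _ c] exI[of _ m]) auto
      moreover have "\<delta> / (2 * n) = \<delta> / (4 * n) + \<delta> / (4 * n)" "\<delta> / (4 * n) > 0"
        using n \<delta> by (simp_all add: field_simps)
      ultimately show False using le[of "d - \<delta> / (2 * n)"] d(2) by linarith
    qed
  qed
  then obtain d where d: "d \<in> \<Delta>" "d < \<epsilon>" using approx[OF \<open>\<epsilon> > 0\<close>] by force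
  then obtain I a m where "translates I a"
    "\<And>x. x \<in> carrier G \<Longrightarrow> m \<le> average I a f x \<and> average I a f x \<le> m + d" unfolding \<Delta>_def by blast
  then show thesis using d by (intro that[of I a m]) (fastforce simp: abs_le_iff)+
qed


definition is_mean :: "('a \<Rightarrow> complex) \<Rightarrow> complex \<Rightarrow> bool" where
  "is_mean f c \<longleftrightarrow>
     (\<forall>\<epsilon>>0. \<exists>I a. translates I a \<and> (\<forall>x\<in>carrier G. norm (average I a f x - c) \<le> \<epsilon>))"

definition mean :: "('a \<Rightarrow> complex) \<Rightarrow> complex" where
  "mean f = (THE c. is_mean f c)"

text \<open>Averaging over translates preserves the distance to a constant and averages commute, so averages that
  work for \<open>f\<close> and for \<open>g\<close> can be composed into one that works for both. This gives uniqueness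
  and additivity of the mean.\<close>
lemma is_mean_both:
  assumes "is_mean f c" "is_mean g d" "\<epsilon> > 0"
  obtains I a where "translates I a"
    "\<forall>x\<in>carrier G. norm (average I a f x - c) \<le> \<epsilon> \<and> norm (average I a g x - d) \<le> \<epsilon>"
proof -
  obtain I a where I: "translates I a" "\<And>x. x \<in> carrier G \<Longrightarrow> norm (average I a f x - c) \<le> \<epsilon>"
    using assms unfolding is_mean_def by blast
  obtain J b where J: "translates J b" "\<And>x. x \<in> carrier G \<Longrightarrow> norm (average J b g x - d) \<le> \<epsilon>"
    using assms unfolding is_mean_def by blast
  obtain K k where K: "translates K k"
    "\<And>(h :: 'a \<Rightarrow> complex) x. x \<in> carrier G \<Longrightarrow> average K k h x = average I a (average J b h) x"
    using average_compose[OF I(1) J(1)] by blast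
  show thesis
  proof (rule that[OF K(1)], intro ballI conjI)
    fix x assume x: "x \<in> carrier G"
    show "norm (average K k f x - c) \<le> \<epsilon>"
      unfolding K(2)[OF x] average_commute[OF I(1) J(1) x]
      by (rule norm_average_diff_le[OF J(1) x I(2)])
    show "norm (average K k g x - d) \<le> \<epsilon>"
      unfolding K(2)[OF x] by (rule norm_average_diff_le[OF I(1) x J(2)])
  qed
qed

lemma is_mean_unique:
  assumes "is_mean f c" "is_mean f d"
  shows "c = d"
proof (rule ccontr)
  assume "c \<noteq> d"
  then have "norm (c - d) / 3 > 0" by simp
  from is_mean_both[OF assms this] obtain I a where "translates I a"
    and close: "\<forall>x\<in>carrier G. norm (average I a f x - c) \<le> norm (c - d) / 3 \<and>
      norm (average I a f x - d) \<le> norm (c - d) / 3" .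
  have "norm (c - d) \<le> norm (average I a f \<one> - d) + norm (average I a f \<one> - c)"
    using norm_triangle_ineq4[of "average I a f \<one> - d" "average I a f \<one> - c"] by simp
  then show False using bspec[OF close one_closed] \<open>norm (c - d) / 3 > 0\<close> by linarith
qed

lemma mean_eqI: "is_mean f c \<Longrightarrow> mean f = c"
  unfolding mean_def using is_mean_unique by blast

text \<open>Apply \<open>small_oscillation\<close> to the real and the imaginary part. The constants reached with
  error \<open>1 / Suc n\<close> form a Cauchy sequence, because any two averages can be composed in either
  order.\<close>
lemma is_mean_mean:
  assumes f: "continuous_map T euclidean f"
  shows "is_mean f (mean f)"
proof -
  have avg_Re: "Re (average I a h x) = average I a (\<lambda>x. Re (h x)) x" for h :: "'a \<Rightarrow> complex" and I a x
    by (simp add: average_def)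
  have avg_Im: "Im (average I a h x) = average I a (\<lambda>x. Im (h x)) x" for h :: "'a \<Rightarrow> complex" and I a x
    by (simp add: average_def)
  have ex: "\<exists>I a c. translates I a \<and> (\<forall>x\<in>carrier G. norm (average I a f x - c) \<le> \<epsilon>)" if e: "\<epsilon> > 0" for \<epsilon>
  proof -
    obtain I a c where I: "translates I a" "\<And>x. x \<in> carrier G \<Longrightarrow> \<bar>average I a (\<lambda>x. Re (f x)) x - c\<bar> \<le> \<epsilon> / 2"
      using small_oscillation[OF continuous_map_Re[OF f] half_gt_zero[OF e]] by blast
    obtain J b d where J: "translates J b" "\<And>x. x \<in> carrier G \<Longrightarrow> \<bar>average J b (\<lambda>x. Im (f x)) x - d\<bar> \<le> \<epsilon> / 2"
      using small_oscillation[OF continuous_map_Im[OF f] half_gt_zero[OF e]] by blast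
    obtain K k where K: "translates K k"
      "\<And>(h :: 'a \<Rightarrow> complex) x. x \<in> carrier G \<Longrightarrow> average K k h x = average I a (average J b h) x"
      using average_compose[OF I(1) J(1)] by blast
    have "norm (average K k f x - Complex c d) \<le> \<epsilon>" if x: "x \<in> carrier G" for x
    proof -
      have "\<bar>Re (average K k f x) - c\<bar> \<le> \<epsilon> / 2"
        unfolding K(2)[OF x] average_commute[OF I(1) J(1) x] avg_Re
        using norm_average_diff_le[OF J(1) x, of "average I a (\<lambda>x. Re (f x))" c "\<epsilon> / 2"] I(2) by simp
      moreover have "\<bar>Im (average K k f x) - d\<bar> \<le> \<epsilon> / 2"
        unfolding K(2)[OF x] avg_Im
        using norm_average_diff_le[OF I(1) x, of "average J b (\<lambda>x. Im (f x))" d "\<epsilon> / 2"] J(2) by simp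
      ultimately show ?thesis
        using cmod_le[of "average K k f x - Complex c d"] by simp
    qed
    then show ?thesis using K(1) by blast
  qed
  then have "\<forall>n. \<exists>I a c. translates I a \<and> (\<forall>x\<in>carrier G. norm (average I a f x - c) \<le> inverse (real (Suc n)))"
    by simp
  then obtain I a c where I: "\<And>n. translates (I n) (a n)"
    "\<And>n x. x \<in> carrier G \<Longrightarrow> norm (average (I n) (a n) f x - c n) \<le> inverse (real (Suc n))"
    by metis
  have close: "norm (c n - c m) \<le> inverse (real (Suc n)) + inverse (real (Suc m))" for n m
  proof -
    have 1: "norm (average (I m) (a m) (average (I n) (a n) f) \<one> - c n) \<le> inverse (real (Suc n))"
      by (rule norm_average_diff_le[OF I(1) one_closed I(2)])
    have 2: "norm (average (I m) (a m) (average (I n) (a n) f) \<one> - c m) \<le> inverse (real (Suc m))"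
      unfolding average_commute[OF I(1) I(1) one_closed, of m n]
      by (rule norm_average_diff_le[OF I(1) one_closed I(2)])
    show ?thesis
      using norm_triangle_ineq4[of "average (I m) (a m) (average (I n) (a n) f) \<one> - c m"
          "average (I m) (a m) (average (I n) (a n) f) \<one> - c n"] 1 2 by simp
  qed
  have "Cauchy c"
  proof (rule CauchyI)
    fix e :: real assume "e > 0"
    then obtain M where M: "inverse (real (Suc M)) < e / 2" using reals_Archimedean[of "e / 2"] by auto
    have "norm (c m - c n) < e" if "m \<ge> M" "n \<ge> M" for m n
    proof -
      have "inverse (real (Suc m)) \<le> inverse (real (Suc M))" "inverse (real (Suc n)) \<le> inverse (real (Suc M))"
        using that by (auto intro!: le_imp_inverse_le)
      then show ?thesis using close[of m n] M by linarith
    qed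
    then show "\<exists>M. \<forall>m\<ge>M. \<forall>n\<ge>M. norm (c m - c n) < e" by blast
  qed
  then obtain C where C: "c \<longlonglongrightarrow> C" using Cauchy_convergent convergent_def by blast
  have "is_mean f C"
    unfolding is_mean_def
  proof (intro allI impI)
    fix e :: real assume e: "e > 0"
    obtain M where M: "inverse (real (Suc M)) < e / 2" using reals_Archimedean[of "e / 2"] e by auto
    from C e obtain M' where M': "\<And>n. n \<ge> M' \<Longrightarrow> norm (c n - C) < e / 2"
      using LIMSEQ_D[OF C, of "e / 2"] by auto
    define n where "n = max M M'"
    have "inverse (real (Suc n)) \<le> inverse (real (Suc M))" by (auto simp: n_def intro!: le_imp_inverse_le)
    moreover have "norm (c n - C) < e / 2" using M' by (simp add: n_def)
    moreover have "norm (average (I n) (a n) f x - C) \<le> norm (average (I n) (a n) f x - c n) + norm (c n - C)" for x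
      using norm_triangle_ineq[of "average (I n) (a n) f x - c n" "c n - C"] by simp
    ultimately have "norm (average (I n) (a n) f x - C) \<le> e" if "x \<in> carrier G" for x
      using I(2)[OF that, of n] M by (smt (verit) field_sum_of_halves)
    then show "\<exists>I a. translates I a \<and> (\<forall>x\<in>carrier G. norm (average I a f x - C) \<le> e)" using I(1) by blast
  qed
  then show ?thesis using mean_eqI by simp
qed

lemma mean_cong:
  assumes "\<And>x. x \<in> carrier G \<Longrightarrow> f x = g x"
  shows "mean f = mean g"
proof -
  have "is_mean f = is_mean g"
  proof
    fix c
    have "average I a f x = average I a g x" if "translates I a" "x \<in> carrier G" for I a x
      using average_cong[OF that, of f g] assms by blast
    then show "is_mean f c = is_mean g c" unfolding is_mean_def by (metis (no_types, lifting))
  qed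
  then show ?thesis by (simp add: mean_def)
qed

lemma mean_add:
  assumes f: "continuous_map T euclidean f" and g: "continuous_map T euclidean g"
  shows "mean (\<lambda>x. f x + g x) = mean f + mean g"
proof (rule mean_eqI, unfold is_mean_def, intro allI impI)
  fix \<epsilon> :: real assume "\<epsilon> > 0"
  obtain I a where I: "translates I a"
    "\<forall>x\<in>carrier G. norm (average I a f x - mean f) \<le> \<epsilon> / 2 \<and> norm (average I a g x - mean g) \<le> \<epsilon> / 2"
    using is_mean_both[OF is_mean_mean[OF f] is_mean_mean[OF g] half_gt_zero[OF \<open>\<epsilon> > 0\<close>]] .
  have "norm (average I a (\<lambda>x. f x + g x) x - (mean f + mean g)) \<le> \<epsilon>" if x: "x \<in> carrier G" for x
    using norm_triangle_ineq[of "average I a f x - mean f" "average I a g x - mean g"] bspec[OF I(2) x]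
    by (simp add: average_add algebra_simps)
  with I(1) show "\<exists>I a. translates I a \<and> (\<forall>x\<in>carrier G. norm (average I a (\<lambda>x. f x + g x) x - (mean f + mean g)) \<le> \<epsilon>)"
    by blast
qed

lemma mean_const [simp]: "mean (\<lambda>x. c) = c"
proof (rule mean_eqI, unfold is_mean_def, intro allI impI)
  fix \<epsilon> :: real assume "\<epsilon> > 0"
  have "translates {0} (\<lambda>_. \<one>)" by (simp add: translates_def)
  then show "\<exists>I a. translates I a \<and> (\<forall>x\<in>carrier G. norm (average I a (\<lambda>x. c) x - c) \<le> \<epsilon>)"
    using average_const \<open>\<epsilon> > 0\<close> by (metis diff_self less_imp_le norm_zero)
qed

lemma mean_cmult:
  assumes f: "continuous_map T euclidean f"
  shows "mean (\<lambda>x. c * f x) = c * mean f"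
proof (cases "c = 0")
  case False
  show ?thesis
  proof (rule mean_eqI, unfold is_mean_def, intro allI impI)
    fix \<epsilon> :: real assume "\<epsilon> > 0"
    then have "\<epsilon> / norm c > 0" using False by simp
    then obtain I a where I: "translates I a" "\<And>x. x \<in> carrier G \<Longrightarrow> norm (average I a f x - mean f) \<le> \<epsilon> / norm c"
      using is_mean_mean[OF f] unfolding is_mean_def by blast
    have "average I a (\<lambda>x. c * f x) x = c * average I a f x" for x
      by (simp add: average_def sum_distrib_left[symmetric])
    then have "norm (average I a (\<lambda>x. c * f x) x - c * mean f) = norm c * norm (average I a f x - mean f)" for x
      by (metis norm_mult right_diff_distrib)
    then have "norm (average I a (\<lambda>x. c * f x) x - c * mean f) \<le> \<epsilon>" if "x \<in> carrier G" for x
      using I(2)[OF that] False by (simp add: pos_le_divide_eq mult.commute)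
    with I(1) show "\<exists>I a. translates I a \<and> (\<forall>x\<in>carrier G. norm (average I a (\<lambda>x. c * f x) x - c * mean f) \<le> \<epsilon>)"
      by blast
  qed
qed simp

lemma mean_diff:
  assumes f: "continuous_map T euclidean f" and g: "continuous_map T euclidean g"
  shows "mean (\<lambda>x. f x - g x) = mean f - mean g"
  using mean_add[OF f continuous_map_cmult[OF g, of "-1"]] mean_cmult[OF g, of "-1"] by simp

lemma mean_cnj:
  assumes f: "continuous_map T euclidean f"
  shows "mean (\<lambda>x. cnj (f x)) = cnj (mean f)"
proof (rule mean_eqI, unfold is_mean_def, intro allI impI)
  fix \<epsilon> :: real assume "\<epsilon> > 0"
  then obtain I a where I: "translates I a" "\<And>x. x \<in> carrier G \<Longrightarrow> norm (average I a f x - mean f) \<le> \<epsilon>"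
    using is_mean_mean[OF f] unfolding is_mean_def by blast
  have "average I a (\<lambda>x. cnj (f x)) x = cnj (average I a f x)" for x
    by (simp add: average_def)
  then have "norm (average I a (\<lambda>x. cnj (f x)) x - cnj (mean f)) \<le> \<epsilon>" if "x \<in> carrier G" for x
    using I(2)[OF that] by (metis complex_cnj_diff complex_mod_cnj)
  with I(1) show "\<exists>I a. translates I a \<and> (\<forall>x\<in>carrier G. norm (average I a (\<lambda>x. cnj (f x)) x - cnj (mean f)) \<le> \<epsilon>)"
    by blast
qed

lemma norm_mean_le:
  assumes f: "continuous_map T euclidean f" and B: "\<And>x. x \<in> carrier G \<Longrightarrow> norm (f x) \<le> B"
  shows "norm (mean f) \<le> B"
proof (rule field_le_epsilon)
  fix \<epsilon> :: real assume "\<epsilon> > 0"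
  then obtain I a where I: "translates I a" "\<And>x. x \<in> carrier G \<Longrightarrow> norm (average I a f x - mean f) \<le> \<epsilon>"
    using is_mean_mean[OF f] unfolding is_mean_def by blast
  show "norm (mean f) \<le> B + \<epsilon>"
    using norm_average_le[OF I(1) one_closed, of f B] B I(2)[OF one_closed]
      norm_triangle_ineq4[of "average I a f \<one>" "average I a f \<one> - mean f"] by simp
qed

lemma mean_translate:
  assumes f: "continuous_map T euclidean f" and b: "b \<in> carrier G"
  shows "mean (\<lambda>x. f (x \<otimes> b)) = mean f"
proof (rule mean_eqI, unfold is_mean_def, intro allI impI)
  fix \<epsilon> :: real assume "\<epsilon> > 0"
  then obtain I a where I: "translates I a" "\<And>x. x \<in> carrier G \<Longrightarrow> norm (average I a f x - mean f) \<le> \<epsilon>"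
    using is_mean_mean[OF f] unfolding is_mean_def by blast
  have "average I a (\<lambda>x. f (x \<otimes> b)) x = average I a f (x \<otimes> b)" if "x \<in> carrier G" for x
    using I(1) b that unfolding average_def
    by (intro arg_cong2[where f = "(/\<^sub>R)"] sum.cong refl) (auto simp: translates_def image_subset_iff m_ac)
  with I b show "\<exists>I a. translates I a \<and> (\<forall>x\<in>carrier G. norm (average I a (\<lambda>x. f (x \<otimes> b)) x - mean f) \<le> \<epsilon>)"
    by (intro exI[of _ I] exI[of _ a]) auto
qed

lemma mean_inv:
  assumes f: "continuous_map T euclidean f"
  shows "mean (\<lambda>x. f (inv x)) = mean f"
proof (rule mean_eqI, unfold is_mean_def, intro allI impI)
  fix \<epsilon> :: real assume "\<epsilon> > 0"
  then obtain I a where I: "translates I a" "\<And>x. x \<in> carrier G \<Longrightarrow> norm (average I a f x - mean f) \<le> \<epsilon>"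
    using is_mean_mean[OF f] unfolding is_mean_def by blast
  have "translates I (\<lambda>i. inv (a i))" using I(1) by (auto simp: translates_def)
  moreover have "average I (\<lambda>i. inv (a i)) (\<lambda>x. f (inv x)) x = average I a f (inv x)" if "x \<in> carrier G" for x
    using I(1) that unfolding average_def
    by (intro arg_cong2[where f = "(/\<^sub>R)"] sum.cong refl) (auto simp: translates_def image_subset_iff inv_mult)
  ultimately show "\<exists>I a. translates I a \<and> (\<forall>x\<in>carrier G. norm (average I a (\<lambda>x. f (inv x)) x - mean f) \<le> \<epsilon>)"
    using I(2) by (intro exI[of _ I] exI[of _ "\<lambda>i. inv (a i)"]) auto
qed

text \<open>The average over \<open>F\<close> of \<open>f\<close> is at least \<open>m / card F\<close> everywhere, since one of its terms is at
  least \<open>m\<close>. This quantitative form yields strict positivity of the mean and controls the means of high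
  powers.\<close>
lemma mean_nonneg_lower_bound:
  fixes f :: "'a \<Rightarrow> real"
  assumes f: "continuous_map T euclidean f" and nonneg: "\<And>x. x \<in> carrier G \<Longrightarrow> f x \<ge> 0"
    and F: "finite F" "F \<noteq> {}" "F \<subseteq> carrier G"
    and low: "\<And>x. x \<in> carrier G \<Longrightarrow> \<exists>a\<in>F. m \<le> f (x \<otimes> a)"
  shows "m / card F \<le> Re (mean (\<lambda>x. f x))"
proof -
  have fc: "continuous_map T euclidean (\<lambda>x. complex_of_real (f x))"
    using f by (simp add: continuous_map_atin tendsto_of_real)
  obtain J b where J: "translates J b" "b ` J = F" "inj_on b J"
    using translates_of_finite_set[OF F] .
  have card: "card J = card F" "card F > 0" using card_image[OF J(3)] J F by (auto simp: card_gt_0_iff translates_def)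
  have avg_low: "m / card F \<le> average J b f x" if x: "x \<in> carrier G" for x
  proof -
    obtain j where j: "j \<in> J" "m \<le> f (x \<otimes> b j)" using low[OF x] unfolding J(2)[symmetric] by blast
    have "f (x \<otimes> b j) \<le> (\<Sum>i\<in>J. f (x \<otimes> b i))"
      using J x nonneg j by (intro member_le_sum) (auto simp: translates_def image_subset_iff)
    then show ?thesis using j card by (simp add: average_def divide_right_mono field_simps)
  qed
  show ?thesis
  proof (rule field_le_epsilon)
    fix \<epsilon> :: real assume "\<epsilon> > 0"
    then obtain I a where I: "translates I a"
      "\<And>x. x \<in> carrier G \<Longrightarrow> norm (average I a (\<lambda>x. complex_of_real (f x)) x - mean (\<lambda>x. f x)) \<le> \<epsilon>"
      using is_mean_mean[OF fc] unfolding is_mean_def by blast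
    have "norm (average J b (average I a (\<lambda>x. complex_of_real (f x))) \<one> - mean (\<lambda>x. f x)) \<le> \<epsilon>"
      by (rule norm_average_diff_le[OF J(1) one_closed I(2)])
    moreover have "average J b (average I a (\<lambda>x. complex_of_real (f x))) \<one> = of_real (average J b (average I a f) \<one>)"
      by (simp add: average_def scaleR_conv_of_real)
    moreover have "m / card F \<le> average J b (average I a f) \<one>"
      unfolding average_commute[OF J(1) I(1) one_closed] by (rule average_ge[OF I(1) one_closed avg_low])
    ultimately show "m / card F \<le> Re (mean (\<lambda>x. f x)) + \<epsilon>"
      using abs_Re_le_cmod[of "average J b (average I a (\<lambda>x. complex_of_real (f x))) \<one> - mean (\<lambda>x. f x)"] by simp
  qed
qed

lemma mean_real:
  assumes "continuous_map T euclideanreal f"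
  shows "mean (\<lambda>x. of_real (f x)) = of_real (Re (mean (\<lambda>x. of_real (f x))))"
proof -
  have "continuous_map T euclidean (\<lambda>x. complex_of_real (f x))"
    using assms by (simp add: continuous_map_atin tendsto_of_real)
  from mean_cnj[OF this] show ?thesis by (simp add: complex_eq_iff)
qed

lemma mean_pos:
  assumes f: "continuous_map T euclideanreal f" and nonneg: "\<And>x. x \<in> carrier G \<Longrightarrow> f x \<ge> 0"
    and y: "y \<in> carrier G" "f y > 0"
  shows "Re (mean (\<lambda>x. of_real (f x))) > 0"
proof -
  define U where "U = {u \<in> topspace T. f (u \<otimes> y) \<in> {f y / 2<..}}"
  have "openin T U"
    unfolding U_def by (rule openin_continuous_map_preimage[OF continuous_map_translate[OF f y(1)]]) simp
  moreover have "\<one> \<in> U" using y by (simp add: U_def topspace_eq)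
  ultimately obtain F where F: "finite F" "F \<noteq> {}" "F \<subseteq> carrier G"
    "\<And>x z. x \<in> carrier G \<Longrightarrow> z \<in> carrier G \<Longrightarrow> \<exists>a\<in>F. \<exists>u\<in>U. x \<otimes> a = z \<otimes> u"
    using finite_translates_cover[of U] by blast
  have "\<exists>a\<in>F. f y / 2 \<le> f (x \<otimes> a)" if x: "x \<in> carrier G" for x
  proof -
    obtain a u where au: "a \<in> F" "u \<in> U" "x \<otimes> a = y \<otimes> u" using F(4)[OF x y(1)] by blast
    then have "f y / 2 \<le> f (x \<otimes> a)" using y by (auto simp: U_def topspace_eq m_comm)
    then show ?thesis using au by blast
  qed
  from mean_nonneg_lower_bound[OF f nonneg F(1-3) this]
  have "f y / 2 / card F \<le> Re (mean (\<lambda>x. of_real (f x)))" .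
  moreover have "f y / 2 / card F > 0" using y F by (simp add: card_gt_0_iff)
  ultimately show ?thesis by linarith
qed

lemma mean_nonneg:
  assumes f: "continuous_map T euclideanreal f" and nonneg: "\<And>x. x \<in> carrier G \<Longrightarrow> f x \<ge> 0"
  shows "Re (mean (\<lambda>x. of_real (f x))) \<ge> 0"
  using mean_nonneg_lower_bound[OF f nonneg, of "{\<one>}" 0] nonneg by simp

lemma mean_parameter_continuous:
  assumes F: "continuous_map (prod_topology Z T) euclidean (\<lambda>(z, x). F z x)"
  shows "continuous_map Z euclidean (\<lambda>z. mean (F z))"
proof -
  have cF: "continuous_map T euclidean (F z)" if "z \<in> topspace Z" for z
    by (rule continuous_section[OF F that])
  show ?thesis
    unfolding Met_TC.continuous_map_to_metric mtopology_is_euclidean[symmetric]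
  proof (intro ballI allI impI)
    fix z0 and \<epsilon> :: real assume z0: "z0 \<in> topspace Z" and "0 < \<epsilon>"
    then have "\<epsilon> / 2 > 0" by simp
    from compact_uniform_neighbourhood[OF compact F z0 this] obtain U where
      U: "openin Z U" "z0 \<in> U" "\<forall>z\<in>U. \<forall>x\<in>topspace T. dist (F z x) (F z0 x) < \<epsilon> / 2" .
    have "dist (mean (F z0)) (mean (F z)) < \<epsilon>" if "z \<in> U" for z
    proof -
      have z: "z \<in> topspace Z" using that openin_subset[OF U(1)] by blast
      have "norm (mean (\<lambda>x. F z x - F z0 x)) \<le> \<epsilon> / 2"
        using U(3) that cF[OF z] cF[OF z0] topspace_eq
        by (intro norm_mean_le continuous_map_diff) (auto simp: dist_norm intro: less_imp_le)
      then show ?thesis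
        using \<open>0 < \<epsilon>\<close> mean_diff[OF cF[OF z] cF[OF z0]] by (simp add: dist_norm norm_minus_commute)
    qed
    with U show "\<exists>U. openin Z U \<and> z0 \<in> U \<and> (\<forall>y\<in>U. mean (F y) \<in> Met_TC.mball (mean (F z0)) \<epsilon>)"
      by auto
  qed
qed

end

section \<open>Convolution\<close>

context compact_abelian_group
begin

lemma mean_sum:
  assumes "finite I" "\<And>i. i \<in> I \<Longrightarrow> continuous_map T euclidean (f i)"
  shows "mean (\<lambda>x. \<Sum>i\<in>I. f i x) = (\<Sum>i\<in>I. mean (f i))"
  using assms
proof (induction I rule: finite_induct)
  case (insert j I)
  have "mean (\<lambda>x. f j x + (\<Sum>i\<in>I. f i x)) = mean (f j) + mean (\<lambda>x. \<Sum>i\<in>I. f i x)"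
    using insert by (intro mean_add continuous_map_sum) auto
  then show ?case using insert by simp
qed simp

text \<open>As in \<open>is_mean_both\<close>, by composing averages.\<close>
lemma is_mean_finite_family:
  assumes "finite E" "\<And>z. z \<in> E \<Longrightarrow> is_mean (F z) (c z)" "\<epsilon> > 0"
  shows "\<exists>I a. translates I a \<and> (\<forall>z\<in>E. \<forall>x\<in>carrier G. norm (average I a (F z) x - c z) \<le> \<epsilon>)"
  using assms
proof (induction E rule: finite_induct)
  case empty
  have "translates {0} (\<lambda>_. \<one>)" by (simp add: translates_def)
  then show ?case by blast
next
  case (insert w E)
  have "\<exists>I a. translates I a \<and> (\<forall>z\<in>E. \<forall>x\<in>carrier G. norm (average I a (F z) x - c z) \<le> \<epsilon>)"
    using insert.prems by (intro insert.IH) auto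
  then obtain I a where I: "translates I a" "\<And>z x. z \<in> E \<Longrightarrow> x \<in> carrier G \<Longrightarrow> norm (average I a (F z) x - c z) \<le> \<epsilon>"
    by blast
  obtain J b where J: "translates J b" "\<And>x. x \<in> carrier G \<Longrightarrow> norm (average J b (F w) x - c w) \<le> \<epsilon>"
    using insert.prems(1)[OF insertI1] \<open>\<epsilon> > 0\<close> unfolding is_mean_def by blast
  obtain K k where K: "translates K k"
    "\<And>(h :: 'a \<Rightarrow> complex) x. x \<in> carrier G \<Longrightarrow> average K k h x = average I a (average J b h) x"
    using average_compose[OF I(1) J(1)] by blast
  have "norm (average K k (F z) x - c z) \<le> \<epsilon>" if z: "z \<in> insert w E" and x: "x \<in> carrier G" for z x
  proof (cases "z = w")
    case True
    show ?thesis unfolding K(2)[OF x] True by (rule norm_average_diff_le[OF I(1) x J(2)])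
  next
    case False
    then have "z \<in> E" using z by simp
    show ?thesis unfolding K(2)[OF x] average_commute[OF I(1) J(1) x]
      by (rule norm_average_diff_le[OF J(1) x I(2)[OF \<open>z \<in> E\<close>]])
  qed
  with K(1) show ?case by blast
qed

text \<open>By compactness in the parameter \<open>z\<close> it suffices to treat finitely many values of \<open>z\<close>.\<close>
lemma mean_uniform_approximation:
  assumes F: "continuous_map (prod_topology T T) euclidean (\<lambda>(z, x). F z x)" and "\<epsilon> > 0"
  shows "\<exists>I a. translates I a \<and> (\<forall>z\<in>carrier G. \<forall>x\<in>carrier G. norm (average I a (F z) x - mean (F z)) \<le> \<epsilon>)"
proof -
  have cF: "continuous_map T euclidean (F z)" if "z \<in> carrier G" for z
    using continuous_section[OF F] that by (simp add: topspace_eq)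
  have e3: "\<epsilon> / 3 > 0" using \<open>\<epsilon> > 0\<close> by simp
  have "\<exists>U. openin T U \<and> z \<in> U \<and> (\<forall>w\<in>U. \<forall>x\<in>topspace T. dist (F w x) (F z x) < \<epsilon> / 3)" if z: "z \<in> carrier G" for z
  proof -
    have "z \<in> topspace T" using z by (simp add: topspace_eq)
    then show ?thesis by (rule compact_uniform_neighbourhood[OF compact F _ e3]) blast
  qed
  then have "\<forall>z\<in>carrier G. \<exists>U. openin T U \<and> z \<in> U \<and> (\<forall>w\<in>U. \<forall>x\<in>topspace T. dist (F w x) (F z x) < \<epsilon> / 3)"
    by blast
  from bchoice[OF this] obtain U where U:
    "\<forall>z\<in>carrier G. openin T (U z) \<and> z \<in> U z \<and> (\<forall>w\<in>U z. \<forall>x\<in>topspace T. dist (F w x) (F z x) < \<epsilon> / 3)"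
    by blast
  have "\<forall>V\<in>U ` carrier G. openin T V" "topspace T \<subseteq> \<Union> (U ` carrier G)"
    using U by (auto simp: topspace_eq)
  then have "\<exists>\<F>. finite \<F> \<and> \<F> \<subseteq> U ` carrier G \<and> topspace T \<subseteq> \<Union>\<F>"
    using compact[unfolded compact_space_alt, rule_format, of "U ` carrier G"] by blast
  then obtain E where E: "finite E" "E \<subseteq> carrier G" "carrier G \<subseteq> \<Union> (U ` E)"
    using finite_subset_image[of _ U "carrier G"] unfolding topspace_eq by metis
  have "\<And>z. z \<in> E \<Longrightarrow> is_mean (F z) (mean (F z))" using E(2) cF is_mean_mean by blast
  then obtain I a where I: "translates I a"
    "\<And>z x. z \<in> E \<Longrightarrow> x \<in> carrier G \<Longrightarrow> norm (average I a (F z) x - mean (F z)) \<le> \<epsilon> / 3"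
    using is_mean_finite_family[OF E(1) _ e3, of F "\<lambda>z. mean (F z)"] by blast
  have "norm (average I a (F z) x - mean (F z)) \<le> \<epsilon>" if z: "z \<in> carrier G" and x: "x \<in> carrier G" for z x
  proof -
    obtain w where w: "w \<in> E" "z \<in> U w" using E(3) z by blast
    then have wG: "w \<in> carrier G" using E(2) by blast
    have d: "norm (F z y - F w y) \<le> \<epsilon> / 3" if "y \<in> carrier G" for y
      using U wG w(2) that by (simp add: topspace_eq dist_norm less_imp_le)
    have "norm (average I a (\<lambda>y. F z y - F w y) x) \<le> \<epsilon> / 3"
      by (rule norm_average_le[OF I(1) x d])
    moreover have "norm (mean (\<lambda>y. F z y - F w y)) \<le> \<epsilon> / 3"
      using d by (intro norm_mean_le continuous_map_diff cF z wG)
    ultimately have 1: "norm (average I a (F z) x - average I a (F w) x) \<le> \<epsilon> / 3"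
      "norm (mean (F z) - mean (F w)) \<le> \<epsilon> / 3"
      using mean_diff[OF cF[OF z] cF[OF wG]] by (simp_all add: average_diff)
    have "average I a (F z) x - mean (F z) = (average I a (F z) x - average I a (F w) x)
        + (average I a (F w) x - mean (F w)) - (mean (F z) - mean (F w))" by simp
    then have "norm (average I a (F z) x - mean (F z)) \<le> norm (average I a (F z) x - average I a (F w) x)
        + norm (average I a (F w) x - mean (F w)) + norm (mean (F z) - mean (F w))"
      by (metis (no_types, lifting) add_right_mono norm_triangle_ineq norm_triangle_ineq4 order_trans)
    then show ?thesis using 1 I(2)[OF w(1) x] by linarith
  qed
  then show ?thesis using I(1) by blast
qed

text \<open>One average approximates the mean over \<open>y\<close> uniformly in \<open>x\<close>, and simultaneously the mean of
  \<open>\<lambda>y. mean (\<lambda>x. F x y)\<close>; a finite sum can be interchanged with the mean over \<open>x\<close>.\<close>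
lemma mean_swap:
  assumes F: "continuous_map (prod_topology T T) euclidean (\<lambda>(x, y). F x y)"
  shows "mean (\<lambda>x. mean (F x)) = mean (\<lambda>y. mean (\<lambda>x. F x y))"
proof -
  have cF: "continuous_map T euclidean (F z)" if "z \<in> carrier G" for z
    using continuous_section[OF F] that by (simp add: topspace_eq)
  have "continuous_map (prod_topology T T) (prod_topology T T) (\<lambda>z. (snd z, fst z))"
    by (intro continuous_map_pairedI continuous_map_fst continuous_map_snd)
  from continuous_map_compose2[OF F this]
  have F': "continuous_map (prod_topology T T) euclidean (\<lambda>(y, x). F x y)"
    by (simp add: case_prod_unfold)
  have cF': "continuous_map T euclidean (\<lambda>x. F x z)" if "z \<in> carrier G" for z
    using continuous_section[OF F'] that by (simp add: topspace_eq)
  define h where "h y = mean (\<lambda>x. F x y)" for y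
  have ch: "continuous_map T euclidean h"
    unfolding h_def by (rule mean_parameter_continuous[OF F'])
  have cm: "continuous_map T euclidean (\<lambda>x. mean (F x))"
    by (rule mean_parameter_continuous[OF F])
  have "norm (mean (\<lambda>x. mean (F x)) - mean h) \<le> 0 + \<epsilon>" if "\<epsilon> > 0" for \<epsilon>
  proof -
    have e2: "\<epsilon> / 2 > 0" using that by simp
    obtain I a where I: "translates I a"
      "\<And>z x. z \<in> carrier G \<Longrightarrow> x \<in> carrier G \<Longrightarrow> norm (average I a (F z) x - mean (F z)) \<le> \<epsilon> / 2"
      using mean_uniform_approximation[OF F e2] by blast
    obtain J b where J: "translates J b" "\<And>x. x \<in> carrier G \<Longrightarrow> norm (average J b h x - mean h) \<le> \<epsilon> / 2"
      using is_mean_mean[OF ch] e2 unfolding is_mean_def by blast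
    obtain K k where K: "translates K k"
      "\<And>(h :: 'a \<Rightarrow> complex) x. x \<in> carrier G \<Longrightarrow> average K k h x = average I a (average J b h) x"
      using average_compose[OF I(1) J(1)] by blast
    have k: "k i \<in> carrier G" if "i \<in> K" for i using K(1) that by (auto simp: translates_def)
    have 1: "norm (average K k h \<one> - mean h) \<le> \<epsilon> / 2"
      unfolding K(2)[OF one_closed] by (rule norm_average_diff_le[OF I(1) one_closed J(2)])
    have 2: "norm (average K k (F z) \<one> - mean (F z)) \<le> \<epsilon> / 2" if z: "z \<in> carrier G" for z
      unfolding K(2)[OF one_closed] average_commute[OF I(1) J(1) one_closed]
      by (rule norm_average_diff_le[OF J(1) one_closed I(2)[OF z]])
    have cK: "continuous_map T euclidean (\<lambda>x. average K k (F x) \<one>)"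
      unfolding average_def scaleR_conv_of_real
      using K(1) k by (intro continuous_map_cmult continuous_map_sum cF') (auto simp: translates_def)
    have "mean (\<lambda>x. average K k (F x) \<one>) = average K k h \<one>"
      unfolding average_def scaleR_conv_of_real h_def
      using K(1) k by (subst mean_cmult, (intro continuous_map_sum cF'; auto simp: translates_def),
          subst mean_sum, auto simp: translates_def intro: cF')
    moreover have "norm (mean (\<lambda>x. average K k (F x) \<one> - mean (F x))) \<le> \<epsilon> / 2"
      by (intro norm_mean_le continuous_map_diff cK cm 2)
    ultimately have "norm (average K k h \<one> - mean (\<lambda>x. mean (F x))) \<le> \<epsilon> / 2"
      using mean_diff[OF cK cm] by simp
    then show ?thesis
      using 1 norm_triangle_ineq4[of "average K k h \<one> - mean h" "average K k h \<one> - mean (\<lambda>x. mean (F x))"]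
      by simp
  qed
  then have "norm (mean (\<lambda>x. mean (F x)) - mean h) \<le> 0" by (rule field_le_epsilon)
  then show ?thesis by (simp add: h_def[abs_def])
qed

lemma translate_quotient:
  assumes "x \<in> carrier G" "y \<in> carrier G" "a \<in> carrier G"
  shows "x \<otimes> a \<otimes> inv (y \<otimes> a) = x \<otimes> inv y"
proof -
  have "a \<otimes> (inv a \<otimes> inv y) = inv y" using assms by (simp add: m_assoc[symmetric])
  then show ?thesis using assms by (simp add: inv_mult_group m_assoc)
qed

text \<open>Functions vanish off the carrier, so that equality on the carrier is equality.\<close>
definition cfun :: "('a \<Rightarrow> complex) set" where
  "cfun = {f. continuous_map T euclidean f \<and> (\<forall>x. x \<notin> carrier G \<longrightarrow> f x = 0)}"

definition conv :: "('a \<Rightarrow> complex) \<Rightarrow> ('a \<Rightarrow> complex) \<Rightarrow> 'a \<Rightarrow> complex" where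
  "conv f g x = (if x \<in> carrier G then mean (\<lambda>y. f (x \<otimes> inv y) * g y) else 0)"

lemma cfun_continuous: "f \<in> cfun \<Longrightarrow> continuous_map T euclidean f"
  by (simp add: cfun_def)

lemma cfun_eqI: "f \<in> cfun \<Longrightarrow> g \<in> cfun \<Longrightarrow> (\<And>x. x \<in> carrier G \<Longrightarrow> f x = g x) \<Longrightarrow> f = g"
  by (rule ext) (metis (mono_tags, lifting) cfun_def mem_Collect_eq)

lemma cfun_add: "f \<in> cfun \<Longrightarrow> g \<in> cfun \<Longrightarrow> (\<lambda>x. f x + g x) \<in> cfun"
  by (auto simp: cfun_def intro: continuous_map_add)

lemma cfun_diff: "f \<in> cfun \<Longrightarrow> g \<in> cfun \<Longrightarrow> (\<lambda>x. f x - g x) \<in> cfun"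
  by (auto simp: cfun_def intro: continuous_map_diff)

lemma cfun_cmult: "f \<in> cfun \<Longrightarrow> (\<lambda>x. c * f x) \<in> cfun"
  by (auto simp: cfun_def intro: continuous_map_cmult)

lemma continuous_conv_kernel:
  assumes "f \<in> cfun" "g \<in> cfun" "continuous_map Z T u" "continuous_map Z T v"
  shows "continuous_map Z euclidean (\<lambda>z. f (u z \<otimes> inv (v z)) * g (v z))"
  using assms
  by (intro continuous_map_mult_algebra continuous_map_compose2[OF cfun_continuous] continuous_map_mult
      continuous_map_inverse) auto

lemma continuous_id: "continuous_map T T (\<lambda>x. x)"
  using continuous_map_id[of T] by (simp add: id_def)

lemma continuous_const: "c \<in> carrier G \<Longrightarrow> continuous_map Z T (\<lambda>x. c)"
  by (simp add: topspace_eq)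

lemma conv_closed:
  assumes "f \<in> cfun" "g \<in> cfun"
  shows "conv f g \<in> cfun"
proof -
  have "continuous_map (prod_topology T T) euclidean (\<lambda>z. f (fst z \<otimes> inv (snd z)) * g (snd z))"
    by (intro continuous_conv_kernel assms continuous_map_fst continuous_map_snd)
  then have "continuous_map T euclidean (\<lambda>x. mean (\<lambda>y. f (x \<otimes> inv y) * g y))"
    by (intro mean_parameter_continuous) (simp add: case_prod_unfold)
  then have "continuous_map T euclidean (conv f g)"
    by (rule continuous_map_eq) (simp add: conv_def topspace_eq)
  then show ?thesis by (simp add: cfun_def conv_def)
qed

lemma mean_reflect:
  assumes f: "continuous_map T euclidean f" and x: "x \<in> carrier G"
  shows "mean (\<lambda>y. f (x \<otimes> inv y)) = mean f"
proof -
  have "continuous_map T euclidean (\<lambda>y. f (y \<otimes> x))" by (rule continuous_map_translate[OF f x])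
  from mean_inv[OF this] have "mean (\<lambda>y. f (inv y \<otimes> x)) = mean f"
    using mean_translate[OF f x] by simp
  moreover have "mean (\<lambda>y. f (inv y \<otimes> x)) = mean (\<lambda>y. f (x \<otimes> inv y))"
    using x by (intro mean_cong) (simp add: m_comm)
  ultimately show ?thesis by simp
qed

lemma conv_commute:
  assumes f: "f \<in> cfun" and g: "g \<in> cfun"
  shows "conv f g = conv g f"
proof (rule cfun_eqI[OF conv_closed[OF f g] conv_closed[OF g f]])
  fix x assume x: "x \<in> carrier G"
  have "continuous_map T euclidean (\<lambda>y. f (x \<otimes> inv y) * g y)"
    by (intro continuous_conv_kernel f g continuous_id continuous_const x)
  from mean_reflect[OF this x]
  have "mean (\<lambda>y. f (x \<otimes> inv (x \<otimes> inv y)) * g (x \<otimes> inv y)) = mean (\<lambda>y. f (x \<otimes> inv y) * g y)" .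
  moreover have "mean (\<lambda>y. f (x \<otimes> inv (x \<otimes> inv y)) * g (x \<otimes> inv y)) = mean (\<lambda>y. g (x \<otimes> inv y) * f y)"
  proof (rule mean_cong)
    fix y assume y: "y \<in> carrier G"
    have "x \<otimes> inv (x \<otimes> inv y) = x \<otimes> (inv x \<otimes> y)" using x y by (simp add: inv_mult)
    also have "\<dots> = y" using x y by (simp add: m_assoc[symmetric])
    finally show "f (x \<otimes> inv (x \<otimes> inv y)) * g (x \<otimes> inv y) = g (x \<otimes> inv y) * f y" by simp
  qed
  ultimately show "conv f g x = conv g f x" using x by (simp add: conv_def)
qed

lemma conv_assoc:
  assumes f: "f \<in> cfun" and g: "g \<in> cfun" and h: "h \<in> cfun"
  shows "conv (conv f g) h = conv f (conv g h)"
proof (rule cfun_eqI)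
  fix x assume x: "x \<in> carrier G"
  have cfg: "continuous_map T euclidean (\<lambda>z. f (w \<otimes> inv z) * g z)" if "w \<in> carrier G" for w
    by (intro continuous_conv_kernel f g continuous_id continuous_const that)
  have cgh: "continuous_map T euclidean (\<lambda>z. g (w \<otimes> inv z) * h z)" if "w \<in> carrier G" for w
    by (intro continuous_conv_kernel g h continuous_id continuous_const that)
  \<comment> \<open>both sides are the double mean of \<open>f (x / z) * g (z / y) * h y\<close>\<close>
  have "conv (conv f g) h x = mean (\<lambda>y. conv f g (x \<otimes> inv y) * h y)"
    using x by (simp add: conv_def[of "conv f g"])
  also have "\<dots> = mean (\<lambda>y. mean (\<lambda>z. f (x \<otimes> inv z) * (g (z \<otimes> inv y) * h y)))"
  proof (rule mean_cong)
    fix y assume y: "y \<in> carrier G"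
    have xy: "x \<otimes> inv y \<in> carrier G" using x y by simp
    have "mean (\<lambda>z. f (x \<otimes> inv y \<otimes> inv z) * g z)
        = mean (\<lambda>z. f (x \<otimes> inv y \<otimes> inv (z \<otimes> inv y)) * g (z \<otimes> inv y))"
      by (rule mean_translate[symmetric, OF cfg[OF xy]]) (use y in simp)
    also have "\<dots> = mean (\<lambda>z. f (x \<otimes> inv z) * g (z \<otimes> inv y))"
    proof (rule mean_cong)
      fix z assume z: "z \<in> carrier G"
      show "f (x \<otimes> inv y \<otimes> inv (z \<otimes> inv y)) * g (z \<otimes> inv y) = f (x \<otimes> inv z) * g (z \<otimes> inv y)"
        using translate_quotient[OF x z inv_closed[OF y]] by simp
    qed
    finally have "mean (\<lambda>z. f (x \<otimes> inv y \<otimes> inv z) * g z) * h y = h y * mean (\<lambda>z. f (x \<otimes> inv z) * g (z \<otimes> inv y))" by simp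
    also have "\<dots> = mean (\<lambda>z. h y * (f (x \<otimes> inv z) * g (z \<otimes> inv y)))"
      using x y f g
      by (intro mean_cmult[symmetric] continuous_map_mult_algebra continuous_map_compose2[OF cfun_continuous]
          continuous_map_mult continuous_map_inverse continuous_id continuous_const) auto
    finally show "conv f g (x \<otimes> inv y) * h y = mean (\<lambda>z. f (x \<otimes> inv z) * (g (z \<otimes> inv y) * h y))"
      using xy by (simp add: conv_def mult_ac)
  qed
  also have "\<dots> = mean (\<lambda>z. mean (\<lambda>y. f (x \<otimes> inv z) * (g (z \<otimes> inv y) * h y)))"
  proof (rule mean_swap, simp only: case_prod_unfold)
    show "continuous_map (prod_topology T T) euclidean
        (\<lambda>p. f (x \<otimes> inv (snd p)) * (g (snd p \<otimes> inv (fst p)) * h (fst p)))"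
      using x f g h
      by (intro continuous_map_mult_algebra continuous_map_compose2[OF cfun_continuous] continuous_map_fst
          continuous_map_snd continuous_map_mult continuous_map_inverse continuous_const)
  qed
  also have "\<dots> = conv f (conv g h) x"
    using x by (simp add: conv_def mean_cmult cgh cong: mean_cong)
  finally show "conv (conv f g) h x = conv f (conv g h) x" .
qed (intro conv_closed f g h)+

lemma conv_add_right:
  assumes "f \<in> cfun" "g \<in> cfun" "h \<in> cfun"
  shows "conv f (\<lambda>x. g x + h x) = (\<lambda>x. conv f g x + conv f h x)"
proof
  fix x
  have "continuous_map T euclidean (\<lambda>y. f (x \<otimes> inv y) * g y)"
    "continuous_map T euclidean (\<lambda>y. f (x \<otimes> inv y) * h y)" if "x \<in> carrier G"
    by (intro continuous_conv_kernel assms continuous_id continuous_const that)+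
  then show "conv f (\<lambda>x. g x + h x) x = conv f g x + conv f h x"
    by (simp add: conv_def distrib_left mean_add)
qed

lemma conv_cmult_right:
  assumes "f \<in> cfun" "g \<in> cfun"
  shows "conv f (\<lambda>x. c * g x) = (\<lambda>x. c * conv f g x)"
proof
  fix x
  have "continuous_map T euclidean (\<lambda>y. f (x \<otimes> inv y) * g y)" if "x \<in> carrier G"
    by (intro continuous_conv_kernel assms continuous_id continuous_const that)
  from mean_cmult[OF this] show "conv f (\<lambda>x. c * g x) x = c * conv f g x"
    by (simp add: conv_def mult_ac)
qed

lemma conv_diff_right:
  assumes "f \<in> cfun" "g \<in> cfun" "h \<in> cfun"
  shows "conv f (\<lambda>x. g x - h x) = (\<lambda>x. conv f g x - conv f h x)"
  using conv_add_right[OF assms(1,2) cfun_cmult[OF assms(3), of "-1"]] conv_cmult_right[OF assms(1,3), of "-1"]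
  by simp

definition translate :: "'a \<Rightarrow> ('a \<Rightarrow> complex) \<Rightarrow> 'a \<Rightarrow> complex" where
  "translate a f x = (if x \<in> carrier G then f (x \<otimes> a) else 0)"

lemma cfun_translate: "f \<in> cfun \<Longrightarrow> a \<in> carrier G \<Longrightarrow> translate a f \<in> cfun"
  unfolding cfun_def
  by (auto simp: translate_def intro: continuous_map_eq[OF continuous_map_translate] simp: topspace_eq)

lemma conv_translate:
  assumes f: "f \<in> cfun" and g: "g \<in> cfun" and a: "a \<in> carrier G"
  shows "conv f (translate a g) = translate a (conv f g)"
proof (rule cfun_eqI[OF conv_closed[OF f cfun_translate[OF g a]] cfun_translate[OF conv_closed[OF f g] a]])
  fix x assume x: "x \<in> carrier G"
  have "continuous_map T euclidean (\<lambda>y. f (x \<otimes> a \<otimes> inv y) * g y)"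
    using x a by (intro continuous_conv_kernel f g continuous_id continuous_const) auto
  from mean_translate[OF this a]
  have "mean (\<lambda>y. f (x \<otimes> a \<otimes> inv (y \<otimes> a)) * g (y \<otimes> a)) = conv f g (x \<otimes> a)"
    using x a by (simp add: conv_def)
  moreover have "mean (\<lambda>y. f (x \<otimes> a \<otimes> inv (y \<otimes> a)) * g (y \<otimes> a)) = mean (\<lambda>y. f (x \<otimes> inv y) * translate a g y)"
  proof (rule mean_cong)
    fix y assume y: "y \<in> carrier G"
    show "f (x \<otimes> a \<otimes> inv (y \<otimes> a)) * g (y \<otimes> a) = f (x \<otimes> inv y) * translate a g y"
      using y translate_quotient[OF x y a] by (simp add: translate_def)
  qed
  ultimately show "conv f (translate a g) x = translate a (conv f g) x"
    using x by (simp add: translate_def conv_def)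
qed

text \<open>Convolution with a hermitian function is a self-adjoint operator.\<close>
definition hermitian :: "('a \<Rightarrow> complex) \<Rightarrow> bool" where
  "hermitian f \<longleftrightarrow> (\<forall>x\<in>carrier G. f (inv x) = cnj (f x))"

lemma hermitian_conv:
  assumes f: "f \<in> cfun" "hermitian f" and g: "g \<in> cfun" "hermitian g"
  shows "hermitian (conv f g)"
  unfolding hermitian_def
proof
  fix x assume x: "x \<in> carrier G"
  have c: "continuous_map T euclidean (\<lambda>y. f (x \<otimes> inv y) * g y)"
    by (intro continuous_conv_kernel f g continuous_id continuous_const x)
  have c': "continuous_map T euclidean (\<lambda>y. f (inv x \<otimes> inv y) * g y)"
    using x by (intro continuous_conv_kernel f g continuous_id continuous_const) simp
  have "conv f g (inv x) = mean (\<lambda>y. f (inv x \<otimes> inv (inv y)) * g (inv y))"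
    using x mean_inv[OF c'] by (simp add: conv_def)
  also have "\<dots> = mean (\<lambda>y. cnj (f (x \<otimes> inv y) * g y))"
  proof (rule mean_cong)
    fix y assume y: "y \<in> carrier G"
    have "inv x \<otimes> inv (inv y) = inv (x \<otimes> inv y)" using x y by (simp add: inv_mult)
    then show "f (inv x \<otimes> inv (inv y)) * g (inv y) = cnj (f (x \<otimes> inv y) * g y)"
      using f(2) g(2) x y by (simp add: hermitian_def del: inv_inv)
  qed
  also have "\<dots> = cnj (conv f g x)" using x mean_cnj[OF c] by (simp add: conv_def)
  finally show "conv f g (inv x) = cnj (conv f g x)" .
qed

definition inner2 :: "('a \<Rightarrow> complex) \<Rightarrow> ('a \<Rightarrow> complex) \<Rightarrow> complex" where
  "inner2 f g = mean (\<lambda>x. cnj (f x) * g x)"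

definition norm2 :: "('a \<Rightarrow> complex) \<Rightarrow> real" where
  "norm2 f = Re (inner2 f f)"

text \<open>Evaluating a convolution at the unit turns norms of iterated convolutions into values of
  convolution powers.\<close>
lemma conv_one:
  assumes "hermitian f"
  shows "conv f g \<one> = inner2 f g"
  using assms by (auto simp: conv_def inner2_def hermitian_def intro!: mean_cong)

lemma continuous_inner2:
  "\<lbrakk>continuous_map T euclidean f; continuous_map T euclidean g\<rbrakk> \<Longrightarrow> continuous_map T euclidean (\<lambda>x. cnj (f x) * g x)"
  by (intro continuous_map_mult_algebra continuous_map_cnj)

lemma inner2_self:
  assumes f: "continuous_map T euclidean f"
  shows "inner2 f f = of_real (norm2 f)" "norm2 f \<ge> 0"
    "\<And>x. x \<in> carrier G \<Longrightarrow> f x \<noteq> 0 \<Longrightarrow> norm2 f > 0"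
proof -
  have eq: "(\<lambda>x. cnj (f x) * f x) = (\<lambda>x. of_real ((norm (f x))\<^sup>2))"
    by (metis complex_norm_square mult.commute of_real_power)
  have c: "continuous_map T euclideanreal (\<lambda>x. (norm (f x))\<^sup>2)"
    using f by (simp add: continuous_map_atin tendsto_norm tendsto_power)
  show "inner2 f f = of_real (norm2 f)"
    unfolding norm2_def inner2_def eq by (rule mean_real[OF c])
  show "norm2 f \<ge> 0" unfolding norm2_def inner2_def eq by (rule mean_nonneg[OF c]) simp
  show "norm2 f > 0" if "x \<in> carrier G" "f x \<noteq> 0" for x
    unfolding norm2_def inner2_def eq by (rule mean_pos[OF c _ that(1)]) (use that in auto)
qed

lemma Cauchy_Schwarz:
  assumes f: "continuous_map T euclidean f" and g: "continuous_map T euclidean g"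
  shows "(norm (inner2 f g))\<^sup>2 \<le> norm2 f * norm2 g"
proof (cases "norm2 f > 0")
  case False
  then have "f x = 0" if "x \<in> carrier G" for x using inner2_self(3)[OF f that] by blast
  then have "inner2 f g = mean (\<lambda>x. 0)" unfolding inner2_def by (intro mean_cong) simp
  then show ?thesis using False inner2_self(2)[OF f] inner2_self(2)[OF g] by simp
next
  case True
  define c where "c = inner2 f g / norm2 f"
  have cs: "continuous_map T euclidean (\<lambda>x. g x - c * f x)"
    by (intro continuous_map_diff continuous_map_cmult f g)
  have "inner2 (\<lambda>x. g x - c * f x) (\<lambda>x. g x - c * f x)
      = mean (\<lambda>x. (cnj (g x) * g x - c * cnj (cnj (f x) * g x)) - (cnj c * (cnj (f x) * g x) - (cnj c * c) * (cnj (f x) * f x)))"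
    unfolding inner2_def by (intro mean_cong) (simp add: algebra_simps)
  also have "\<dots> = (inner2 g g - c * cnj (inner2 f g)) - (cnj c * inner2 f g - (cnj c * c) * inner2 f f)"
    unfolding inner2_def
    by (simp add: mean_diff mean_cmult mean_cnj[symmetric] continuous_inner2 f g continuous_map_diff
        continuous_map_cmult continuous_map_cnj del: complex_cnj_mult complex_cnj_cnj)
  also have "\<dots> = inner2 g g - c * cnj (inner2 f g)"
    using True by (simp add: inner2_self(1)[OF f] c_def)
  also have "c * cnj (inner2 f g) = of_real ((norm (inner2 f g))\<^sup>2 / norm2 f)"
    by (simp add: c_def complex_norm_square[symmetric])
  finally have "norm2 (\<lambda>x. g x - c * f x) = norm2 g - (norm (inner2 f g))\<^sup>2 / norm2 f"
    by (simp add: norm2_def)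
  then have "(norm (inner2 f g))\<^sup>2 / norm2 f \<le> norm2 g" using inner2_self(2)[OF cs] by linarith
  then show ?thesis using True by (simp add: pos_divide_le_eq mult.commute)
qed

text \<open>The reason why limits in the mean square become uniform limits after a convolution.\<close>
lemma norm_conv_le:
  assumes f: "f \<in> cfun" and g: "g \<in> cfun" and x: "x \<in> carrier G"
  shows "(norm (conv f g x))\<^sup>2 \<le> norm2 f * norm2 g"
proof -
  have c: "continuous_map T euclidean (\<lambda>y. f (x \<otimes> inv y))"
    using x f by (intro continuous_map_compose2[OF cfun_continuous] continuous_map_mult continuous_map_inverse
        continuous_id continuous_const)
  have "conv f g x = inner2 (\<lambda>y. cnj (f (x \<otimes> inv y))) g" using x by (simp add: conv_def inner2_def)
  moreover have "norm2 (\<lambda>y. cnj (f (x \<otimes> inv y))) = norm2 f"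
    using mean_reflect[OF continuous_inner2[OF cfun_continuous[OF f] cfun_continuous[OF f]] x]
    by (simp add: norm2_def inner2_def mult.commute)
  ultimately show ?thesis
    using Cauchy_Schwarz[OF continuous_map_cnj[OF c] cfun_continuous[OF g]] by simp
qed

lemma norm2_le:
  assumes f: "continuous_map T euclidean f" and B: "\<And>x. x \<in> carrier G \<Longrightarrow> (norm (f x))\<^sup>2 \<le> B"
  shows "norm2 f \<le> B"
proof -
  have "norm (inner2 f f) \<le> B"
    unfolding inner2_def using B
    by (intro norm_mean_le continuous_inner2 f) (simp add: norm_mult power2_eq_square)
  then show ?thesis using inner2_self[OF f] by simp
qed

lemma norm2_conv_le:
  assumes "f \<in> cfun" "g \<in> cfun"
  shows "norm2 (conv f g) \<le> norm2 f * norm2 g"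
  using assms by (intro norm2_le cfun_continuous conv_closed norm_conv_le)

end

section \<open>Characters separate the points of a compact abelian group\<close>

context compact_abelian_group
begin

lemma hermitian_one:
  assumes "hermitian f"
  shows "f \<one> = of_real (Re (f \<one>))"
proof -
  have "f (inv \<one>) = cnj (f \<one>)" using assms unfolding hermitian_def by blast
  then show ?thesis by (simp add: complex_eq_iff)
qed

lemma mean_uniform_limit:
  assumes f: "\<And>n. continuous_map T euclidean (f n)" and g: "continuous_map T euclidean g"
    and lim: "uniform_limit (carrier G) f g sequentially"
  shows "(\<lambda>n. mean (f n)) \<longlonglongrightarrow> mean g"
proof (rule LIMSEQ_I)
  fix r :: real assume "r > 0"
  then have "\<forall>\<^sub>F n in sequentially. \<forall>x\<in>carrier G. dist (f n x) (g x) < r / 2"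
    using lim unfolding uniform_limit_iff by (meson half_gt_zero)
  then obtain N where N: "\<And>n x. n \<ge> N \<Longrightarrow> x \<in> carrier G \<Longrightarrow> dist (f n x) (g x) < r / 2"
    unfolding eventually_sequentially by blast
  have "norm (mean (f n) - mean g) < r" if "n \<ge> N" for n
  proof -
    have "norm (mean (\<lambda>x. f n x - g x)) \<le> r / 2"
      using N[OF that] by (intro norm_mean_le continuous_map_diff f g) (simp add: dist_norm less_imp_le)
    then show ?thesis using \<open>r > 0\<close> mean_diff[OF f g] by simp
  qed
  then show "\<exists>no. \<forall>n\<ge>no. norm (mean (f n) - mean g) < r" by blast
qed

lemma bounded_cfun:
  assumes "continuous_map T euclidean f"
  shows "bounded (f ` carrier G)"
proof -
  have "compactin euclidean (f ` topspace T)"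
    using compact assms unfolding compact_space_def by (rule image_compactin)
  then show ?thesis by (simp add: topspace_eq compact_imp_bounded)
qed

lemma conv_uniform_limit:
  assumes f: "\<And>n. f n \<in> cfun" "f' \<in> cfun" "uniform_limit (carrier G) f f' sequentially"
    and g: "\<And>n. g n \<in> cfun" "g' \<in> cfun" "uniform_limit (carrier G) g g' sequentially"
    and x: "x \<in> carrier G"
  shows "(\<lambda>n. conv (f n) (g n) x) \<longlonglongrightarrow> conv f' g' x"
proof -
  have "uniform_limit (carrier G) (\<lambda>n y. f n (x \<otimes> inv y)) (\<lambda>y. f' (x \<otimes> inv y)) sequentially"
    unfolding uniform_limit_iff
  proof (intro allI impI)
    fix \<epsilon> :: real assume "\<epsilon> > 0"
    then have "\<forall>\<^sub>F n in sequentially. \<forall>y\<in>carrier G. dist (f n y) (f' y) < \<epsilon>"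
      using f(3) unfolding uniform_limit_iff by blast
    then show "\<forall>\<^sub>F n in sequentially. \<forall>y\<in>carrier G. dist (f n (x \<otimes> inv y)) (f' (x \<otimes> inv y)) < \<epsilon>"
      by (rule eventually_mono) (use x in simp)
  qed
  moreover have "bounded ((\<lambda>y. f' (x \<otimes> inv y)) ` carrier G)"
    using bounded_cfun[OF cfun_continuous[OF f(2)]] x by (auto simp: bounded_iff)
  ultimately have "uniform_limit (carrier G) (\<lambda>n y. f n (x \<otimes> inv y) * g n y) (\<lambda>y. f' (x \<otimes> inv y) * g' y) sequentially"
    using g(3) bounded_cfun[OF cfun_continuous[OF g(2)]] by (intro uniform_lim_mult)
  then have "(\<lambda>n. mean (\<lambda>y. f n (x \<otimes> inv y) * g n y)) \<longlonglongrightarrow> mean (\<lambda>y. f' (x \<otimes> inv y) * g' y)"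
    by (intro mean_uniform_limit continuous_conv_kernel f g continuous_id continuous_const x)
  then show ?thesis using x by (simp add: conv_def)
qed

text \<open>Power iteration. In terms of the Fourier coefficients \<open>c\<close> of \<open>k\<close>, the even convolution powers
  \<open>P n\<close> of \<open>k\<close> have the coefficients \<open>c ^ (2 n + 2)\<close>; divided by powers of the largest value
  \<open>\<kappa>\<close> of \<open>c\<^sup>2\<close>, they tend to the sum \<open>e\<close> of the finitely many characters at which it is attained.
  No characters are needed to see this. The squared norms \<open>s n\<close> of the powers are logarithmically convex
  by the Cauchy-Schwarz inequality, so their ratios increase to some \<open>\<kappa>\<close>, and they are
  submultiplicative, so \<open>s n\<close> is at least \<open>\<kappa> ^ Suc n\<close>. Hence the normalised squared norms \<open>t n\<close>
  decrease to a limit \<open>\<tau> \<ge> 1\<close>. The inner product of two normalised powers is again one of the \<open>t n\<close>,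
  so the normalised powers are Cauchy in the mean square, and uniformly after one more convolution.\<close>
lemma top_spectral_idempotent:
  assumes k: "k \<in> cfun" "hermitian k" and nz: "k \<noteq> (\<lambda>x. 0)"
  obtains e \<kappa> where "e \<in> cfun" "hermitian e" "conv e e = e" "e \<noteq> (\<lambda>x. 0)"
    "\<kappa> > 0" "conv (conv k k) e = (\<lambda>x. of_real \<kappa> * e x)"
proof -
  define K where "K n = ((conv k) ^^ n) k" for n
  have K0: "K 0 = k" and KSuc: "K (Suc n) = conv k (K n)" for n by (simp_all add: K_def)
  have Kc: "K n \<in> cfun" for n by (induction n) (simp_all add: K0 KSuc conv_closed k)
  have Kh: "hermitian (K n)" for n by (induction n) (simp_all add: K0 KSuc hermitian_conv k Kc)
  have KK: "conv (K n) (K m) = K (Suc (n + m))" for n m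
    by (induction n) (simp_all add: K0 KSuc conv_assoc k Kc)
  define s where "s n = norm2 (K n)" for n
  define P where "P n = K (Suc (n + n))" for n
  have Pc: "P n \<in> cfun" and Ph: "hermitian (P n)" for n by (simp_all add: P_def Kc Kh)
  have inner: "inner2 (K n) (K m) = K (Suc (n + m)) \<one>" for n m
    using conv_one[OF Kh] KK by metis
  have P1: "P n \<one> = of_real (s n)" for n
    using inner2_self(1)[OF cfun_continuous[OF Kc], of n] inner[of n n] by (simp add: P_def s_def)
  have PP: "conv (P n) (P m) = P (Suc (n + m))" for n m
  proof -
    have "Suc (Suc (n + n) + Suc (m + m)) = Suc (Suc (n + m) + Suc (n + m))" by simp
    then show ?thesis unfolding P_def KK by (simp add: add_ac)
  qed
  have innerP: "inner2 (P n) (P m) = of_real (s (Suc (n + m)))" for n m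
    using conv_one[OF Ph, of n "P m"] by (simp add: PP P1)
  have spos_iff: "s n > 0" if Kn: "K n \<noteq> (\<lambda>x. 0)" for n
  proof -
    obtain x where x: "K n x \<noteq> 0" using Kn by blast
    then have "x \<in> carrier G" using Kc[of n] by (auto simp: cfun_def)
    then show ?thesis unfolding s_def using inner2_self(3)[OF cfun_continuous[OF Kc]] x by blast
  qed
  have conv0: "conv k (\<lambda>x. 0) = (\<lambda>x. 0)" by (simp add: conv_def fun_eq_iff)
  have "\<exists>m\<ge>n. K m \<noteq> (\<lambda>x. 0)" for n
  proof (induction n)
    case 0
    then show ?case using nz K0 by (metis le0)
  next
    case (Suc n)
    then obtain m where m: "m \<ge> n" "K m \<noteq> (\<lambda>x. 0)" by blast
    have "P m \<one> \<noteq> 0" using spos_iff[OF m(2)] by (simp add: P1)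
    then have "K (Suc (m + m)) \<noteq> (\<lambda>x. 0)" unfolding P_def by metis
    moreover have "Suc (m + m) \<ge> Suc n" using m(1) by simp
    ultimately show ?case by blast
  qed
  moreover have "K m = (\<lambda>x. 0)" if "K n = (\<lambda>x. 0)" "n \<le> m" for n m
    using that(2,1) by (induction m rule: dec_induct) (simp_all add: KSuc conv0)
  ultimately have "K n \<noteq> (\<lambda>x. 0)" for n by blast
  then have spos: "s n > 0" for n using spos_iff by blast
  have s_nonzero: "s n \<noteq> 0" for n using spos[of n] by simp
  have submult: "s (Suc (n + m)) \<le> s n * s m" for n m
    unfolding s_def KK[symmetric] by (rule norm2_conv_le[OF Kc Kc])
  have logconvex: "(s (Suc n))\<^sup>2 \<le> s n * s (Suc (Suc n))" for n
  proof -
    have "inner2 (K n) (K (Suc (Suc n))) = P (Suc n) \<one>" unfolding inner P_def by simp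
    then have "(norm (P (Suc n) \<one>))\<^sup>2 \<le> s n * s (Suc (Suc n))"
      using Cauchy_Schwarz[OF cfun_continuous[OF Kc] cfun_continuous[OF Kc]] unfolding s_def by metis
    then show ?thesis by (simp add: P1)
  qed
  \<comment> \<open>the ratios of consecutive norms increase to the top eigenvalue\<close>
  define r where "r n = s (Suc n) / s n" for n
  have r_pos: "r n > 0" for n by (simp add: r_def spos)
  have r_mono: "incseq r"
  proof (rule incseq_SucI)
    fix n
    show "r n \<le> r (Suc n)"
      using logconvex[of n] spos[of n] spos[of "Suc n"] by (simp add: r_def field_simps power2_eq_square)
  qed
  have "r n \<le> s 0" for n
    using submult[of 0 n] spos[of n] by (simp add: r_def field_simps)
  then obtain \<kappa> where \<kappa>: "r \<longlonglongrightarrow> \<kappa>" "\<And>n. r n \<le> \<kappa>"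
    using incseq_convergent[OF r_mono] by blast
  have \<kappa>pos: "\<kappa> > 0" using r_pos[of 0] \<kappa>(2)[of 0] by linarith
  define t where "t n = s n / \<kappa> ^ Suc n" for n
  have t_dec: "t (Suc n) \<le> t n" for n
  proof -
    have "s (Suc n) \<le> \<kappa> * s n" using \<kappa>(2)[of n] spos[of n] by (simp add: r_def pos_divide_le_eq)
    then have "s (Suc n) / \<kappa> ^ Suc (Suc n) \<le> \<kappa> * s n / \<kappa> ^ Suc (Suc n)"
      using \<kappa>pos by (intro divide_right_mono) auto
    then show ?thesis using \<kappa>pos by (simp add: t_def)
  qed
  have t_ge1: "t n \<ge> 1" for n
  proof -
    have lim: "(\<lambda>m. s (m + j) / s m) \<longlonglongrightarrow> \<kappa> ^ j" for j
    proof (induction j)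
      case 0
      have "s m / s m = 1" for m using spos[of m] by simp
      then show ?case by simp
    next
      case (Suc j)
      have "(\<lambda>m. r (m + j) * (s (m + j) / s m)) \<longlonglongrightarrow> \<kappa> * \<kappa> ^ j"
        by (intro tendsto_mult LIMSEQ_ignore_initial_segment[OF \<kappa>(1)] Suc)
      moreover have "(\<lambda>m. r (m + j) * (s (m + j) / s m)) = (\<lambda>m. s (m + Suc j) / s m)"
        by (simp add: r_def s_nonzero fun_eq_iff)
      ultimately show ?case by simp
    qed
    have "\<kappa> ^ Suc n \<le> s n"
    proof (rule LIMSEQ_le_const2[OF lim[of "Suc n"]], intro exI allI impI)
      fix m
      show "s (m + Suc n) / s m \<le> s n"
        using submult[of m n] spos[of m] by (simp add: pos_divide_le_eq mult.commute)
    qed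
    then show ?thesis using \<kappa>pos by (simp add: t_def)
  qed
  have "decseq t" by (rule decseq_SucI) (rule t_dec)
  then obtain \<tau> where \<tau>: "t \<longlonglongrightarrow> \<tau>"
    using decseq_convergent[of t 1] t_ge1 by blast
  have \<tau>1: "\<tau> \<ge> 1" using LIMSEQ_le_const[OF \<tau>, of 1] t_ge1 by blast
  define u where "u n x = P n x / \<kappa> ^ Suc n" for n x
  have u_eq: "u n = (\<lambda>x. of_real (1 / \<kappa> ^ Suc n) * P n x)" for n by (simp add: u_def fun_eq_iff)
  have uc: "u n \<in> cfun" for n unfolding u_eq by (rule cfun_cmult[OF Pc])
  have uh: "hermitian (u n)" for n using Ph[of n] by (simp add: u_def hermitian_def)
  have inneru: "inner2 (u n) (u m) = of_real (t (Suc (n + m)))" for n m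
  proof -
    have "inner2 (u n) (u m) = mean (\<lambda>x. of_real (1 / \<kappa> ^ Suc n * (1 / \<kappa> ^ Suc m)) * (cnj (P n x) * P m x))"
      unfolding inner2_def u_eq by (intro mean_cong) simp
    also have "\<dots> = of_real (1 / \<kappa> ^ Suc n * (1 / \<kappa> ^ Suc m)) * inner2 (P n) (P m)"
      unfolding inner2_def by (intro mean_cmult continuous_inner2 cfun_continuous Pc)
    also have "\<dots> = of_real (t (Suc (n + m)))"
      by (simp add: innerP t_def power_add mult_ac)
    finally show ?thesis .
  qed
  have norm2_diff: "norm2 (\<lambda>x. u n x - u m x) = t (Suc (n + n)) - 2 * t (Suc (n + m)) + t (Suc (m + m))" for n m
  proof -
    have c: "continuous_map T euclidean (u n)" for n by (rule cfun_continuous[OF uc])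
    have "inner2 (\<lambda>x. u n x - u m x) (\<lambda>x. u n x - u m x)
        = mean (\<lambda>x. (cnj (u n x) * u n x - cnj (u n x) * u m x) - (cnj (u m x) * u n x - cnj (u m x) * u m x))"
      unfolding inner2_def by (intro mean_cong) (simp add: algebra_simps)
    also have "\<dots> = (inner2 (u n) (u n) - inner2 (u n) (u m)) - (inner2 (u m) (u n) - inner2 (u m) (u m))"
      unfolding inner2_def
      by (simp add: mean_diff continuous_map_diff continuous_inner2 c)
    finally show ?thesis by (simp add: norm2_def inneru add.commute)
  qed
  have Pu: "conv (conv k k) (u n) = (\<lambda>x. of_real \<kappa> * u (Suc n) x)" for n
  proof -
    have kk: "conv k k = P 0" by (simp add: P_def K_def)
    have "conv (conv k k) (u n) = (\<lambda>x. of_real (1 / \<kappa> ^ Suc n) * conv (P 0) (P n) x)"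
      unfolding kk u_eq by (rule conv_cmult_right[OF Pc Pc])
    also have "conv (P 0) (P n) = P (Suc n)" using PP[of 0 n] by simp
    finally have "conv (conv k k) (u n) = (\<lambda>x. of_real (1 / \<kappa> ^ Suc n) * P (Suc n) x)" .
    then show ?thesis using \<kappa>pos by (simp add: u_def fun_eq_iff)
  qed
  have sup_le: "norm (u (Suc n) x - u (Suc m) x) \<le> sqrt (norm2 (conv k k) * norm2 (\<lambda>x. u n x - u m x)) / \<kappa>"
    if x: "x \<in> carrier G" for n m x
  proof -
    have kk: "conv k k \<in> cfun" by (intro conv_closed k)
    have "conv (conv k k) (\<lambda>x. u n x - u m x) x = of_real \<kappa> * (u (Suc n) x - u (Suc m) x)"
      by (simp add: conv_diff_right[OF kk uc uc] Pu right_diff_distrib)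
    moreover have "norm (conv (conv k k) (\<lambda>x. u n x - u m x) x) \<le> sqrt (norm2 (conv k k) * norm2 (\<lambda>x. u n x - u m x))"
      by (rule real_le_rsqrt) (rule norm_conv_le[OF kk cfun_diff[OF uc uc] x])
    ultimately show ?thesis
      using \<kappa>pos by (simp add: norm_mult pos_le_divide_eq mult.commute)
  qed
  have Cauchy: "uniformly_Cauchy_on (carrier G) (\<lambda>n. u (Suc n))"
    unfolding uniformly_Cauchy_on_def
  proof (intro allI impI)
    fix \<epsilon> :: real assume \<epsilon>: "\<epsilon> > 0"
    define C where "C = norm2 (conv k k) + 1"
    have C: "C > 0" "norm2 (conv k k) \<le> C"
      using inner2_self(2)[OF cfun_continuous[OF conv_closed[OF k(1) k(1)]]] by (simp_all add: C_def)
    define \<delta> where "\<delta> = (\<epsilon> * \<kappa>)\<^sup>2 / (4 * C)"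
    have \<delta>: "\<delta> > 0" using \<epsilon> \<kappa>pos C by (simp add: \<delta>_def)
    obtain M where M: "\<And>n. n \<ge> M \<Longrightarrow> \<bar>t n - \<tau>\<bar> < \<delta> / 4"
      using LIMSEQ_D[OF \<tau>, of "\<delta> / 4"] \<delta> by auto
    have "dist (u (Suc m) x) (u (Suc n) x) < \<epsilon>" if "m \<ge> M" "n \<ge> M" and x: "x \<in> carrier G" for m n x
    proof -
      have "\<bar>t (Suc (m + m)) - \<tau>\<bar> < \<delta> / 4" "\<bar>t (Suc (m + n)) - \<tau>\<bar> < \<delta> / 4" "\<bar>t (Suc (n + n)) - \<tau>\<bar> < \<delta> / 4"
        by (rule M, use that in linarith)+
      then have "norm2 (\<lambda>x. u m x - u n x) \<le> \<delta>" unfolding norm2_diff by linarith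
      then have "norm2 (conv k k) * norm2 (\<lambda>x. u m x - u n x) \<le> C * \<delta>"
        using C inner2_self(2)[OF cfun_continuous[OF cfun_diff[OF uc uc]], of m n] by (intro mult_mono) auto
      also have "\<dots> = (\<epsilon> * \<kappa> / 2)\<^sup>2" using C by (simp add: \<delta>_def power2_eq_square)
      finally have "sqrt (norm2 (conv k k) * norm2 (\<lambda>x. u m x - u n x)) \<le> \<epsilon> * \<kappa> / 2"
        using \<epsilon> \<kappa>pos by (intro real_le_lsqrt) auto
      then have "sqrt (norm2 (conv k k) * norm2 (\<lambda>x. u m x - u n x)) / \<kappa> \<le> \<epsilon> / 2"
        using \<kappa>pos by (simp add: pos_divide_le_eq)
      then show ?thesis using sup_le[OF x, of m n] \<epsilon> unfolding dist_norm by linarith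
    qed
    then show "\<exists>M. \<forall>x\<in>carrier G. \<forall>m\<ge>M. \<forall>n\<ge>M. dist (u (Suc m) x) (u (Suc n) x) < \<epsilon>" by blast
  qed
  then obtain e0 where e0: "uniform_limit (carrier G) (\<lambda>n. u (Suc n)) e0 sequentially"
    using Cauchy_uniformly_convergent unfolding uniformly_convergent_on_def by blast
  define e where "e x = (if x \<in> carrier G then e0 x else 0)" for x
  have lim_Suc: "uniform_limit (carrier G) (\<lambda>n. u (Suc n)) e sequentially"
    using e0 by (simp add: uniform_limit_iff e_def)
  have lim: "uniform_limit (carrier G) u e sequentially"
    using lim_Suc unfolding uniform_limit_iff eventually_sequentially_Suc[of "\<lambda>n. \<forall>x\<in>carrier G. dist (u n x) (e x) < _"] .
  have ce: "continuous_map T euclidean e"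
    unfolding mtopology_is_euclidean[symmetric]
  proof (rule Met_TC.continuous_map_uniform_limit[where F = sequentially and f = u])
    show "\<forall>\<^sub>F n in sequentially. continuous_map T Met_TC.mtopology (u n)"
      using cfun_continuous[OF uc] by (simp add: mtopology_is_euclidean)
    show "\<forall>\<^sub>F n in sequentially. \<forall>x\<in>topspace T. e x \<in> UNIV \<and> dist (u n x) (e x) < \<epsilon>" if "\<epsilon> > 0" for \<epsilon>
      using lim that by (simp add: uniform_limit_iff topspace_eq)
  qed simp
  have ecf: "e \<in> cfun" using ce by (simp add: cfun_def e_def)
  have pt: "(\<lambda>n. u n x) \<longlonglongrightarrow> e x" if "x \<in> carrier G" for x
    using tendsto_uniform_limitI[OF lim that] .
  have eh: "hermitian e"
    unfolding hermitian_def
  proof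
    fix x assume x: "x \<in> carrier G"
    have "(\<lambda>n. cnj (u n x)) \<longlonglongrightarrow> cnj (e x)" by (intro tendsto_cnj pt x)
    moreover have "u n (inv x) = cnj (u n x)" for n using uh[of n] x by (simp add: hermitian_def)
    ultimately have "(\<lambda>n. u n (inv x)) \<longlonglongrightarrow> cnj (e x)" by simp
    then show "e (inv x) = cnj (e x)" using LIMSEQ_unique pt[OF inv_closed[OF x]] by blast
  qed
  have uu: "conv (u n) (u n) = u (Suc (n + n))" for n
  proof -
    have "conv (u n) (u n) = (\<lambda>x. of_real (1 / \<kappa> ^ Suc n) * conv (u n) (P n) x)"
      by (subst (2) u_eq) (rule conv_cmult_right[OF uc Pc])
    also have "conv (u n) (P n) = conv (P n) (u n)" by (rule conv_commute[OF uc Pc])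
    also have "\<dots> = (\<lambda>x. of_real (1 / \<kappa> ^ Suc n) * conv (P n) (P n) x)"
      unfolding u_eq by (rule conv_cmult_right[OF Pc Pc])
    also have "conv (P n) (P n) = P (Suc (n + n))" by (rule PP)
    finally have *: "conv (u n) (u n) =
      (\<lambda>x. of_real (1 / \<kappa> ^ Suc n) * (of_real (1 / \<kappa> ^ Suc n) * P (Suc (n + n)) x))" .
    show ?thesis unfolding * by (simp add: fun_eq_iff u_def power_add mult_ac)
  qed
  have idem: "conv e e = e"
  proof (rule cfun_eqI[OF conv_closed[OF ecf ecf] ecf])
    fix x assume x: "x \<in> carrier G"
    have "(\<lambda>n. u (Suc (n + n)) x) \<longlonglongrightarrow> conv e e x"
      using conv_uniform_limit[OF uc ecf lim uc ecf lim x] by (simp add: uu)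
    moreover have "(\<lambda>n. u (Suc (n + n)) x) \<longlonglongrightarrow> e x"
      using LIMSEQ_subseq_LIMSEQ[OF pt[OF x], of "\<lambda>n. Suc (n + n)"] by (simp add: strict_mono_def o_def)
    ultimately show "conv e e x = e x" by (rule LIMSEQ_unique)
  qed
  have eig: "conv (conv k k) e = (\<lambda>x. of_real \<kappa> * e x)"
  proof (rule cfun_eqI[OF conv_closed[OF conv_closed[OF k(1) k(1)] ecf] cfun_cmult[OF ecf]])
    fix x assume x: "x \<in> carrier G"
    have "(\<lambda>n. of_real \<kappa> * u (Suc n) x) \<longlonglongrightarrow> conv (conv k k) e x"
      using conv_uniform_limit[OF conv_closed[OF k(1) k(1)] conv_closed[OF k(1) k(1)] uniform_limit_const uc ecf lim x]
      by (simp add: Pu)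
    moreover have "(\<lambda>n. of_real \<kappa> * u (Suc n) x) \<longlonglongrightarrow> of_real \<kappa> * e x"
      by (intro tendsto_mult tendsto_const LIMSEQ_Suc pt x)
    ultimately show "conv (conv k k) e x = of_real \<kappa> * e x" by (rule LIMSEQ_unique)
  qed
  have "(\<lambda>n. complex_of_real (t n)) \<longlonglongrightarrow> e \<one>" using pt[OF one_closed] by (simp add: u_def P1 t_def)
  then have "e \<one> = of_real \<tau>" using \<tau> LIMSEQ_unique tendsto_of_real by blast
  then have "e \<noteq> (\<lambda>x. 0)" using \<tau>1 by (metis of_real_eq_0_iff not_one_le_zero)
  with ecf eh idem \<kappa>pos eig show thesis by (intro that)
qed

text \<open>For a sum of characters, \<open>e \<one>\<close> counts the summands. The bound makes splitting an idempotent
  terminate.\<close>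
lemma idempotent_ge_1:
  assumes e: "e \<in> cfun" "hermitian e" "conv e e = e" "e \<noteq> (\<lambda>x. 0)"
  shows "Re (e \<one>) \<ge> 1"
proof -
  have c: "continuous_map T euclidean e" by (rule cfun_continuous[OF e(1)])
  have e1: "Re (e \<one>) = norm2 e" using conv_one[OF e(2), of e] e(3) by (simp add: norm2_def)
  obtain x where "e x \<noteq> 0" using e(4) by blast
  then have pos: "norm2 e > 0" using inner2_self(3)[OF c, of x] e(1) by (auto simp: cfun_def)
  have "norm2 e \<le> norm2 e * norm2 e"
    using norm2_conv_le[OF e(1) e(1)] e(3) by simp
  then show ?thesis using pos e1 by simp
qed

text \<open>Start with a kernel \<open>h\<close> which annihilates every character that is trivial on \<open>m\<close>, and choose, among the
  idempotents \<open>e\<close> on which convolution with \<open>h * h\<close> is a positive scalar, one whose value at the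
  unit is within \<open>1\<close> of the infimum. If a nonzero hermitian \<open>k\<close> in \<open>e * C(G)\<close> had an idempotent \<open>e'\<close> other
  than \<open>e\<close> as its limit of powers, the idempotent \<open>e - e'\<close> would have value at least \<open>1\<close> at the
  unit, so \<open>e'\<close> would undercut the infimum. Therefore \<open>k * k\<close> is a multiple of \<open>e\<close>; applying
  this to \<open>k\<close> and to \<open>k + e\<close> shows that \<open>k\<close> itself is a multiple of \<open>e\<close>. As suitable combinations of
  translates of \<open>e\<close> are hermitian, every translate of \<open>e\<close> is a multiple of \<open>e\<close>, so \<open>e\<close> is
  proportional to a character, and it is nontrivial on \<open>m\<close> because convolution with \<open>h\<close> does not
  annihilate it.\<close>
lemma characters_separate_points:
  assumes m: "m \<in> carrier G" "m \<noteq> \<one>"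
  obtains \<xi> where "continuous_map T euclidean \<xi>"
    "\<forall>x\<in>carrier G. \<forall>y\<in>carrier G. \<xi> (x \<otimes> y) = \<xi> x * \<xi> y" "\<forall>x\<in>carrier G. norm (\<xi> x) = 1" "\<xi> m \<noteq> (1::complex)"
proof -
  have "normal_space T"
    using compact Hausdorff compact_Hausdorff_or_regular_imp_normal_space by blast
  moreover have "closedin T {\<one>}" "closedin T {m}"
    using Hausdorff m by (simp_all add: closedin_Hausdorff_singleton topspace_eq)
  moreover have "disjnt {m} {\<one>}" using m by simp
  ultimately obtain f where f: "continuous_map T euclideanreal f" "f ` {m} \<subseteq> {0}" "f ` {\<one>} \<subseteq> {1}"
    using Urysohn_lemma_alt by metis
  define q where "q x = (if x \<in> carrier G then complex_of_real (f x * f (inv x)) else 0)" for x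
  have "continuous_map T euclideanreal (\<lambda>x. f x * f (inv x))"
    by (intro continuous_map_real_mult f continuous_map_compose2[OF f(1)] continuous_map_inverse continuous_id)
  then have "continuous_map T euclidean (\<lambda>x. complex_of_real (f x * f (inv x)))"
    by (simp add: continuous_map_atin tendsto_of_real del: of_real_mult)
  then have "continuous_map T euclidean q"
    by (rule continuous_map_eq) (simp add: q_def topspace_eq)
  then have qc: "q \<in> cfun" by (simp add: cfun_def q_def)
  have qh: "hermitian q" by (simp add: hermitian_def q_def)
  have q: "q \<one> = 1" "q m = 0" "q (inv m) = 0" using f m by (simp_all add: q_def)
  \<comment> \<open>the kernel \<open>h\<close> annihilates every character that is trivial on \<open>m\<close>\<close>
  define h where "h x = (2 * q x - translate m q x) - translate (inv m) q x" for x
  have hc: "h \<in> cfun"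
    unfolding h_def[abs_def] using m by (intro cfun_diff cfun_cmult cfun_translate qc) auto
  have hh: "hermitian h"
    unfolding hermitian_def
  proof
    fix x assume x: "x \<in> carrier G"
    have qinv: "q (inv x) = cnj (q x)" if "x \<in> carrier G" for x using qh that by (simp add: hermitian_def)
    have "inv x \<otimes> m = inv (x \<otimes> inv m)" "inv x \<otimes> inv m = inv (x \<otimes> m)"
      using x m by (simp_all add: inv_mult)
    then show "h (inv x) = cnj (h x)"
      using x m qinv[of x] qinv[of "x \<otimes> inv m"] qinv[of "x \<otimes> m"]
      by (simp add: h_def translate_def)
  qed
  have "h \<one> = 2" using q m by (simp add: h_def translate_def)
  then have hnz: "h \<noteq> (\<lambda>x. 0)" by (metis zero_neq_numeral)
  define E where "E = {e \<in> cfun. hermitian e \<and> conv e e = e \<and> e \<noteq> (\<lambda>x. 0) \<and>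
      (\<exists>\<kappa>::real. \<kappa> > 0 \<and> conv (conv h h) e = (\<lambda>x. of_real \<kappa> * e x))}"
  obtain e0 \<kappa>0 where "e0 \<in> cfun" "hermitian e0" "conv e0 e0 = e0" "e0 \<noteq> (\<lambda>x. 0)"
    "\<kappa>0 > 0" "conv (conv h h) e0 = (\<lambda>x. complex_of_real \<kappa>0 * e0 x)"
    using top_spectral_idempotent[OF hc hh hnz] .
  then have "e0 \<in> E" unfolding E_def by blast
  then have "E \<noteq> {}" by blast
  define \<rho> where "\<rho> = (\<lambda>e. Re (e \<one>)) ` E"
  have bdd: "bdd_below \<rho>" 
  proof (rule bdd_belowI)
    fix y assume "y \<in> \<rho>"
    then show "1 \<le> y" unfolding \<rho>_def E_def using idempotent_ge_1 by blast
  qed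
  have "\<rho> \<noteq> {}" using \<open>E \<noteq> {}\<close> by (simp add: \<rho>_def)
  then have "\<exists>y\<in>\<rho>. y < Inf \<rho> + 1" using cInf_lessD[of \<rho> "Inf \<rho> + 1"] by auto
  then obtain e where e: "e \<in> E" "Re (e \<one>) < Inf \<rho> + 1" by (auto simp: \<rho>_def)
  have min: "Re (e \<one>) < Re (e' \<one>) + 1" if "e' \<in> E" for e'
    using cInf_lower[OF _ bdd, of "Re (e' \<one>)"] e(2) that by (auto simp: \<rho>_def)
  obtain \<kappa> where ec: "e \<in> cfun" and eh: "hermitian e" and ee: "conv e e = e" and enz: "e \<noteq> (\<lambda>x. 0)"
    and \<kappa>: "\<kappa> > 0" "conv (conv h h) e = (\<lambda>x. complex_of_real \<kappa> * e x)"
    using e(1) unfolding E_def by blast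
  \<comment> \<open>minimality: the algebra \<open>e * C(G)\<close> has no smaller idempotent\<close>
  have square: "\<exists>\<mu>::complex. conv k k = (\<lambda>x. \<mu> * e x)" if k: "k \<in> cfun" "hermitian k" "conv e k = k" for k
  proof (cases "k = (\<lambda>x. 0)")
    case True
    then show ?thesis by (intro exI[of _ 0]) (simp add: conv_def fun_eq_iff)
  next
    case False
    obtain e' \<mu> where e': "e' \<in> cfun" "hermitian e'" "conv e' e' = e'" "e' \<noteq> (\<lambda>x. 0)"
      and \<mu>: "\<mu> > 0" "conv (conv k k) e' = (\<lambda>x. complex_of_real \<mu> * e' x)"
      using top_spectral_idempotent[OF k(1,2) False] .
    have kk: "conv k k \<in> cfun" by (intro conv_closed k)
    have ekk: "conv e (conv k k) = conv k k" using conv_assoc[OF ec k(1) k(1)] k(3) by simp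
    have e'_eq: "e' = (\<lambda>x. of_real (1 / \<mu>) * conv (conv k k) e' x)" using \<mu> by (simp add: fun_eq_iff)
    have ekke: "conv e (conv (conv k k) e') = conv (conv k k) e'"
      using conv_assoc[OF ec kk e'(1)] ekk by simp
    have ee': "conv e e' = e'"
      using conv_cmult_right[OF ec conv_closed[OF kk e'(1)], of "of_real (1 / \<mu>)"] ekke e'_eq by simp
    have "conv (conv h h) e' = conv (conv (conv h h) e) e'"
      using conv_assoc[OF conv_closed[OF hc hc] ec e'(1)] ee' by simp
    also have "\<dots> = conv e' (\<lambda>x. of_real \<kappa> * e x)"
      unfolding \<kappa>(2) by (rule conv_commute[OF cfun_cmult[OF ec] e'(1)])
    also have "\<dots> = (\<lambda>x. of_real \<kappa> * e' x)"
      using conv_cmult_right[OF e'(1) ec] conv_commute[OF e'(1) ec] ee' by simp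
    finally have "e' \<in> E" unfolding E_def using e' \<kappa>(1) by blast
    define d where "d x = e x - e' x" for x
    have dc: "d \<in> cfun" unfolding d_def[abs_def] by (intro cfun_diff ec e')
    have dh: "hermitian d" using eh e'(2) by (simp add: d_def hermitian_def)
    have "conv d e = d" "conv d e' = (\<lambda>x. 0)"
      using conv_diff_right[OF ec ec e'(1)] conv_diff_right[OF e'(1) ec e'(1)] conv_commute[OF dc ec]
        conv_commute[OF dc e'(1)] conv_commute[OF e'(1) ec] ee ee' e'(3)
      by (simp_all add: d_def[abs_def])
    then have "conv d d = d"
      using conv_diff_right[OF dc ec e'(1)] by (simp add: d_def[abs_def])
    then have "d = (\<lambda>x. 0)"
      using idempotent_ge_1[OF dc dh] min[OF \<open>e' \<in> E\<close>] by (force simp: d_def[of \<one>])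
    then have "e' = e" by (simp add: d_def[abs_def] fun_eq_iff)
    then have "conv (conv k k) e = (\<lambda>x. complex_of_real \<mu> * e x)" using \<mu>(2) by simp
    moreover have "conv (conv k k) e = conv k k" using conv_commute[OF kk ec] ekk by simp
    ultimately show ?thesis by auto
  qed
  have scalar: "\<exists>\<mu>::complex. \<forall>x. k x = \<mu> * e x" if k: "k \<in> cfun" "hermitian k" "conv e k = k" for k
  proof -
    obtain \<mu> where \<mu>: "conv k k = (\<lambda>x. \<mu> * e x)" using square[OF k] by blast
    define k' where "k' x = k x + e x" for x
    have k'c: "k' \<in> cfun" unfolding k'_def[abs_def] by (intro cfun_add k ec)
    have k'h: "hermitian k'" using k(2) eh by (simp add: k'_def hermitian_def)
    have ek': "conv e k' = k'"
      unfolding k'_def[abs_def] by (simp add: conv_add_right[OF ec k(1) ec] k(3) ee)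
    obtain \<nu> where \<nu>: "conv k' k' = (\<lambda>x. \<nu> * e x)" using square[OF k'c k'h ek'] by blast
    have "conv k' k' = (\<lambda>x. conv k' k x + conv k' e x)"
      unfolding k'_def[abs_def] by (rule conv_add_right[OF _ k(1) ec]) (use k'c in \<open>simp add: k'_def[abs_def]\<close>)
    also have "conv k' e = k'" using conv_commute[OF k'c ec] ek' by simp
    also have "conv k' k = (\<lambda>x. conv k k x + k x)"
      unfolding conv_commute[OF k'c k(1)] unfolding k'_def[abs_def] conv_add_right[OF k(1) k(1) ec]
      using conv_commute[OF k(1) ec] k(3) by simp
    finally have *: "conv k' k' = (\<lambda>x. (conv k k x + k x) + k' x)" .
    have "k x = ((\<nu> - \<mu> - 1) / 2) * e x" for x
    proof -
      have "\<nu> * e x = (\<mu> * e x + k x) + (k x + e x)"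
        using fun_cong[OF *, of x] fun_cong[OF \<nu>, of x] fun_cong[OF \<mu>, of x] unfolding k'_def by simp
      then show ?thesis by (simp add: field_simps)
    qed
    then show ?thesis by blast
  qed
  have translates: "\<exists>\<mu>. \<forall>x. translate y e x = \<mu> * e x" if y: "y \<in> carrier G" for y
  proof -
    have iy: "inv y \<in> carrier G" using y by simp
    have e_inv: "e (inv x) = cnj (e x)" if "x \<in> carrier G" for x using eh that by (simp add: hermitian_def)
    \<comment> \<open>the cases \<open>w = 1\<close> and \<open>w = \<i>\<close> together isolate \<open>translate y e\<close>\<close>
    have "\<exists>\<mu>. \<forall>x. w * translate y e x + cnj w * translate (inv y) e x = \<mu> * e x" for w
    proof (rule scalar)
      show "(\<lambda>x. w * translate y e x + cnj w * translate (inv y) e x) \<in> cfun"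
        by (intro cfun_add cfun_cmult cfun_translate ec y iy)
      show "hermitian (\<lambda>x. w * translate y e x + cnj w * translate (inv y) e x)"
        unfolding hermitian_def
      proof
        fix x assume x: "x \<in> carrier G"
        have "inv x \<otimes> y = inv (x \<otimes> inv y)" "inv x \<otimes> inv y = inv (x \<otimes> y)"
          using x y by (simp_all add: inv_mult)
        then show "w * translate y e (inv x) + cnj w * translate (inv y) e (inv x)
            = cnj (w * translate y e x + cnj w * translate (inv y) e x)"
          using x y e_inv[of "x \<otimes> inv y"] e_inv[of "x \<otimes> y"] by (simp add: translate_def)
      qed
      show "conv e (\<lambda>x. w * translate y e x + cnj w * translate (inv y) e x)
          = (\<lambda>x. w * translate y e x + cnj w * translate (inv y) e x)"
        using conv_add_right[OF ec cfun_cmult[OF cfun_translate[OF ec y]] cfun_cmult[OF cfun_translate[OF ec iy]]]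
          conv_cmult_right[OF ec cfun_translate[OF ec y]] conv_cmult_right[OF ec cfun_translate[OF ec iy]]
          conv_translate[OF ec ec y] conv_translate[OF ec ec iy] ee by simp
    qed
    from this[of 1] this[of \<i>] obtain a b where
      "\<And>x. translate y e x + translate (inv y) e x = a * e x"
      "\<And>x. \<i> * translate y e x - \<i> * translate (inv y) e x = b * e x" by auto
    note ab = this
    have "translate y e x = ((a - \<i> * b) / 2) * e x" for x
    proof -
      have "\<i> * b * e x = \<i> * (\<i> * translate y e x - \<i> * translate (inv y) e x)"
        using ab(2)[of x] by simp
      also have "\<dots> = translate (inv y) e x - translate y e x"
        by (simp add: right_diff_distrib flip: mult.assoc)
      finally have "(a - \<i> * b) * e x = 2 * translate y e x"
        unfolding left_diff_distrib using ab(1)[of x] by (simp flip: ab(1))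
      then show ?thesis by simp
    qed
    then show ?thesis by blast
  qed
  define c where "c = e \<one>"
  have c: "c \<noteq> 0" using idempotent_ge_1[OF ec eh ee enz] by (auto simp: c_def)
  have mult: "e (x \<otimes> y) * c = e x * e y" if x: "x \<in> carrier G" and y: "y \<in> carrier G" for x y
  proof -
    obtain \<mu> where \<mu>: "\<And>x. translate y e x = \<mu> * e x" using translates[OF y] by blast
    have "e y = \<mu> * c" "e (x \<otimes> y) = \<mu> * e x"
      using \<mu>[of \<one>] \<mu>[of x] x y by (simp_all add: translate_def c_def)
    then show ?thesis by simp
  qed
  define \<xi> where "\<xi> x = e x / c" for x
  have \<xi>_mult: "\<xi> (x \<otimes> y) = \<xi> x * \<xi> y" if "x \<in> carrier G" "y \<in> carrier G" for x y
    using mult[OF that] c by (simp add: \<xi>_def field_simps)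
  have \<xi>1: "\<xi> \<one> = 1" using c by (simp add: \<xi>_def c_def)
  have "continuous_map T euclidean (\<lambda>x. (1 / c) * e x)"
    by (intro continuous_map_cmult cfun_continuous ec)
  then have cont: "continuous_map T euclidean \<xi>" by (simp add: \<xi>_def[abs_def])
  have norm: "norm (\<xi> x) = 1" if x: "x \<in> carrier G" for x
  proof -
    have "cnj c = c" using hermitian_one[OF eh] unfolding c_def by (metis complex_cnj_complex_of_real)
    then have "\<xi> (inv x) = cnj (\<xi> x)" using eh x by (simp add: \<xi>_def hermitian_def)
    then have "\<xi> x * cnj (\<xi> x) = 1" using \<xi>_mult[OF x inv_closed[OF x]] x \<xi>1 by simp
    then have "(norm (\<xi> x))\<^sup>2 = 1" by (metis complex_norm_square of_real_eq_1_iff)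
    then show ?thesis by (simp add: power2_eq_1_iff) (use norm_ge_zero[of "\<xi> x"] in linarith)
  qed
  have "\<xi> m \<noteq> 1"
  proof
    assume \<xi>m: "\<xi> m = 1"
    then have em: "translate m e = e"
      using mult[OF _ m(1)] c ec by (auto simp: \<xi>_def translate_def fun_eq_iff cfun_def)
    have "\<xi> (inv m) = 1" using \<xi>_mult[OF m(1) inv_closed[OF m(1)]] m \<xi>m \<xi>1 by simp
    then have eim: "translate (inv m) e = e"
      using mult[OF _ inv_closed[OF m(1)]] c ec by (auto simp: \<xi>_def translate_def fun_eq_iff cfun_def)
    have im: "inv m \<in> carrier G" using m by simp
    have move: "conv e (translate a q) = conv e q" if a: "a \<in> carrier G" "translate a e = e" for a
      using conv_translate[OF ec qc a(1)] conv_translate[OF qc ec a(1)] a(2) conv_commute[OF ec qc] by simp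
    have "conv e h = (\<lambda>x. (2 * conv e q x - conv e q x) - conv e q x)"
      unfolding h_def[abs_def]
      by (simp add: conv_diff_right conv_cmult_right cfun_diff cfun_cmult cfun_translate ec qc m(1) im
          move[OF m(1) em] move[OF im eim])
    then have "conv h e = (\<lambda>x. 0)" using conv_commute[OF hc ec] by simp
    then have "conv (conv h h) e = (\<lambda>x. 0)"
      unfolding conv_assoc[OF hc hc ec] by (simp add: conv_def fun_eq_iff)
    then have "complex_of_real \<kappa> * e \<one> = 0" using \<kappa>(2) by metis
    then show False using \<kappa>(1) c by (simp add: c_def)
  qed
  with cont \<xi>_mult norm show thesis by (intro that) auto
qed

end

section \<open>The dual of a discrete abelian group\<close>

lemma carrier_circle [simp]: "carrier circle_group = sphere 0 1"
  and mult_circle [simp]: "x \<otimes>\<^bsub>circle_group\<^esub> y = x * y"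
  by (simp_all add: circle_group_def)

lemma topspace_circle [simp]: "topspace circle_topology = sphere 0 1"
  by (simp add: circle_topology_def)

lemma compact_circle: "compact_space circle_topology"
  by (simp add: circle_topology_def compact_space_subtopology)

lemma Hausdorff_circle: "Hausdorff_space circle_topology"
  by (simp add: circle_topology_def Hausdorff_space_subtopology)

lemma continuous_map_circle:
  "continuous_map Z circle_topology f \<longleftrightarrow>
     continuous_map Z euclidean f \<and> (\<forall>z\<in>topspace Z. norm (f z) = 1)"
  by (auto simp: circle_topology_def continuous_map_in_subtopology)

lemma continuous_hom_circle:
  assumes "topspace T = carrier G"
  shows "continuous_hom G T circle_group circle_topology \<xi> \<longleftrightarrow>
    continuous_map T euclidean \<xi> \<and> (\<forall>x\<in>carrier G. norm (\<xi> x) = 1) \<and>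
    (\<forall>x\<in>carrier G. \<forall>y\<in>carrier G. \<xi> (x \<otimes>\<^bsub>G\<^esub> y) = \<xi> x * \<xi> y)"
  using assms by (auto simp: continuous_hom_def hom_def continuous_map_circle)

lemma circle_inverse: "norm z = 1 \<Longrightarrow> inverse z = cnj z"
  by (simp add: inverse_complex_def cmod_def complex_eq_iff power2_eq_square)

lemma closedin_ball:
  assumes "\<And>i. i \<in> I \<Longrightarrow> closedin Z {z \<in> topspace Z. P i z}"
  shows "closedin Z {z \<in> topspace Z. \<forall>i\<in>I. P i z}"
proof (cases "I = {}")
  case False
  have "{z \<in> topspace Z. \<forall>i\<in>I. P i z} = (\<Inter>i\<in>I. {z \<in> topspace Z. P i z})" using False by auto
  then show ?thesis using assms False by (auto intro: closedin_Inter)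
qed simp

abbreviation ddual :: "('p, 'm) monoid_scheme \<Rightarrow> ('p \<Rightarrow> complex) monoid" where
  "ddual D \<equiv> dual_group D (discrete_topology (carrier D))"

abbreviation ddual_topology :: "('p, 'm) monoid_scheme \<Rightarrow> ('p \<Rightarrow> complex) topology" where
  "ddual_topology D \<equiv> dual_topology D (discrete_topology (carrier D))"

lemma carrier_ddual:
  "a \<in> carrier (ddual D) \<longleftrightarrow> a \<in> extensional (carrier D) \<and> (\<forall>p\<in>carrier D. norm (a p) = 1) \<and>
     (\<forall>p\<in>carrier D. \<forall>q\<in>carrier D. a (p \<otimes>\<^bsub>D\<^esub> q) = a p * a q)"
  by (simp add: dual_group_def continuous_hom_circle)

lemma mult_dual: "a \<otimes>\<^bsub>dual_group D S\<^esub> b = (\<lambda>p\<in>carrier D. a p * b p)"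
  and one_dual: "\<one>\<^bsub>dual_group D S\<^esub> = (\<lambda>p\<in>carrier D. 1)"
  by (simp_all add: dual_group_def)

lemma topspace_dual_topology: "topspace (dual_topology D S) = carrier (dual_group D S)"
proof -
  have "carrier (dual_group D S) \<in> {{\<xi> \<in> carrier (dual_group D S). \<xi> ` K \<subseteq> U} | K U. compactin S K \<and> openin circle_topology U}"
    by (rule CollectI, rule exI[of _ "{}"], rule exI[of _ "{}"]) simp
  then show ?thesis unfolding dual_topology_def topology_generated_by_topspace by blast
qed

text \<open>Compact subsets of a discrete space are finite, so the compact-open topology is the topology of
  pointwise convergence.\<close>
lemma ddual_topology_eq:
  "ddual_topology D = subtopology (product_topology (\<lambda>_. circle_topology) (carrier D)) (carrier (ddual D))"
    (is "?L = ?R")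
proof -
  let ?A = "carrier (ddual D)"
  have top: "topspace ?R = ?A"
    by (auto simp: carrier_ddual PiE_def)
  have ev: "continuous_map ?R circle_topology (\<lambda>\<xi>. \<xi> p)" if "p \<in> carrier D" for p
    by (intro continuous_map_from_subtopology continuous_map_product_coordinates that)
  have "openin ?R V" if "openin ?L V" for V
  proof -
    have "generate_topology_on {{\<xi> \<in> ?A. \<xi> ` K \<subseteq> U} | K U. compactin (discrete_topology (carrier D)) K \<and> openin circle_topology U} V"
      using that unfolding dual_topology_def openin_topology_generated_by_iff .
    then show ?thesis
    proof (rule generate_topology_on_coarsest[rotated 2])
      show "istopology (openin ?R)" by simp
      fix S assume "S \<in> {{\<xi> \<in> ?A. \<xi> ` K \<subseteq> U} | K U. compactin (discrete_topology (carrier D)) K \<and> openin circle_topology U}"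
      then obtain K U where S: "S = {\<xi> \<in> ?A. \<xi> ` K \<subseteq> U}" and K: "K \<subseteq> carrier D" "finite K" and U: "openin circle_topology U"
        by (auto simp: compactin_discrete_topology)
      show "openin ?R S"
      proof (cases "K = {}")
        case True
        then show ?thesis using openin_topspace[of ?R] unfolding top S by simp
      next
        case False
        have "S = (\<Inter>p\<in>K. {\<xi> \<in> topspace ?R. \<xi> p \<in> U})" using False unfolding top S by auto
        moreover have "openin ?R {\<xi> \<in> topspace ?R. \<xi> p \<in> U}" if "p \<in> K" for p
          using that K by (intro openin_continuous_map_preimage[OF ev U]) auto
        ultimately show ?thesis using K False by (auto simp only: intro!: openin_Inter)
      qed
    qed
  qed
  moreover have "openin ?L V" if V: "openin ?R V" for V
  proof -
    have ev': "continuous_map ?L circle_topology (\<lambda>\<xi>. \<xi> p)" if p: "p \<in> carrier D" for p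
      unfolding continuous_map_def topspace_dual_topology
    proof (intro conjI allI impI)
      show "(\<lambda>\<xi>. \<xi> p) \<in> ?A \<rightarrow> topspace circle_topology" using p by (auto simp: carrier_ddual)
      fix U assume "openin circle_topology U"
      moreover have "{\<xi> \<in> ?A. \<xi> p \<in> U} = {\<xi> \<in> ?A. \<xi> ` {p} \<subseteq> U}" by auto
      moreover have "compactin (discrete_topology (carrier D)) {p}" using p by simp
      ultimately show "openin ?L {\<xi> \<in> ?A. \<xi> p \<in> U}"
        unfolding dual_topology_def by (intro topology_generated_by_Basis) blast
    qed
    have "continuous_map ?L ?R (\<lambda>\<xi>. \<xi>)"
      unfolding continuous_map_in_subtopology continuous_map_componentwise
      using ev' by (auto simp: topspace_dual_topology carrier_ddual extensional_def)
    from openin_continuous_map_preimage[OF this V]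
    have "openin ?L {\<xi> \<in> ?A. \<xi> \<in> V}" by (simp add: topspace_dual_topology)
    moreover have "{\<xi> \<in> ?A. \<xi> \<in> V} = V" using openin_subset[OF V] unfolding top by blast
    ultimately show ?thesis by simp
  qed
  ultimately show ?thesis by (auto simp: topology_eq)
qed

lemma continuous_map_ddual:
  "continuous_map Z (ddual_topology D) f \<longleftrightarrow>
     f ` topspace Z \<subseteq> carrier (ddual D) \<and> (\<forall>p\<in>carrier D. continuous_map Z euclidean (\<lambda>z. f z p))"
proof -
  have "f ` topspace Z \<subseteq> carrier (ddual D) \<Longrightarrow> f ` topspace Z \<subseteq> extensional (carrier D)"
    by (auto simp: carrier_ddual)
  then show ?thesis
    unfolding ddual_topology_eq continuous_map_in_subtopology continuous_map_componentwise continuous_map_circle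
    by (auto simp: carrier_ddual image_subset_iff Pi_iff)
qed

lemma continuous_map_ddual_eval:
  "p \<in> carrier D \<Longrightarrow> continuous_map (ddual_topology D) euclidean (\<lambda>a. a p)"
  using continuous_map_id[of "ddual_topology D"] unfolding id_def continuous_map_ddual by blast

text \<open>The homomorphisms form a closed subset of a product of circles.\<close>
lemma compact_ddual_topology:
  assumes "monoid D"
  shows "compact_space (ddual_topology D)"
proof -
  interpret D: monoid D by fact
  let ?P = "product_topology (\<lambda>_. circle_topology) (carrier D)"
  have ev: "continuous_map ?P euclidean (\<lambda>a. a p)" if "p \<in> carrier D" for p
    using continuous_map_product_coordinates[OF that, of "\<lambda>_. circle_topology"] by (simp add: continuous_map_circle)
  have "closedin ?P {a \<in> topspace ?P. \<forall>p\<in>carrier D. \<forall>q\<in>carrier D. a (p \<otimes>\<^bsub>D\<^esub> q) = a p * a q}"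
    by (intro closedin_ball closedin_continuous_maps_eq[OF Hausdorff_space_euclidean] ev
        continuous_map_mult_algebra D.m_closed)
  moreover have "{a \<in> topspace ?P. \<forall>p\<in>carrier D. \<forall>q\<in>carrier D. a (p \<otimes>\<^bsub>D\<^esub> q) = a p * a q} = carrier (ddual D)"
    by (auto simp: carrier_ddual PiE_iff)
  moreover have "compact_space ?P"
    by (simp add: compact_space_product_topology compact_circle)
  ultimately show "compact_space (ddual_topology D)"
    unfolding ddual_topology_eq using closedin_compact_space compact_space_subtopology by fastforce
qed

lemma Hausdorff_ddual_topology: "Hausdorff_space (ddual_topology D)"
  unfolding ddual_topology_eq
  by (simp add: Hausdorff_space_subtopology Hausdorff_space_product_topology Hausdorff_circle)

lemma compact_abelian_ddual:
  assumes "comm_group D"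
  shows "compact_abelian_group (ddual D) (ddual_topology D)"
proof -
  interpret D: comm_group D by fact
  let ?A = "ddual D"
  have inv: "(\<lambda>p\<in>carrier D. cnj (a p)) \<in> carrier ?A" "(\<lambda>p\<in>carrier D. cnj (a p)) \<otimes>\<^bsub>?A\<^esub> a = \<one>\<^bsub>?A\<^esub>"
    if "a \<in> carrier ?A" for a
  proof -
    show "(\<lambda>p\<in>carrier D. cnj (a p)) \<in> carrier ?A" using that by (auto simp: carrier_ddual)
    have "cnj (a p) * a p = 1" if p: "p \<in> carrier D" for p
    proof -
      have "norm (a p) = 1" using \<open>a \<in> carrier ?A\<close> p by (simp add: carrier_ddual)
      then show ?thesis using complex_norm_square[of "a p"] by (simp add: mult.commute)
    qed
    then show "(\<lambda>p\<in>carrier D. cnj (a p)) \<otimes>\<^bsub>?A\<^esub> a = \<one>\<^bsub>?A\<^esub>"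
      by (auto simp: mult_dual one_dual)
  qed
  have grp: "comm_group ?A"
  proof (rule comm_groupI)
    fix a b c assume "a \<in> carrier ?A" "b \<in> carrier ?A" "c \<in> carrier ?A"
    then show "a \<otimes>\<^bsub>?A\<^esub> b \<otimes>\<^bsub>?A\<^esub> c = a \<otimes>\<^bsub>?A\<^esub> (b \<otimes>\<^bsub>?A\<^esub> c)"
      by (auto simp: mult_dual)
  next
    fix a assume a: "a \<in> carrier ?A"
    then show "\<one>\<^bsub>?A\<^esub> \<otimes>\<^bsub>?A\<^esub> a = a"
      by (auto simp: mult_dual one_dual carrier_ddual extensional_def)
    show "\<exists>y\<in>carrier ?A. y \<otimes>\<^bsub>?A\<^esub> a = \<one>\<^bsub>?A\<^esub>" using inv[OF a] by blast
  qed (auto simp: mult_dual one_dual carrier_ddual norm_mult)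
  interpret A: comm_group ?A by fact
  have inv_eq: "inv\<^bsub>?A\<^esub> a = (\<lambda>p\<in>carrier D. cnj (a p))" if "a \<in> carrier ?A" for a
    using A.inv_equality[OF inv(2) that inv(1)] that by simp
  show ?thesis
  proof
    show "topspace (ddual_topology D) = carrier ?A" by (rule topspace_dual_topology)
    have eval: "continuous_map (prod_topology (ddual_topology D) (ddual_topology D)) euclidean (\<lambda>z. fst z p)"
      "continuous_map (prod_topology (ddual_topology D) (ddual_topology D)) euclidean (\<lambda>z. snd z p)"
      if "p \<in> carrier D" for p
      by (rule continuous_map_compose2[OF continuous_map_ddual_eval[OF that] continuous_map_fst],
          rule continuous_map_compose2[OF continuous_map_ddual_eval[OF that] continuous_map_snd])
    show "continuous_map (prod_topology (ddual_topology D) (ddual_topology D)) (ddual_topology D)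
        (\<lambda>(x, y). x \<otimes>\<^bsub>?A\<^esub> y)"
      unfolding continuous_map_ddual
    proof (intro conjI ballI)
      show "(\<lambda>(x, y). x \<otimes>\<^bsub>?A\<^esub> y) ` topspace (prod_topology (ddual_topology D) (ddual_topology D)) \<subseteq> carrier ?A"
        by (auto simp: topspace_dual_topology)
      fix p assume p: "p \<in> carrier D"
      show "continuous_map (prod_topology (ddual_topology D) (ddual_topology D)) euclidean
          (\<lambda>z. (case z of (x, y) \<Rightarrow> x \<otimes>\<^bsub>?A\<^esub> y) p)"
        using continuous_map_mult_algebra[OF eval(1)[OF p] eval(2)[OF p]] p by (simp add: mult_dual case_prod_unfold)
    qed
    show "continuous_map (ddual_topology D) (ddual_topology D) (\<lambda>x. inv\<^bsub>?A\<^esub> x)"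
      unfolding continuous_map_ddual
    proof (intro conjI ballI)
      show "(\<lambda>x. inv\<^bsub>?A\<^esub> x) ` topspace (ddual_topology D) \<subseteq> carrier ?A"
        by (auto simp: topspace_dual_topology)
      fix p assume p: "p \<in> carrier D"
      have "continuous_map (ddual_topology D) euclidean (\<lambda>a. cnj (a p))"
        by (intro continuous_map_cnj continuous_map_ddual_eval p)
      then show "continuous_map (ddual_topology D) euclidean (\<lambda>a. (inv\<^bsub>?A\<^esub> a) p)"
        by (rule continuous_map_eq) (simp add: topspace_dual_topology inv_eq p)
    qed
  qed (rule compact_ddual_topology Hausdorff_ddual_topology D.monoid_axioms)+
qed

lemma (in compact_abelian_group) compact_abelian_closed_subgroup:
  assumes "subgroup C G" "closedin T C"
  shows "compact_abelian_group (G\<lparr>carrier := C\<rparr>) (subtopology T C)"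
proof -
  interpret C: topological_group "G\<lparr>carrier := C\<rparr>" "subtopology T C"
    by (rule topological_group_subgroup[OF assms(1)])
  show ?thesis
    using assms(2) compact Hausdorff subgroup.subset[OF assms(1)]
    by unfold_locales (auto simp: m_comm subset_iff closedin_compact_space compact_space_subtopology Hausdorff_space_subtopology)
qed

text \<open>Let \<open>C\<close> be the closure of \<open>S\<close>. A character \<open>a \<mapsto> a p\<close> with \<open>p\<close> nontrivial is nontrivial already
  on \<open>S\<close>, so its mean is \<open>0\<close> both over \<open>C\<close> and over the whole dual. Hence trigonometric polynomials
  have the same mean over both. If \<open>a0\<close> lies outside of \<open>C\<close>, finitely many coordinates separate it
  from every point of \<open>C\<close>, and the product \<open>g\<close> of the factors \<open>norm (a0 p + a p)\<^sup>2 / 4\<close>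
  over these coordinates is a trigonometric polynomial with values in \<open>[0, 1]\<close> which is \<open>1\<close> at \<open>a0\<close> and
  at most \<open>s < 1\<close> on \<open>C\<close>. The mean of \<open>g ^ n\<close> over \<open>C\<close> is at most \<open>s ^ n\<close>, but over the whole dual
  it is at least a constant times \<open>s' ^ n\<close> for some \<open>s' > s\<close>, because \<open>g\<close> exceeds \<open>s'\<close> near
  \<open>a0\<close>.\<close>
theorem dense_in_ddual:
  assumes D: "comm_group D" and S: "subgroup S (ddual D)"
    and ann: "\<And>p. p \<in> carrier D \<Longrightarrow> \<forall>s\<in>S. s p = 1 \<Longrightarrow> p = \<one>\<^bsub>D\<^esub>"
  shows "ddual_topology D closure_of S = carrier (ddual D)"
proof (rule ccontr)
  interpret D: comm_group D by fact
  let ?A = "ddual D" and ?T = "ddual_topology D"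
  interpret A: compact_abelian_group ?A ?T by (rule compact_abelian_ddual[OF D])
  define C where "C = ?T closure_of S"
  have sC: "subgroup C ?A" unfolding C_def by (rule A.subgroup_closure_of[OF S])
  have clC: "closedin ?T C" by (simp add: C_def)
  have SA: "S \<subseteq> carrier ?A" using S by (rule subgroup.subset)
  have CA: "C \<subseteq> carrier ?A" using sC by (rule subgroup.subset)
  have SC: "S \<subseteq> C" unfolding C_def using SA by (simp add: closure_of_subset A.topspace_eq)
  interpret C: compact_abelian_group "?A\<lparr>carrier := C\<rparr>" "subtopology ?T C"
    by (rule A.compact_abelian_closed_subgroup[OF sC clC])
  assume "?T closure_of S \<noteq> carrier ?A"
  then obtain a0 where a0: "a0 \<in> carrier ?A" "a0 \<notin> C" using CA unfolding C_def by blast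
  have mult: "a (p \<otimes>\<^bsub>D\<^esub> q) = a p * a q" if "a \<in> carrier ?A" "p \<in> carrier D" "q \<in> carrier D" for a p q
    using that by (simp add: carrier_ddual)
  have norm1: "norm (a p) = 1" if "a \<in> carrier ?A" "p \<in> carrier D" for a p
    using that by (simp add: carrier_ddual)
  have one: "a \<one>\<^bsub>D\<^esub> = 1" if "a \<in> carrier ?A" for a
    using mult[OF that D.one_closed D.one_closed] norm1[OF that D.one_closed] by auto
  have inv: "a (inv\<^bsub>D\<^esub> p) = cnj (a p)" if "a \<in> carrier ?A" "p \<in> carrier D" for a p
  proof -
    have "a p * a (inv\<^bsub>D\<^esub> p) = a \<one>\<^bsub>D\<^esub>"
      using mult[OF that(1) that(2) D.inv_closed[OF that(2)]] that by simp
    then have "a p * a (inv\<^bsub>D\<^esub> p) = 1" unfolding one[OF that(1)] .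
    then have "inverse (a p) = a (inv\<^bsub>D\<^esub> p)" by (rule inverse_unique)
    then show ?thesis using circle_inverse norm1[OF that] by simp
  qed
  have ev: "continuous_map ?T euclidean (\<lambda>a. a p)" if "p \<in> carrier D" for p
    by (rule continuous_map_ddual_eval[OF that])
  \<comment> \<open>the functions on the dual whose products with all characters have the same mean over the
      closure of \<open>S\<close> as over the whole group\<close>
  define R where "R P \<longleftrightarrow> continuous_map ?T euclidean P \<and>
    (\<forall>q\<in>carrier D. A.mean (\<lambda>a. a q * P a) = C.mean (\<lambda>a. a q * P a))" for P
  have sub: "continuous_map (subtopology ?T C) euclidean P" if "continuous_map ?T euclidean P" for P :: "('a \<Rightarrow> complex) \<Rightarrow> complex"
    using that by (rule continuous_map_from_subtopology)
  have R1: "R (\<lambda>a. 1)"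
    unfolding R_def
  proof (intro conjI ballI)
    fix q assume q: "q \<in> carrier D"
    show "A.mean (\<lambda>a. a q * 1) = C.mean (\<lambda>a. a q * 1)"
    proof (cases "q = \<one>\<^bsub>D\<^esub>")
      case True
      have "A.mean (\<lambda>a. a q * 1) = A.mean (\<lambda>a. 1)" by (rule A.mean_cong) (simp add: True one)
      moreover have "C.mean (\<lambda>a. a q * 1) = C.mean (\<lambda>a. 1)"
        using CA by (intro C.mean_cong) (auto simp: True one)
      ultimately show ?thesis by (simp only: A.mean_const C.mean_const)
    next
      case False
      then obtain s where s: "s \<in> S" "s q \<noteq> 1" using ann[OF q] by blast
      have "A.mean (\<lambda>a. a q) = A.mean (\<lambda>a. (a \<otimes>\<^bsub>?A\<^esub> s) q)"
        using A.mean_translate[OF ev[OF q], of s] s SA by auto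
      also have "\<dots> = A.mean (\<lambda>a. s q * a q)" by (intro A.mean_cong) (simp add: mult_dual q)
      also have "\<dots> = s q * A.mean (\<lambda>a. a q)" by (rule A.mean_cmult[OF ev[OF q]])
      finally have "A.mean (\<lambda>a. a q) = 0" using s(2) by (simp add: mult_cancel_right1)
      moreover have "C.mean (\<lambda>a. a q) = C.mean (\<lambda>a. (a \<otimes>\<^bsub>?A\<lparr>carrier := C\<rparr>\<^esub> s) q)"
        using C.mean_translate[OF sub[OF ev[OF q]], of s] s SC by auto
      then have "C.mean (\<lambda>a. a q) = C.mean (\<lambda>a. s q * a q)"
        using C.mean_cong[of "\<lambda>a. (a \<otimes>\<^bsub>?A\<lparr>carrier := C\<rparr>\<^esub> s) q" "\<lambda>a. s q * a q"] by (simp add: mult_dual q)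
      then have "C.mean (\<lambda>a. a q) = 0"
        using C.mean_cmult[OF sub[OF ev[OF q]], of "s q"] s(2) by (simp add: mult_cancel_right1)
      ultimately show ?thesis by simp
    qed
  qed simp
  have Rmult: "R (\<lambda>a. c * a p * P a)" if P: "R P" and p: "p \<in> carrier D" for c p P
    unfolding R_def
  proof (intro conjI ballI)
    have cP: "continuous_map ?T euclidean P" using P by (simp add: R_def)
    then show "continuous_map ?T euclidean (\<lambda>a. c * a p * P a)"
      by (intro continuous_map_mult_algebra continuous_map_cmult ev p)
    fix q assume q: "q \<in> carrier D"
    have c: "continuous_map ?T euclidean (\<lambda>a. a (q \<otimes>\<^bsub>D\<^esub> p) * P a)"
      using p q by (intro continuous_map_mult_algebra ev cP) simp
    have "A.mean (\<lambda>a. a q * (c * a p * P a)) = A.mean (\<lambda>a. c * (a (q \<otimes>\<^bsub>D\<^esub> p) * P a))"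
      using p q by (intro A.mean_cong) (simp add: mult)
    also have "\<dots> = c * A.mean (\<lambda>a. a (q \<otimes>\<^bsub>D\<^esub> p) * P a)" by (rule A.mean_cmult[OF c])
    also have "\<dots> = c * C.mean (\<lambda>a. a (q \<otimes>\<^bsub>D\<^esub> p) * P a)" using P p q by (simp add: R_def)
    also have "\<dots> = C.mean (\<lambda>a. c * (a (q \<otimes>\<^bsub>D\<^esub> p) * P a))" by (rule C.mean_cmult[OF sub[OF c], symmetric])
    also have "\<dots> = C.mean (\<lambda>a. a q * (c * a p * P a))"
      using p q CA by (intro C.mean_cong) (auto simp: mult)
    finally show "A.mean (\<lambda>a. a q * (c * a p * P a)) = C.mean (\<lambda>a. a q * (c * a p * P a))" .
  qed
  have Radd: "R (\<lambda>a. P a + Q a)" if P: "R P" and Q: "R Q" for P Q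
    unfolding R_def
  proof (intro conjI ballI)
    have cPQ: "continuous_map ?T euclidean P" "continuous_map ?T euclidean Q" using P Q by (simp_all add: R_def)
    then show "continuous_map ?T euclidean (\<lambda>a. P a + Q a)" by (intro continuous_map_add)
    fix q assume q: "q \<in> carrier D"
    have c: "continuous_map ?T euclidean (\<lambda>a. a q * P a)" "continuous_map ?T euclidean (\<lambda>a. a q * Q a)"
      by (intro continuous_map_mult_algebra ev cPQ q)+
    show "A.mean (\<lambda>a. a q * (P a + Q a)) = C.mean (\<lambda>a. a q * (P a + Q a))"
      using A.mean_add[OF c] C.mean_add[OF sub[OF c(1)] sub[OF c(2)]] P Q q
      by (simp add: R_def distrib_left)
  qed
  define w where "w p a = (2 + cnj (a0 p) * a p + a0 p * a (inv\<^bsub>D\<^esub> p)) / 4" for p a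
  have Rw: "R (\<lambda>a. w p a * P a)" if P: "R P" and p: "p \<in> carrier D" for p P
  proof -
    have "R (\<lambda>a. ((1/2) * a \<one>\<^bsub>D\<^esub> * P a + (cnj (a0 p) / 4) * a p * P a) + (a0 p / 4) * a (inv\<^bsub>D\<^esub> p) * P a)"
      using p by (intro Radd Rmult P) auto
    moreover have "R P \<longleftrightarrow> R Q" if PQ: "\<And>a. a \<in> carrier ?A \<Longrightarrow> P a = Q a" for P Q
    proof -
      have "continuous_map ?T euclidean P \<longleftrightarrow> continuous_map ?T euclidean Q"
        using PQ by (metis A.topspace_eq continuous_map_eq)
      moreover have "A.mean (\<lambda>a. a q * P a) = A.mean (\<lambda>a. a q * Q a)" for q
        using PQ by (intro A.mean_cong) simp
      moreover have "C.mean (\<lambda>a. a q * P a) = C.mean (\<lambda>a. a q * Q a)" for q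
        using PQ CA by (intro C.mean_cong) auto
      ultimately show ?thesis by (simp add: R_def)
    qed
    ultimately show ?thesis
      by (rule iffD1[rotated]) (simp add: w_def one field_simps)
  qed
  \<comment> \<open>\<open>w p a\<close> is \<open>1\<close> if \<open>a p = a0 p\<close>, and less than \<open>1\<close> otherwise\<close>
  have w_real: "w p a = of_real ((norm (a0 p + a p))\<^sup>2 / 4)" if "a \<in> carrier ?A" "p \<in> carrier D" for a p
  proof -
    have "complex_of_real ((norm (a0 p + a p))\<^sup>2) = (a0 p + a p) * cnj (a0 p + a p)"
      by (rule complex_norm_square)
    also have "\<dots> = a0 p * cnj (a0 p) + a p * cnj (a p) + cnj (a0 p) * a p + a0 p * cnj (a p)"
      by (simp add: algebra_simps)
    finally have *: "complex_of_real ((norm (a0 p + a p))\<^sup>2)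
        = a0 p * cnj (a0 p) + a p * cnj (a p) + cnj (a0 p) * a p + a0 p * cnj (a p)" .
    have "a0 p * cnj (a0 p) = 1" "a p * cnj (a p) = 1"
      using norm1[OF a0(1) that(2)] norm1[OF that] by (simp_all flip: complex_norm_square)
    then have "4 * w p a = complex_of_real ((norm (a0 p + a p))\<^sup>2)"
      unfolding * w_def inv[OF that] by simp
    then show ?thesis by (simp add: field_simps)
  qed
  have w_bounds: "0 \<le> (norm (a0 p + a p))\<^sup>2 / 4" "(norm (a0 p + a p))\<^sup>2 / 4 \<le> 1"
    "(norm (a0 p + a p))\<^sup>2 / 4 = 1 \<Longrightarrow> a p = a0 p" if "a \<in> carrier ?A" "p \<in> carrier D" for a p
  proof -
    have par: "(norm (a0 p + a p))\<^sup>2 + (norm (a0 p - a p))\<^sup>2 = 4"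
    proof -
      have "complex_of_real ((norm (a0 p + a p))\<^sup>2 + (norm (a0 p - a p))\<^sup>2)
          = 2 * (a0 p * cnj (a0 p)) + 2 * (a p * cnj (a p))"
        by (simp only: of_real_add complex_norm_square complex_cnj_add complex_cnj_diff) (simp add: algebra_simps)
      also have "\<dots> = of_real 4"
        using norm1[OF a0(1) that(2)] norm1[OF that] by (simp flip: complex_norm_square)
      finally show ?thesis by (simp only: of_real_eq_iff)
    qed
    show "0 \<le> (norm (a0 p + a p))\<^sup>2 / 4" by simp
    show "(norm (a0 p + a p))\<^sup>2 / 4 \<le> 1" using par zero_le_power2[of "norm (a0 p - a p)"] by linarith
    show "a p = a0 p" if "(norm (a0 p + a p))\<^sup>2 / 4 = 1" using par that by simp
  qed
  obtain F where F: "finite F" "F \<subseteq> carrier D" "\<And>c. c \<in> C \<Longrightarrow> \<exists>p\<in>F. c p \<noteq> a0 p"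
  proof -
    let ?P = "product_topology (\<lambda>_. circle_topology) (carrier D)"
    have "openin ?T (topspace ?T - C)" using clC by (rule openin_diff[OF openin_topspace])
    then obtain V where V: "openin ?P V" "carrier ?A - C = V \<inter> carrier ?A"
      unfolding A.topspace_eq unfolding ddual_topology_eq openin_subtopology by blast
    then have "a0 \<in> V" using a0 by blast
    then obtain Y where Y: "a0 \<in> (\<Pi>\<^sub>E i\<in>carrier D. Y i)" "\<And>i. openin circle_topology (Y i)"
      "finite {i. Y i \<noteq> topspace circle_topology}" "(\<Pi>\<^sub>E i\<in>carrier D. Y i) \<subseteq> V"
      using product_topology_open_contains_basis[OF V(1)] by metis
    define F where "F = {i \<in> carrier D. Y i \<noteq> topspace circle_topology}"
    have "finite F" by (rule finite_subset[OF _ Y(3)]) (auto simp: F_def)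
    moreover have "\<exists>p\<in>F. c p \<noteq> a0 p" if c: "c \<in> C" for c
    proof (rule ccontr)
      assume neg: "\<not> (\<exists>p\<in>F. c p \<noteq> a0 p)"
      have cA: "c \<in> carrier ?A" using c CA by blast
      have "c p \<in> Y p" if p: "p \<in> carrier D" for p
      proof (cases "p \<in> F")
        case True
        then show ?thesis using neg Y(1) p by (metis PiE_mem)
      next
        case False
        then have "Y p = topspace circle_topology" using p by (simp add: F_def)
        then show ?thesis using norm1[OF cA p] by simp
      qed
      then have "c \<in> V" using Y(4) cA by (auto simp: PiE_def carrier_ddual)
      then show False using V(2) c cA by blast
    qed
    ultimately show thesis using that[of F] by (auto simp: F_def)
  qed
  define f where "f a = (\<Prod>p\<in>F. w p a)" for a
  define g where "g a = (\<Prod>p\<in>F. (norm (a0 p + a p))\<^sup>2 / 4)" for a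
  have fg: "f a = of_real (g a)" if "a \<in> carrier ?A" for a
    unfolding f_def g_def of_real_prod using F(2) that by (intro prod.cong refl w_real) auto
  have g_nonneg: "0 \<le> g a" for a unfolding g_def by (intro prod_nonneg) simp
  have Rf: "R (\<lambda>a. f a * P a)" if "R P" for P
    unfolding f_def using F(1,2) that
  proof (induction F rule: finite_induct)
    case (insert p F)
    then have "R (\<lambda>a. w p a * ((\<Prod>p\<in>F. w p a) * P a))" by (intro Rw) auto
    then show ?case using insert by (simp add: mult.assoc)
  qed simp
  have Rfn: "R (\<lambda>a. f a ^ n)" for n
    by (induction n) (simp_all add: R1 Rf)
  have cf: "continuous_map ?T euclidean (\<lambda>a. f a ^ n)" for n using Rfn[of n] by (simp add: R_def)
  have means: "A.mean (\<lambda>a. f a ^ n) = C.mean (\<lambda>a. f a ^ n)" for n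
  proof -
    have "A.mean (\<lambda>a. f a ^ n) = A.mean (\<lambda>a. a \<one>\<^bsub>D\<^esub> * f a ^ n)" by (intro A.mean_cong) (simp add: one)
    also have "\<dots> = C.mean (\<lambda>a. a \<one>\<^bsub>D\<^esub> * f a ^ n)" using Rfn[of n] by (simp add: R_def)
    also have "\<dots> = C.mean (\<lambda>a. f a ^ n)" using CA by (intro C.mean_cong) (auto simp: one)
    finally show ?thesis .
  qed
  have cg: "continuous_map ?T euclideanreal g"
    unfolding g_def[abs_def] using F(1,2)
    by (intro continuous_map_prod continuous_map_real_divide continuous_map_real_pow continuous_map_norm
        continuous_map_add) (auto intro: ev)
  \<comment> \<open>on the closed set \<open>C\<close>, the function \<open>g\<close> stays away from its value at \<open>a0\<close>\<close>
  obtain s where s: "0 \<le> s" "s < 1" "\<And>c. c \<in> C \<Longrightarrow> g c \<le> s"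
  proof -
    have "compactin ?T C" using clC A.compact closedin_compact_space by blast
    then have "compactin euclideanreal (g ` C)" by (rule image_compactin[OF _ cg])
    moreover have "C \<noteq> {}" using C.one_closed by auto
    ultimately obtain c where c: "c \<in> C" "\<forall>x\<in>C. g x \<le> g c"
      using compact_attains_sup[of "g ` C"] by auto
    have cA: "c \<in> carrier ?A" using c CA by blast
    obtain p where p: "p \<in> F" "c p \<noteq> a0 p" using F(3)[OF c(1)] by blast
    have "g c = (norm (a0 p + c p))\<^sup>2 / 4 * (\<Prod>p\<in>F - {p}. (norm (a0 p + c p))\<^sup>2 / 4)"
      unfolding g_def using F(1) p(1) by (rule prod.remove)
    also have "\<dots> \<le> (norm (a0 p + c p))\<^sup>2 / 4 * 1"
      using w_bounds[OF cA] F(2) by (intro mult_left_mono prod_le_1) auto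
    also have "\<dots> < 1"
      using w_bounds(2,3)[OF cA, of p] p F(2) by (auto simp: less_le)
    finally show thesis using that[of "g c"] g_nonneg c(2) by blast
  qed
  have ga0: "g a0 = 1"
  proof -
    have "(norm (a0 p + a0 p))\<^sup>2 / 4 = 1" if "p \<in> F" for p
    proof -
      have "p \<in> carrier D" using that F(2) by blast
      then have "norm (a0 p + a0 p) = 2" using norm1[OF a0(1)] by (simp add: norm_mult flip: mult_2)
      then show ?thesis by simp
    qed
    then show ?thesis unfolding g_def by simp
  qed
  define s' where "s' = (1 + s) / 2"
  have s': "s < s'" "s' < 1" "0 < s'" using s by (simp_all add: s'_def)
  define U where "U = {u \<in> topspace ?T. g (u \<otimes>\<^bsub>?A\<^esub> a0) \<in> {s'<..}}"
  have "openin ?T U"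
    unfolding U_def by (rule openin_continuous_map_preimage[OF A.continuous_map_translate[OF cg a0(1)]]) simp
  moreover have "\<one>\<^bsub>?A\<^esub> \<in> U" using a0 s' ga0 by (simp add: U_def A.topspace_eq)
  ultimately obtain E where E: "finite E" "E \<noteq> {}" "E \<subseteq> carrier ?A"
    "\<And>x z. x \<in> carrier ?A \<Longrightarrow> z \<in> carrier ?A \<Longrightarrow> \<exists>a\<in>E. \<exists>u\<in>U. x \<otimes>\<^bsub>?A\<^esub> a = z \<otimes>\<^bsub>?A\<^esub> u"
    using A.finite_translates_cover[of U] by blast
  have low: "\<exists>a\<in>E. s' ^ n \<le> g (x \<otimes>\<^bsub>?A\<^esub> a) ^ n" if x: "x \<in> carrier ?A" for x n
  proof -
    obtain a u where au: "a \<in> E" "u \<in> U" "x \<otimes>\<^bsub>?A\<^esub> a = a0 \<otimes>\<^bsub>?A\<^esub> u" using E(4)[OF x a0(1)] by blast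
    then have "s' \<le> g (x \<otimes>\<^bsub>?A\<^esub> a)" using a0 by (auto simp: U_def A.topspace_eq A.m_comm)
    then have "s' ^ n \<le> g (x \<otimes>\<^bsub>?A\<^esub> a) ^ n" using s' by (intro power_mono) auto
    then show ?thesis using au(1) by blast
  qed
  have "s' ^ n / card E \<le> s ^ n" for n
  proof -
    have "s' ^ n / card E \<le> Re (A.mean (\<lambda>a. of_real (g a ^ n)))"
      using cg by (intro A.mean_nonneg_lower_bound continuous_map_real_pow E(1-3) low) (simp_all add: g_nonneg)
    also have "A.mean (\<lambda>a. of_real (g a ^ n)) = A.mean (\<lambda>a. f a ^ n)"
      by (intro A.mean_cong) (simp add: fg)
    also have "Re \<dots> \<le> norm (C.mean (\<lambda>a. f a ^ n))" unfolding means by (rule complex_Re_le_cmod)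
    also have "\<dots> \<le> s ^ n"
    proof (rule C.norm_mean_le[OF sub[OF cf]])
      fix a assume "a \<in> carrier (?A\<lparr>carrier := C\<rparr>)"
      then have a: "a \<in> C" "a \<in> carrier ?A" using CA by auto
      then show "norm (f a ^ n) \<le> s ^ n"
        using s(3)[OF a(1)] g_nonneg[of a] by (simp add: fg norm_power power_mono)
    qed
    finally show ?thesis .
  qed
  moreover have "(\<lambda>n. (s / s') ^ n) \<longlonglongrightarrow> 0"
    using s s' by (intro LIMSEQ_realpow_zero) auto
  then obtain n where "(s / s') ^ n < 1 / card E"
    using E(1,2) order_tendstoD(2)[of "\<lambda>n. (s / s') ^ n" 0 sequentially "1 / card E"]
    by (auto simp: eventually_sequentially card_gt_0_iff)
  then have "s ^ n < s' ^ n / card E"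
    using s' by (simp add: power_divide pos_divide_less_eq)
  ultimately show False by (meson not_le)
qed

section \<open>Characters of profinite groups\<close>

text \<open>While \<open>w\<close> stays within distance \<open>1\<close> of \<open>1\<close>, squaring multiplies this distance by
  \<open>norm (w + 1) \<ge> 3/2\<close>, in view of the parallelogram law.\<close>
lemma circle_no_small_subgroups:
  fixes z :: complex
  assumes z: "norm z = 1" and small: "\<And>n::nat. norm (z ^ n - 1) < 1"
  shows "z = 1"
proof (rule ccontr)
  assume "z \<noteq> 1"
  have double: "(3/2) * norm (w - 1) \<le> norm (w\<^sup>2 - 1)" if w: "norm w = 1" "norm (w - 1) < 1" for w :: complex
  proof -
    have "complex_of_real ((norm (w + 1))\<^sup>2 + (norm (w - 1))\<^sup>2) = 2 * (w * cnj w) + 2"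
      by (simp only: of_real_add complex_norm_square complex_cnj_add complex_cnj_diff) (simp add: algebra_simps)
    also have "\<dots> = of_real 4" using w by (simp flip: complex_norm_square)
    finally have "(norm (w + 1))\<^sup>2 + (norm (w - 1))\<^sup>2 = 4" by (simp only: of_real_eq_iff)
    moreover have "(norm (w - 1))\<^sup>2 \<le> 1" using w(2) by (simp add: power_le_one)
    ultimately have "(3/2)\<^sup>2 \<le> (norm (w + 1))\<^sup>2" by (simp add: power2_eq_square)
    then have "3/2 \<le> norm (w + 1)" by (rule power2_le_imp_le) simp
    then have "(3/2) * norm (w - 1) \<le> norm (w + 1) * norm (w - 1)" by (intro mult_right_mono) auto
    also have "\<dots> = norm (w\<^sup>2 - 1)" by (simp add: power2_eq_square algebra_simps flip: norm_mult)
    finally show ?thesis .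
  qed
  have grow: "(3/2) ^ k * norm (z - 1) \<le> norm (z ^ (2 ^ k) - 1)" for k
  proof (induction k)
    case (Suc k)
    have "(3/2) ^ Suc k * norm (z - 1) = (3/2) * ((3/2) ^ k * norm (z - 1))" by simp
    also have "\<dots> \<le> (3/2) * norm (z ^ (2 ^ k) - 1)" by (intro mult_left_mono Suc) simp
    also have "\<dots> \<le> norm ((z ^ (2 ^ k))\<^sup>2 - 1)"
      using z small by (intro double) (simp_all add: norm_power)
    also have "(z ^ (2 ^ k))\<^sup>2 = z ^ (2 ^ Suc k)" by (simp add: power_mult mult.commute flip: power_mult)
    finally show ?case .
  qed simp
  obtain k where "1 / norm (z - 1) < (3/2::real) ^ k"
    using real_arch_pow[of "3/2" "1 / norm (z - 1)"] by auto
  then have "1 < (3/2) ^ k * norm (z - 1)" using \<open>z \<noteq> 1\<close> by (simp add: pos_divide_less_eq)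
  then show False using grow[of k] small[of "2 ^ k"] by linarith
qed

lemma trivial_if_close_to_1:
  fixes \<xi> :: "'a \<Rightarrow> complex"
  assumes M: "group M"
    and mult: "\<And>x y. x \<in> carrier M \<Longrightarrow> y \<in> carrier M \<Longrightarrow> \<xi> (x \<otimes>\<^bsub>M\<^esub> y) = \<xi> x * \<xi> y"
    and norm1: "\<And>x. x \<in> carrier M \<Longrightarrow> norm (\<xi> x) = 1"
    and close: "\<And>x. x \<in> carrier M \<Longrightarrow> norm (\<xi> x - 1) < 1" and x: "x \<in> carrier M"
  shows "\<xi> x = 1"
proof (rule circle_no_small_subgroups)
  interpret group M by fact
  have "\<xi> \<one>\<^bsub>M\<^esub> = 1" using mult[of "\<one>\<^bsub>M\<^esub>" "\<one>\<^bsub>M\<^esub>"] norm1[of "\<one>\<^bsub>M\<^esub>"] by auto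
  then have "\<xi> (x [^]\<^bsub>M\<^esub> n) = \<xi> x ^ n" for n :: nat
    using x by (induction n) (simp_all add: mult)
  then show "norm (\<xi> x ^ n - 1) < 1" for n using close[of "x [^]\<^bsub>M\<^esub> n"] x by simp
qed (rule norm1[OF x])

text \<open>In a totally disconnected compact group the component of the unit is trivial, so the neighbourhood of
  the unit where \<open>\<xi>\<close> is within \<open>1\<close> of \<open>1\<close> contains a clopen neighbourhood \<open>U\<close>. As \<open>U\<close> is compact, it is
  stable under translation by a smaller neighbourhood \<open>S\<close>, so all powers of elements of \<open>S\<close> stay in
  \<open>U\<close>, and \<open>\<xi>\<close> is trivial on \<open>S\<close>. Thus \<open>\<xi>\<close> is locally constant.\<close>
theorem profinite_character_finite_image:
  assumes M: "profinite_group M TM"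
    and \<xi>: "continuous_hom M TM circle_group circle_topology \<xi>"
  shows "finite (\<xi> ` carrier M)"
proof -
  have tg: "topological_group M TM" and comp: "compact_space TM" and Haus: "Hausdorff_space TM"
    and td: "totally_disconnected_space TM"
    using M by (auto simp: profinite_group_def compact_group_def)
  interpret topological_group M TM by fact
  have c\<xi>: "continuous_map TM euclidean \<xi>"
    and norm1: "\<And>x. x \<in> carrier M \<Longrightarrow> norm (\<xi> x) = 1"
    and mult: "\<And>x y. x \<in> carrier M \<Longrightarrow> y \<in> carrier M \<Longrightarrow> \<xi> (x \<otimes>\<^bsub>M\<^esub> y) = \<xi> x * \<xi> y"
    using \<xi> unfolding continuous_hom_circle[OF topspace_eq] by blast+
  have one: "\<xi> \<one>\<^bsub>M\<^esub> = 1" using mult[of "\<one>\<^bsub>M\<^esub>" "\<one>\<^bsub>M\<^esub>"] norm1[of "\<one>\<^bsub>M\<^esub>"] by auto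
  define W where "W = {x \<in> topspace TM. \<xi> x \<in> ball 1 1}"
  have W: "openin TM W" unfolding W_def by (rule openin_continuous_map_preimage[OF c\<xi>]) simp
  have "connected_component_of_set TM \<one>\<^bsub>M\<^esub> \<in> connected_components_of TM"
    by (simp add: connected_components_of_def topspace_eq)
  moreover have "connected_component_of_set TM \<one>\<^bsub>M\<^esub> = {\<one>\<^bsub>M\<^esub>}"
  proof -
    have "connectedin TM (connected_component_of_set TM \<one>\<^bsub>M\<^esub>)" by (rule connectedin_connected_component_of)
    then obtain x where "connected_component_of_set TM \<one>\<^bsub>M\<^esub> \<subseteq> {x}" using td unfolding totally_disconnected_space_def by blast
    moreover have "\<one>\<^bsub>M\<^esub> \<in> connected_component_of_set TM \<one>\<^bsub>M\<^esub>"
      by (simp add: connected_component_of_refl topspace_eq)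
    ultimately show ?thesis by blast
  qed
  ultimately have "{\<one>\<^bsub>M\<^esub>} \<in> connected_components_of TM" by simp
  moreover have "compactin TM {\<one>\<^bsub>M\<^esub>}" by (simp add: topspace_eq)
  moreover have "{\<one>\<^bsub>M\<^esub>} \<subseteq> W" using one by (simp add: W_def topspace_eq)
  ultimately obtain U V where UV: "openin TM U" "openin TM V" "disjnt U V" "U \<union> V = topspace TM"
    "{\<one>\<^bsub>M\<^esub>} \<subseteq> U" "U \<subseteq> W"
    using wilder_locally_compact_component_thm[OF compact_imp_locally_compact_space[OF comp] Haus _ _ W] by metis
  have "U = topspace TM - V" using UV by (auto simp: disjnt_iff)
  then have "compactin TM U" using UV comp closedin_compact_space by (metis closedin_diff closedin_topspace)
  \<comment> \<open>right translation by a small element preserves the clopen set \<open>U\<close>\<close>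
  define Q where "Q = {z \<in> topspace (prod_topology TM TM). snd z \<otimes>\<^bsub>M\<^esub> fst z \<in> U}"
  have "openin (prod_topology TM TM) Q"
    unfolding Q_def
    by (rule openin_continuous_map_preimage[OF continuous_map_mult[OF continuous_map_snd continuous_map_fst] UV(1)])
  moreover have "{\<one>\<^bsub>M\<^esub>} \<times> U \<subseteq> Q" using openin_subset[OF UV(1)] by (auto simp: Q_def topspace_eq)
  moreover have "\<one>\<^bsub>M\<^esub> \<in> topspace TM" by (simp add: topspace_eq)
  ultimately obtain S S' where S: "openin TM S" "\<one>\<^bsub>M\<^esub> \<in> S" "U \<subseteq> S'" "S \<times> S' \<subseteq> Q"
    using tube_lemma_right[OF _ \<open>compactin TM U\<close>] by metis
  have trivial: "\<xi> s = 1" if s: "s \<in> S" for s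
  proof (rule circle_no_small_subgroups)
    have sM: "s \<in> carrier M" using s openin_subset[OF S(1)] by (auto simp: topspace_eq)
    show "norm (\<xi> s) = 1" by (rule norm1[OF sM])
    have pow: "s [^]\<^bsub>M\<^esub> n \<in> U \<and> \<xi> (s [^]\<^bsub>M\<^esub> n) = \<xi> s ^ n" for n :: nat
    proof (induction n)
      case 0
      then show ?case using UV(5) one by simp
    next
      case (Suc n)
      then have "(s, s [^]\<^bsub>M\<^esub> n) \<in> Q" using s S by blast
      then show ?case using Suc sM mult by (simp add: Q_def)
    qed
    then have "\<xi> s ^ n \<in> ball 1 1" for n using UV(6) unfolding W_def by (metis (mono_tags, lifting) mem_Collect_eq subsetD)
    then show "norm (\<xi> s ^ n - 1) < 1" for n by (simp add: dist_norm norm_minus_commute)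
  qed
  define fibre where "fibre y = {x \<in> topspace TM. inv\<^bsub>M\<^esub> y \<otimes>\<^bsub>M\<^esub> x \<in> S}" for y
  have fibre_eq: "\<xi> x = \<xi> y" if "x \<in> fibre y" "y \<in> carrier M" for x y
  proof -
    have x: "x \<in> carrier M" using that by (simp add: fibre_def topspace_eq)
    have "\<xi> (inv\<^bsub>M\<^esub> y \<otimes>\<^bsub>M\<^esub> x) = 1" using that trivial by (simp add: fibre_def)
    then have "\<xi> (y \<otimes>\<^bsub>M\<^esub> (inv\<^bsub>M\<^esub> y \<otimes>\<^bsub>M\<^esub> x)) = \<xi> y" using mult[of y "inv\<^bsub>M\<^esub> y \<otimes>\<^bsub>M\<^esub> x"] that(2) x by simp
    then show ?thesis using that(2) x by (simp add: m_assoc[symmetric])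
  qed
  have "openin TM (fibre y)" if "y \<in> carrier M" for y
    unfolding fibre_def using that
    by (intro openin_continuous_map_preimage[OF _ S(1)] continuous_map_mult) (simp_all add: topspace_eq)
  moreover have "topspace TM \<subseteq> \<Union> (fibre ` carrier M)" using S(2) by (auto simp: fibre_def topspace_eq)
  ultimately have "\<exists>\<F>. finite \<F> \<and> \<F> \<subseteq> fibre ` carrier M \<and> topspace TM \<subseteq> \<Union>\<F>"
    using comp[unfolded compact_space_alt, rule_format, of "fibre ` carrier M"] by blast
  then obtain E where E: "finite E" "E \<subseteq> carrier M" "carrier M \<subseteq> \<Union> (fibre ` E)"
    using finite_subset_image[of _ fibre "carrier M"] unfolding topspace_eq by metis
  have "\<xi> ` carrier M \<subseteq> \<xi> ` E" using E fibre_eq by blast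
  then show ?thesis using E(1) finite_subset by blast
qed

section \<open>Permutations preserving the classes of a partition into finite sets\<close>

lemma locally_equal_continuous:
  assumes "\<And>z. z \<in> topspace Z \<Longrightarrow> \<exists>V g. openin Z V \<and> z \<in> V \<and> continuous_map Z Y g \<and> (\<forall>w\<in>V. f w = g w)"
  shows "continuous_map Z Y f"
  unfolding continuous_map_def
proof (intro conjI allI impI)
  show "f \<in> topspace Z \<rightarrow> topspace Y"
  proof
    fix z assume z: "z \<in> topspace Z"
    then obtain V g where "openin Z V" "z \<in> V" "continuous_map Z Y g" "\<forall>w\<in>V. f w = g w" using assms by blast
    then show "f z \<in> topspace Y" using z by (auto simp: continuous_map_def)
  qed
  fix U assume U: "openin Y U"
  show "openin Z {z \<in> topspace Z. f z \<in> U}"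
  proof (subst openin_subopen, intro ballI)
    fix z assume z: "z \<in> {z \<in> topspace Z. f z \<in> U}"
    then obtain V g where V: "openin Z V" "z \<in> V" "continuous_map Z Y g" "\<forall>w\<in>V. f w = g w" using assms by blast
    have "openin Z (V \<inter> {z \<in> topspace Z. g z \<in> U})"
      by (rule openin_Int[OF V(1) openin_continuous_map_preimage[OF V(3) U]])
    moreover have "V \<inter> {z \<in> topspace Z. g z \<in> U} \<subseteq> {z \<in> topspace Z. f z \<in> U}" using V(4) by auto
    moreover have "z \<in> V \<inter> {z \<in> topspace Z. g z \<in> U}" using z V by auto
    ultimately show "\<exists>W. openin Z W \<and> z \<in> W \<and> W \<subseteq> {z \<in> topspace Z. f z \<in> U}" by blast
  qed
qed

lemma locally_constant_continuous:
  assumes "\<And>z. z \<in> topspace Z \<Longrightarrow> f z \<in> topspace Y"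
    and "\<And>z. z \<in> topspace Z \<Longrightarrow> \<exists>V. openin Z V \<and> z \<in> V \<and> (\<forall>w\<in>V. f w = f z)"
  shows "continuous_map Z Y f"
proof (rule locally_equal_continuous)
  fix z assume z: "z \<in> topspace Z"
  then obtain V where "openin Z V" "z \<in> V" "\<forall>w\<in>V. f w = f z" using assms(2) by blast
  moreover have "continuous_map Z Y (\<lambda>w. f z)" using assms(1)[OF z] by simp
  ultimately show "\<exists>V g. openin Z V \<and> z \<in> V \<and> continuous_map Z Y g \<and> (\<forall>w\<in>V. f w = g w)" by blast
qed

lemma openin_discrete_fibre:
  assumes "continuous_map Z (discrete_topology S) f"
  shows "openin Z {z \<in> topspace Z. f z = v}"
proof -
  have "openin Z {z \<in> topspace Z. f z \<in> S \<inter> {v}}" by (rule openin_continuous_map_preimage[OF assms]) simp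
  moreover have "{z \<in> topspace Z. f z \<in> S \<inter> {v}} = {z \<in> topspace Z. f z = v}"
    using continuous_map_image_subset_topspace[OF assms] by auto
  ultimately show ?thesis by simp
qed

lemma totally_disconnected_by_coordinates:
  assumes coord: "\<And>i. i \<in> I \<Longrightarrow> totally_disconnected_space (Y i) \<and> continuous_map Z (Y i) (f i)"
    and sep: "\<And>x y. x \<in> topspace Z \<Longrightarrow> y \<in> topspace Z \<Longrightarrow> (\<And>i. i \<in> I \<Longrightarrow> f i x = f i y) \<Longrightarrow> x = y"
  shows "totally_disconnected_space Z"
  unfolding totally_disconnected_space_def
proof (intro allI impI)
  fix S assume S: "connectedin Z S"
  then have sub: "S \<subseteq> topspace Z" by (rule connectedin_subset_topspace)
  have same: "f i x = f i y" if i: "i \<in> I" and xy: "x \<in> S" "y \<in> S" for i x y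
  proof -
    have "connectedin (Y i) (f i ` S)" using coord[OF i] S connectedin_continuous_map_image by blast
    then obtain v where "f i ` S \<subseteq> {v}" using coord[OF i] unfolding totally_disconnected_space_def by blast
    then show ?thesis using xy by auto
  qed
  have "x = y" if "x \<in> S" "y \<in> S" for x y
    by (rule sep) (use that sub in blast, use that sub in blast, rule same[OF _ that])
  then show "\<exists>x. S \<subseteq> {x}" by blast
qed

lemma totally_disconnected_discrete: "totally_disconnected_space (discrete_topology S)"
  by (simp add: totally_disconnected_space_def connectedin_discrete_topology)

text \<open>The classes are given by a function, as the orbits of a group action will be.\<close>
locale finite_partition =
  fixes D :: "'d set" and cls :: "'d \<Rightarrow> 'd set"
  assumes finite_cls: "x \<in> D \<Longrightarrow> finite (cls x)"
    and cls_subset: "x \<in> D \<Longrightarrow> cls x \<subseteq> D"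
    and cls_self: "x \<in> D \<Longrightarrow> x \<in> cls x"
    and cls_eq: "x \<in> D \<Longrightarrow> y \<in> cls x \<Longrightarrow> cls y = cls x"
begin

definition perms :: "('d \<Rightarrow> 'd) set" where
  "perms = {\<sigma> \<in> Bij D. \<forall>x\<in>D. \<sigma> x \<in> cls x}"

definition perm_group :: "('d \<Rightarrow> 'd) monoid" where
  "perm_group = BijGroup D\<lparr>carrier := perms\<rparr>"

definition perm_topology :: "('d \<Rightarrow> 'd) topology" where
  "perm_topology = subtopology (product_topology (\<lambda>x. discrete_topology (cls x)) D) perms"

lemma perms_Bij: "\<sigma> \<in> perms \<Longrightarrow> \<sigma> \<in> Bij D"
  by (simp add: perms_def)

lemma perms_mult: "\<sigma> \<in> perms \<Longrightarrow> \<tau> \<in> perms \<Longrightarrow> x \<in> D \<Longrightarrow> (\<sigma> \<otimes>\<^bsub>perm_group\<^esub> \<tau>) x = \<sigma> (\<tau> x)"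
  by (simp add: perm_group_def BijGroup_def perms_Bij compose_def)

lemma perms_closed: "\<sigma> \<in> perms \<Longrightarrow> x \<in> D \<Longrightarrow> \<sigma> x \<in> D"
  using cls_subset by (auto simp: perms_def)

lemma perms_eqI: "\<sigma> \<in> perms \<Longrightarrow> \<tau> \<in> perms \<Longrightarrow> (\<And>x. x \<in> D \<Longrightarrow> \<sigma> x = \<tau> x) \<Longrightarrow> \<sigma> = \<tau>"
  by (rule extensionalityI[of _ D]) (auto simp: perms_def Bij_def)

text \<open>An injection that maps each finite class into itself is onto. Injectivity is a closed condition in
  the product of the classes, which will give compactness.\<close>
lemma perms_iff: "\<sigma> \<in> perms \<longleftrightarrow> \<sigma> \<in> (\<Pi>\<^sub>E x\<in>D. cls x) \<and> inj_on \<sigma> D"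
proof
  assume "\<sigma> \<in> perms"
  then show "\<sigma> \<in> (\<Pi>\<^sub>E x\<in>D. cls x) \<and> inj_on \<sigma> D"
    by (auto simp: perms_def Bij_def bij_betw_def PiE_iff)
next
  assume \<sigma>: "\<sigma> \<in> (\<Pi>\<^sub>E x\<in>D. cls x) \<and> inj_on \<sigma> D"
  have "\<sigma> ` D = D"
  proof
    show "\<sigma> ` D \<subseteq> D" using \<sigma> cls_subset by (auto simp: PiE_iff)
    show "D \<subseteq> \<sigma> ` D"
    proof
      fix x assume x: "x \<in> D"
      have "\<sigma> ` cls x \<subseteq> cls x"
      proof clarify
        fix y assume y: "y \<in> cls x"
        then have "y \<in> D" using cls_subset[OF x] by blast
        then have "\<sigma> y \<in> cls y" using \<sigma> by auto
        then show "\<sigma> y \<in> cls x" using cls_eq[OF x y] by simp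
      qed
      moreover have "inj_on \<sigma> (cls x)" using \<sigma> cls_subset[OF x] inj_on_subset by blast
      ultimately have "\<sigma> ` cls x = cls x" using finite_cls[OF x] by (simp add: endo_inj_surj)
      then show "x \<in> \<sigma> ` D" using cls_self[OF x] cls_subset[OF x] by blast
    qed
  qed
  then show "\<sigma> \<in> perms" using \<sigma> by (auto simp: perms_def Bij_def bij_betw_def PiE_iff)
qed

lemma subgroup_perms: "subgroup perms (BijGroup D)"
proof
  show "perms \<subseteq> carrier (BijGroup D)" by (auto simp: perms_def BijGroup_def)
  show "\<one>\<^bsub>BijGroup D\<^esub> \<in> perms" using cls_self by (auto simp: perms_iff BijGroup_def inj_on_def)
  fix \<sigma> assume \<sigma>: "\<sigma> \<in> perms"
  show "\<sigma> \<otimes>\<^bsub>BijGroup D\<^esub> \<tau> \<in> perms" if \<tau>: "\<tau> \<in> perms" for \<tau>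
  proof -
    have "\<sigma> \<otimes>\<^bsub>BijGroup D\<^esub> \<tau> \<in> Bij D"
      using perms_Bij[OF \<sigma>] perms_Bij[OF \<tau>] by (simp add: BijGroup_def compose_Bij)
    moreover have "(\<sigma> \<otimes>\<^bsub>BijGroup D\<^esub> \<tau>) x \<in> cls x" if x: "x \<in> D" for x
    proof -
      have "\<tau> x \<in> cls x" "\<sigma> (\<tau> x) \<in> cls (\<tau> x)" using \<sigma> \<tau> x perms_closed by (auto simp: perms_def)
      then have "\<sigma> (\<tau> x) \<in> cls x" using cls_eq[OF x] by blast
      then show ?thesis using perms_mult[OF \<sigma> \<tau> x] by (simp add: perm_group_def)
    qed
    ultimately show ?thesis by (simp add: perms_def)
  qed
  show "inv\<^bsub>BijGroup D\<^esub> \<sigma> \<in> perms"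
  proof -
    have inv: "inv\<^bsub>BijGroup D\<^esub> \<sigma> = (\<lambda>x\<in>D. inv_into D \<sigma> x)" using perms_Bij[OF \<sigma>] by (rule inv_BijGroup)
    have "(\<lambda>x\<in>D. inv_into D \<sigma> x) \<in> Bij D" using perms_Bij[OF \<sigma>] by (rule restrict_inv_into_Bij)
    moreover have "inv_into D \<sigma> x \<in> cls x" if x: "x \<in> D" for x
    proof -
      have im: "x \<in> \<sigma> ` D" using perms_Bij[OF \<sigma>] x by (simp add: Bij_def bij_betw_def)
      have y: "inv_into D \<sigma> x \<in> D" "\<sigma> (inv_into D \<sigma> x) = x"
        using inv_into_into[OF im] f_inv_into_f[OF im] by auto
      have "\<sigma> (inv_into D \<sigma> x) \<in> cls (inv_into D \<sigma> x)" using \<sigma> y(1) unfolding perms_def by blast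
      then have "x \<in> cls (inv_into D \<sigma> x)" unfolding y(2) .
      from cls_eq[OF y(1) this] show ?thesis using cls_self[OF y(1)] by blast
    qed
    ultimately show ?thesis unfolding inv by (simp add: perms_def)
  qed
qed

lemma continuous_map_perm_topology:
  "continuous_map Z perm_topology f \<longleftrightarrow>
     f \<in> topspace Z \<rightarrow> perms \<and> (\<forall>x\<in>D. continuous_map Z (discrete_topology (cls x)) (\<lambda>z. f z x))"
  unfolding perm_topology_def continuous_map_in_subtopology continuous_map_componentwise
  by (auto simp: perms_iff PiE_iff)

theorem profinite_perm_group: "profinite_group perm_group perm_topology"
proof -
  let ?P = "product_topology (\<lambda>x. discrete_topology (cls x)) D"
  have top: "topspace perm_topology = perms" by (auto simp: perm_topology_def perms_iff)
  have carrier: "carrier perm_group = perms" by (simp add: perm_group_def)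
  interpret group perm_group
    unfolding perm_group_def by (rule subgroup.subgroup_is_group[OF subgroup_perms group_BijGroup])
  have one: "\<one>\<^bsub>perm_group\<^esub> x = x" if "x \<in> D" for x using that by (simp add: perm_group_def BijGroup_def)
  have ev: "continuous_map perm_topology (discrete_topology (cls x)) (\<lambda>\<sigma>. \<sigma> x)" if "x \<in> D" for x
    using continuous_map_id[of perm_topology] that unfolding id_def continuous_map_perm_topology by blast
  have tg: "topological_group perm_group perm_topology"
  proof
    show "topspace perm_topology = carrier perm_group" by (simp add: top carrier)
    show "continuous_map (prod_topology perm_topology perm_topology) perm_topology (\<lambda>(\<sigma>, \<tau>). \<sigma> \<otimes>\<^bsub>perm_group\<^esub> \<tau>)"
      unfolding continuous_map_perm_topology
    proof (intro conjI ballI)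
      show "(\<lambda>(\<sigma>, \<tau>). \<sigma> \<otimes>\<^bsub>perm_group\<^esub> \<tau>) \<in> topspace (prod_topology perm_topology perm_topology) \<rightarrow> perms"
        using m_closed by (auto simp: top carrier)
      fix x assume x: "x \<in> D"
      show "continuous_map (prod_topology perm_topology perm_topology) (discrete_topology (cls x))
          (\<lambda>z. (case z of (\<sigma>, \<tau>) \<Rightarrow> \<sigma> \<otimes>\<^bsub>perm_group\<^esub> \<tau>) x)"
      proof (rule locally_constant_continuous)
        fix z assume "z \<in> topspace (prod_topology perm_topology perm_topology)"
        then obtain \<sigma> \<tau> where z: "z = (\<sigma>, \<tau>)" "\<sigma> \<in> perms" "\<tau> \<in> perms" by (auto simp: top)
        have "\<sigma> \<otimes>\<^bsub>perm_group\<^esub> \<tau> \<in> perms" using m_closed z by (simp add: carrier)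
        then show "(case z of (\<sigma>, \<tau>) \<Rightarrow> \<sigma> \<otimes>\<^bsub>perm_group\<^esub> \<tau>) x \<in> topspace (discrete_topology (cls x))"
          using x z by (simp add: perms_def)
        define V where "V = {\<sigma>' \<in> topspace perm_topology. \<sigma>' (\<tau> x) = \<sigma> (\<tau> x)} \<times> {\<tau>' \<in> topspace perm_topology. \<tau>' x = \<tau> x}"
        have "openin (prod_topology perm_topology perm_topology) V"
          unfolding V_def openin_prod_Times_iff
          using openin_discrete_fibre[OF ev] perms_closed[OF z(3) x] x by blast
        moreover have "z \<in> V" using z by (simp add: V_def top)
        moreover have "\<forall>w\<in>V. (case w of (\<sigma>, \<tau>) \<Rightarrow> \<sigma> \<otimes>\<^bsub>perm_group\<^esub> \<tau>) x = (case z of (\<sigma>, \<tau>) \<Rightarrow> \<sigma> \<otimes>\<^bsub>perm_group\<^esub> \<tau>) x"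
          using z x by (auto simp: V_def top perms_mult)
        ultimately show "\<exists>V. openin (prod_topology perm_topology perm_topology) V \<and> z \<in> V \<and>
            (\<forall>w\<in>V. (case w of (\<sigma>, \<tau>) \<Rightarrow> \<sigma> \<otimes>\<^bsub>perm_group\<^esub> \<tau>) x = (case z of (\<sigma>, \<tau>) \<Rightarrow> \<sigma> \<otimes>\<^bsub>perm_group\<^esub> \<tau>) x)" by blast
      qed
    qed
    show "continuous_map perm_topology perm_topology (\<lambda>\<sigma>. inv\<^bsub>perm_group\<^esub> \<sigma>)"
      unfolding continuous_map_perm_topology
    proof (intro conjI ballI)
      show "(\<lambda>\<sigma>. inv\<^bsub>perm_group\<^esub> \<sigma>) \<in> topspace perm_topology \<rightarrow> perms"
        using inv_closed by (auto simp: top carrier)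
      have inv: "inv\<^bsub>perm_group\<^esub> \<sigma> \<in> perms" if "\<sigma> \<in> perms" for \<sigma> using inv_closed that by (simp add: carrier)
      have l: "(inv\<^bsub>perm_group\<^esub> \<sigma>) (\<sigma> x) = x" and r: "\<sigma> ((inv\<^bsub>perm_group\<^esub> \<sigma>) x) = x" if "\<sigma> \<in> perms" "x \<in> D" for \<sigma> x
        using perms_mult[OF inv[OF that(1)] that] perms_mult[OF that(1) inv[OF that(1)] that(2)] one[OF that(2)] that(1)
        by (simp_all add: carrier)
      fix x assume x: "x \<in> D"
      show "continuous_map perm_topology (discrete_topology (cls x)) (\<lambda>\<sigma>. (inv\<^bsub>perm_group\<^esub> \<sigma>) x)"
      proof (rule locally_constant_continuous)
        fix \<sigma> assume "\<sigma> \<in> topspace perm_topology"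
        then have \<sigma>: "\<sigma> \<in> perms" by (simp add: top)
        show "(inv\<^bsub>perm_group\<^esub> \<sigma>) x \<in> topspace (discrete_topology (cls x))"
          using inv[OF \<sigma>] x by (simp add: perms_def)
        define y where "y = (inv\<^bsub>perm_group\<^esub> \<sigma>) x"
        have y: "y \<in> D" unfolding y_def by (rule perms_closed[OF inv[OF \<sigma>] x])
        have "openin perm_topology {\<tau> \<in> topspace perm_topology. \<tau> y = x}" by (rule openin_discrete_fibre[OF ev[OF y]])
        moreover have "\<sigma> \<in> {\<tau> \<in> topspace perm_topology. \<tau> y = x}" using \<sigma> r[OF \<sigma> x] by (simp add: top y_def)
        moreover have "(inv\<^bsub>perm_group\<^esub> \<tau>) x = y" if "\<tau> \<in> {\<tau> \<in> topspace perm_topology. \<tau> y = x}" for \<tau>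
          using l[of \<tau> y] y that by (auto simp: top)
        ultimately show "\<exists>V. openin perm_topology V \<and> \<sigma> \<in> V \<and> (\<forall>\<tau>\<in>V. (inv\<^bsub>perm_group\<^esub> \<tau>) x = (inv\<^bsub>perm_group\<^esub> \<sigma>) x)"
          unfolding y_def by blast
      qed
    qed
  qed
  have "closedin ?P {\<sigma> \<in> topspace ?P. \<forall>p\<in>{(x, y). x \<in> D \<and> y \<in> D \<and> x \<noteq> y}. \<sigma> (fst p) \<noteq> \<sigma> (snd p)}"
  proof (rule closedin_ball)
    fix p assume p: "p \<in> {(x, y). x \<in> D \<and> y \<in> D \<and> x \<noteq> y}"
    have cx: "continuous_map ?P (discrete_topology (cls (fst p))) (\<lambda>\<sigma>. \<sigma> (fst p))"
      and cy: "continuous_map ?P (discrete_topology (cls (snd p))) (\<lambda>\<sigma>. \<sigma> (snd p))"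
      using p by (auto intro: continuous_map_product_projection)
    have "openin ?P (\<Union>v\<in>UNIV. {\<sigma> \<in> topspace ?P. \<sigma> (fst p) = v} \<inter> {\<sigma> \<in> topspace ?P. \<sigma> (snd p) = v})"
      using openin_discrete_fibre[OF cx] openin_discrete_fibre[OF cy] by (intro openin_Union) blast
    moreover have "{\<sigma> \<in> topspace ?P. \<sigma> (fst p) \<noteq> \<sigma> (snd p)}
        = topspace ?P - (\<Union>v\<in>UNIV. {\<sigma> \<in> topspace ?P. \<sigma> (fst p) = v} \<inter> {\<sigma> \<in> topspace ?P. \<sigma> (snd p) = v})" by auto
    ultimately show "closedin ?P {\<sigma> \<in> topspace ?P. \<sigma> (fst p) \<noteq> \<sigma> (snd p)}"
      by (simp only: closedin_diff closedin_topspace)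
  qed
  moreover have "{\<sigma> \<in> topspace ?P. \<forall>p\<in>{(x, y). x \<in> D \<and> y \<in> D \<and> x \<noteq> y}. \<sigma> (fst p) \<noteq> \<sigma> (snd p)} = perms"
    unfolding perms_iff[abs_def] set_eq_iff by (auto simp: perms_iff inj_on_def)
  moreover have "compact_space ?P"
    using finite_cls by (simp add: compact_space_product_topology compact_space_discrete_topology)
  ultimately have comp: "compact_space perm_topology"
    unfolding perm_topology_def using closedin_compact_space compact_space_subtopology by fastforce
  have Haus: "Hausdorff_space perm_topology"
    unfolding perm_topology_def
    by (simp add: Hausdorff_space_subtopology Hausdorff_space_product_topology)
  have "totally_disconnected_space perm_topology"
    by (rule totally_disconnected_by_coordinates[where I = D and f = "\<lambda>x \<sigma>. \<sigma> x"])
      (use ev totally_disconnected_discrete perms_eqI in \<open>auto simp: top\<close>)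
  with tg comp Haus show ?thesis by (simp add: profinite_group_def compact_group_def)
qed

end

section \<open>Semidirect products of compact groups\<close>

lemma compact_group_semidirect_product:
  assumes A: "compact_group A TA" and K: "compact_group K TK" and \<theta>: "continuous_action K TK A TA \<theta>"
  shows "compact_group (semidirect_product A K \<theta>) (prod_topology TA TK)"
proof -
  interpret A: topological_group A TA using A by (simp add: compact_group_def)
  interpret K: topological_group K TK using K by (simp add: compact_group_def)
  let ?S = "semidirect_product A K \<theta>" and ?T = "prod_topology TA TK"
  have \<theta>_iso: "\<theta> k \<in> iso A A" if "k \<in> carrier K" for k using \<theta> that by (simp add: continuous_action_def)
  have \<theta>_closed: "\<theta> k a \<in> carrier A" if "k \<in> carrier K" "a \<in> carrier A" for k a
    using \<theta>_iso[OF that(1)] that(2) by (auto simp: iso_def hom_def)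
  have \<theta>_mult: "\<theta> k (a \<otimes>\<^bsub>A\<^esub> b) = \<theta> k a \<otimes>\<^bsub>A\<^esub> \<theta> k b" if "k \<in> carrier K" "a \<in> carrier A" "b \<in> carrier A" for k a b
    using \<theta>_iso[OF that(1)] that(2,3) by (auto simp: iso_def hom_def)
  have \<theta>_one: "\<theta> \<one>\<^bsub>K\<^esub> a = a" if "a \<in> carrier A" for a using \<theta> that by (simp add: continuous_action_def)
  have \<theta>_comp: "\<theta> (k \<otimes>\<^bsub>K\<^esub> l) a = \<theta> k (\<theta> l a)" if "k \<in> carrier K" "l \<in> carrier K" "a \<in> carrier A" for k l a
    using \<theta> that by (simp add: continuous_action_def)
  have \<theta>_cont: "continuous_map Z TA (\<lambda>z. \<theta> (f z) (g z))"
    if "continuous_map Z TK f" "continuous_map Z TA g" for Z :: "'z topology" and f g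
    using \<theta> continuous_map_compose2[OF _ continuous_map_pairedI[OF that], of TA "\<lambda>(k, a). \<theta> k a"]
    by (simp add: continuous_action_def)
  have \<theta>_A_one: "\<theta> k \<one>\<^bsub>A\<^esub> = \<one>\<^bsub>A\<^esub>" if "k \<in> carrier K" for k
    using \<theta>_mult[OF that A.one_closed A.one_closed] \<theta>_closed[OF that A.one_closed]
    by (metis A.l_one A.one_closed A.r_cancel_one')
  have inv: "(\<theta> (inv\<^bsub>K\<^esub> k) (inv\<^bsub>A\<^esub> a), inv\<^bsub>K\<^esub> k) \<otimes>\<^bsub>?S\<^esub> (a, k) = \<one>\<^bsub>?S\<^esub>" if "a \<in> carrier A" "k \<in> carrier K" for a k
    using that \<theta>_mult[of "inv\<^bsub>K\<^esub> k" "inv\<^bsub>A\<^esub> a" a] \<theta>_A_one by (simp add: semidirect_product_def)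
  have grp: "group ?S"
  proof (rule groupI)
    fix x y z assume "x \<in> carrier ?S" "y \<in> carrier ?S" "z \<in> carrier ?S"
    then show "x \<otimes>\<^bsub>?S\<^esub> y \<otimes>\<^bsub>?S\<^esub> z = x \<otimes>\<^bsub>?S\<^esub> (y \<otimes>\<^bsub>?S\<^esub> z)"
      by (auto simp: semidirect_product_def \<theta>_mult \<theta>_comp \<theta>_closed A.m_assoc K.m_assoc)
  next
    fix x assume "x \<in> carrier ?S"
    then obtain a k where x: "x = (a, k)" "a \<in> carrier A" "k \<in> carrier K" by (auto simp: semidirect_product_def)
    show "\<one>\<^bsub>?S\<^esub> \<otimes>\<^bsub>?S\<^esub> x = x" using x by (simp add: semidirect_product_def \<theta>_one)
    show "\<exists>y\<in>carrier ?S. y \<otimes>\<^bsub>?S\<^esub> x = \<one>\<^bsub>?S\<^esub>"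
      using inv[OF x(2,3)] x \<theta>_closed
      by (intro bexI[of _ "(\<theta> (inv\<^bsub>K\<^esub> k) (inv\<^bsub>A\<^esub> a), inv\<^bsub>K\<^esub> k)"]) (auto simp: semidirect_product_def)
  qed (auto simp: semidirect_product_def \<theta>_closed)
  interpret S: group ?S by fact
  have inv_eq: "inv\<^bsub>?S\<^esub> x = (\<theta> (inv\<^bsub>K\<^esub> (snd x)) (inv\<^bsub>A\<^esub> (fst x)), inv\<^bsub>K\<^esub> (snd x))" if "x \<in> carrier ?S" for x
    using that inv[of "fst x" "snd x"] \<theta>_closed
    by (intro S.inv_equality) (auto simp: semidirect_product_def)
  have top: "topspace ?T = carrier ?S" by (simp add: semidirect_product_def A.topspace_eq K.topspace_eq)
  have tg: "topological_group ?S ?T"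
  proof
    show "topspace ?T = carrier ?S" by (rule top)
    have c: "continuous_map (prod_topology ?T ?T) TA (\<lambda>z. fst (fst z))" "continuous_map (prod_topology ?T ?T) TK (\<lambda>z. snd (fst z))"
      "continuous_map (prod_topology ?T ?T) TA (\<lambda>z. fst (snd z))" "continuous_map (prod_topology ?T ?T) TK (\<lambda>z. snd (snd z))"
      by (rule continuous_map_compose2[OF continuous_map_fst continuous_map_fst]
          continuous_map_compose2[OF continuous_map_snd continuous_map_fst]
          continuous_map_compose2[OF continuous_map_fst continuous_map_snd]
          continuous_map_compose2[OF continuous_map_snd continuous_map_snd])+
    have "continuous_map (prod_topology ?T ?T) ?T
        (\<lambda>z. (fst (fst z) \<otimes>\<^bsub>A\<^esub> \<theta> (snd (fst z)) (fst (snd z)), snd (fst z) \<otimes>\<^bsub>K\<^esub> snd (snd z)))"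
      by (intro continuous_map_pairedI A.continuous_map_mult K.continuous_map_mult \<theta>_cont c)
    then show "continuous_map (prod_topology ?T ?T) ?T (\<lambda>(x, y). x \<otimes>\<^bsub>?S\<^esub> y)"
      by (simp add: semidirect_product_def case_prod_unfold)
    have "continuous_map ?T ?T (\<lambda>x. (\<theta> (inv\<^bsub>K\<^esub> (snd x)) (inv\<^bsub>A\<^esub> (fst x)), inv\<^bsub>K\<^esub> (snd x)))"
      by (intro continuous_map_pairedI \<theta>_cont continuous_map_compose2[OF K.continuous_inv]
          continuous_map_compose2[OF A.continuous_inv] continuous_map_fst continuous_map_snd)
    then show "continuous_map ?T ?T (\<lambda>x. inv\<^bsub>?S\<^esub> x)"
      by (rule continuous_map_eq) (simp only: top inv_eq)
  qed
  then show ?thesis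
    using A K by (simp add: compact_group_def compact_space_prod_topology Hausdorff_space_prod_topology)
qed

lemma totally_disconnected_prod_topology:
  assumes "totally_disconnected_space TA" "totally_disconnected_space TK"
  shows "totally_disconnected_space (prod_topology TA TK)"
  unfolding totally_disconnected_space_def
proof (intro allI impI)
  fix S assume S: "connectedin (prod_topology TA TK) S"
  obtain a k where "fst ` S \<subseteq> {a}" "snd ` S \<subseteq> {k}"
    using assms connectedin_continuous_map_image[OF continuous_map_fst S]
      connectedin_continuous_map_image[OF continuous_map_snd S]
    unfolding totally_disconnected_space_def by metis
  then have "S \<subseteq> {(a, k)}" by force
  then show "\<exists>x. S \<subseteq> {x}" by blast
qed

section \<open>The characters of the abelian normal factor\<close>

lemma (in group) conj_mult:
  assumes "h \<in> carrier G" "m \<in> carrier G" "n \<in> carrier G"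
  shows "inv h \<otimes> (m \<otimes> n) \<otimes> h = (inv h \<otimes> m \<otimes> h) \<otimes> (inv h \<otimes> n \<otimes> h)"
proof -
  have "h \<otimes> (inv h \<otimes> (n \<otimes> h)) = n \<otimes> h" using assms by (simp add: m_assoc[symmetric])
  then show ?thesis using assms by (simp add: m_assoc)
qed

locale abelian_semidirect_product = topological_group G T
  for G :: "('g, 'm) monoid_scheme" (structure) and T :: "'g topology" +
  fixes N H :: "'g set"
  assumes sdp: "topological_semidirect_product G T N H"
    and N_abelian: "comm_group (G\<lparr>carrier := N\<rparr>)"
begin

abbreviation GN :: "('g, 'm) monoid_scheme" where "GN \<equiv> G\<lparr>carrier := N\<rparr>"
abbreviation TN :: "'g topology" where "TN \<equiv> subtopology T N"
abbreviation GH :: "('g, 'm) monoid_scheme" where "GH \<equiv> G\<lparr>carrier := H\<rparr>"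
abbreviation TH :: "'g topology" where "TH \<equiv> subtopology T H"
abbreviation Nhat :: "('g \<Rightarrow> complex) monoid" where "Nhat \<equiv> dual_group GN TN"
abbreviation cconj :: "'g \<Rightarrow> ('g \<Rightarrow> complex) \<Rightarrow> 'g \<Rightarrow> complex" where "cconj \<equiv> conj_char G N"

lemma N_normal: "N \<lhd> G" and H_subgroup: "subgroup H G"
  using sdp by (simp_all add: topological_semidirect_product_def)

lemma N_subgroup: "subgroup N G"
  using N_normal by (rule normal_imp_subgroup)

lemma N_carrier: "n \<in> N \<Longrightarrow> n \<in> carrier G" and H_carrier: "h \<in> H \<Longrightarrow> h \<in> carrier G"
  using subgroup.subset[OF N_subgroup] subgroup.subset[OF H_subgroup] by blast+

lemma topspace_TN: "topspace TN = N" and topspace_TH: "topspace TH = H"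
  using N_carrier H_carrier by (auto simp: topspace_eq)

lemma topological_group_H: "topological_group GH TH"
  by (rule topological_group_subgroup[OF H_subgroup])

lemma conj_closed: "h \<in> carrier G \<Longrightarrow> n \<in> N \<Longrightarrow> inv h \<otimes> n \<otimes> h \<in> N"
  using normal.inv_op_closed1[OF N_normal] .

lemma N_closed: "m \<in> N \<Longrightarrow> n \<in> N \<Longrightarrow> m \<otimes> n \<in> N" "\<one> \<in> N" "n \<in> N \<Longrightarrow> inv n \<in> N"
  and H_closed: "h \<in> H \<Longrightarrow> k \<in> H \<Longrightarrow> h \<otimes> k \<in> H" "\<one> \<in> H" "h \<in> H \<Longrightarrow> inv h \<in> H"
  using N_subgroup H_subgroup by (auto simp: subgroup_def)

lemma carrier_Nhat:
  "\<xi> \<in> carrier Nhat \<longleftrightarrow> \<xi> \<in> extensional N \<and> continuous_map TN euclidean \<xi> \<and>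
     (\<forall>n\<in>N. norm (\<xi> n) = 1) \<and> (\<forall>m\<in>N. \<forall>n\<in>N. \<xi> (m \<otimes> n) = \<xi> m * \<xi> n)"
  using continuous_hom_circle[of TN GN \<xi>] topspace_TN by (simp add: dual_group_def)

lemma Nhat_eqI: "\<xi> \<in> carrier Nhat \<Longrightarrow> \<psi> \<in> carrier Nhat \<Longrightarrow> (\<And>n. n \<in> N \<Longrightarrow> \<xi> n = \<psi> n) \<Longrightarrow> \<xi> = \<psi>"
  by (rule extensionalityI[of _ N]) (auto simp: carrier_Nhat)

lemma comm_group_Nhat: "comm_group Nhat"
  and inv_Nhat: "\<xi> \<in> carrier Nhat \<Longrightarrow> inv\<^bsub>Nhat\<^esub> \<xi> = (\<lambda>n\<in>N. cnj (\<xi> n))"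
proof -
  have inv: "(\<lambda>n\<in>N. cnj (\<xi> n)) \<in> carrier Nhat" "(\<lambda>n\<in>N. cnj (\<xi> n)) \<otimes>\<^bsub>Nhat\<^esub> \<xi> = \<one>\<^bsub>Nhat\<^esub>"
    if \<xi>: "\<xi> \<in> carrier Nhat" for \<xi>
  proof -
    have "continuous_map TN euclidean (\<lambda>n. cnj (\<xi> n))" using \<xi> by (simp add: carrier_Nhat continuous_map_cnj)
    then have "continuous_map TN euclidean (\<lambda>n\<in>N. cnj (\<xi> n))"
      by (rule continuous_map_eq) (auto simp: topspace_TN)
    then show "(\<lambda>n\<in>N. cnj (\<xi> n)) \<in> carrier Nhat" using \<xi> N_closed by (auto simp: carrier_Nhat)
    have "cnj (\<xi> n) * \<xi> n = 1" if n: "n \<in> N" for n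
      using \<xi> n complex_norm_square[of "\<xi> n"] by (simp add: carrier_Nhat mult.commute)
    then show "(\<lambda>n\<in>N. cnj (\<xi> n)) \<otimes>\<^bsub>Nhat\<^esub> \<xi> = \<one>\<^bsub>Nhat\<^esub>" by (auto simp: mult_dual one_dual)
  qed
  have closed: "\<xi> \<otimes>\<^bsub>Nhat\<^esub> \<psi> \<in> carrier Nhat" if "\<xi> \<in> carrier Nhat" "\<psi> \<in> carrier Nhat" for \<xi> \<psi>
  proof -
    have "continuous_map TN euclidean (\<lambda>n. \<xi> n * \<psi> n)"
      using that by (simp add: carrier_Nhat continuous_map_mult_algebra)
    then have "continuous_map TN euclidean (\<lambda>n\<in>N. \<xi> n * \<psi> n)"
      by (rule continuous_map_eq) (auto simp: topspace_TN)
    then show ?thesis using that N_closed by (auto simp: carrier_Nhat mult_dual norm_mult)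
  qed
  have "continuous_map TN euclidean (\<lambda>n\<in>N. 1 :: complex)"
    by (rule continuous_map_eq[of _ _ "\<lambda>n. 1"]) (auto simp: topspace_TN)
  then have one: "\<one>\<^bsub>Nhat\<^esub> \<in> carrier Nhat" using N_closed by (auto simp: carrier_Nhat one_dual)
  show grp: "comm_group Nhat"
  proof (rule comm_groupI)
    show "\<one>\<^bsub>Nhat\<^esub> \<otimes>\<^bsub>Nhat\<^esub> \<xi> = \<xi>" if "\<xi> \<in> carrier Nhat" for \<xi>
      using that by (auto simp: carrier_Nhat mult_dual one_dual extensional_def)
    show "\<exists>\<psi>\<in>carrier Nhat. \<psi> \<otimes>\<^bsub>Nhat\<^esub> \<xi> = \<one>\<^bsub>Nhat\<^esub>" if "\<xi> \<in> carrier Nhat" for \<xi>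
      using inv[OF that] by blast
  qed (use one closed N_closed in \<open>auto simp: mult_dual fun_eq_iff\<close>)
  then interpret Nh: comm_group Nhat .
  show "inv\<^bsub>Nhat\<^esub> \<xi> = (\<lambda>n\<in>N. cnj (\<xi> n))" if "\<xi> \<in> carrier Nhat"
    using Nh.inv_equality[OF inv(2) that inv(1)] that by simp
qed

lemma cconj_closed:
  assumes h: "h \<in> carrier G" and \<xi>: "\<xi> \<in> carrier Nhat"
  shows "cconj h \<xi> \<in> carrier Nhat"
proof -
  have id: "continuous_map TN T (\<lambda>n. n)"
    using continuous_map_from_subtopology[OF continuous_map_id[of T], of N] by (simp add: id_def)
  have "inv h \<in> topspace T" "h \<in> topspace T" using h by (simp_all add: topspace_eq)
  then have "continuous_map TN T (\<lambda>n. inv h)" "continuous_map TN T (\<lambda>n. h)"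
    by (simp_all only: continuous_map_const simp_thms)
  from continuous_map_mult[OF continuous_map_mult[OF this(1) id] this(2)]
  have "continuous_map TN T (\<lambda>n. inv h \<otimes> n \<otimes> h)" .
  then have "continuous_map TN TN (\<lambda>n. inv h \<otimes> n \<otimes> h)"
    using conj_closed[OF h] topspace_TN by (auto simp: continuous_map_in_subtopology)
  moreover have "continuous_map TN euclidean \<xi>" using \<xi> by (simp add: carrier_Nhat)
  ultimately have "continuous_map TN euclidean (\<lambda>n. \<xi> (inv h \<otimes> n \<otimes> h))"
    by (rule continuous_map_compose2[rotated])
  then have "continuous_map TN euclidean (cconj h \<xi>)"
    by (rule continuous_map_eq) (auto simp: topspace_TN conj_char_def)
  moreover have "\<xi> (inv h \<otimes> (m \<otimes> n) \<otimes> h) = \<xi> (inv h \<otimes> m \<otimes> h) * \<xi> (inv h \<otimes> n \<otimes> h)"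
    if mn: "m \<in> N" "n \<in> N" for m n
    using conj_mult[OF h N_carrier[OF mn(1)] N_carrier[OF mn(2)]] \<xi> conj_closed[OF h mn(1)] conj_closed[OF h mn(2)]
    by (simp add: carrier_Nhat)
  ultimately show ?thesis
    using \<xi> conj_closed[OF h] N_closed by (auto simp: carrier_Nhat conj_char_def)
qed

lemma cconj_cconj:
  assumes "h \<in> carrier G" "k \<in> carrier G"
  shows "cconj h (cconj k \<xi>) = cconj (h \<otimes> k) \<xi>"
proof
  fix n
  have "inv k \<otimes> (inv h \<otimes> n \<otimes> h) \<otimes> k = inv (h \<otimes> k) \<otimes> n \<otimes> (h \<otimes> k)" if "n \<in> N"
    using assms N_carrier[OF that] by (simp add: inv_mult_group m_assoc)
  then show "cconj h (cconj k \<xi>) n = cconj (h \<otimes> k) \<xi> n"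
    using conj_closed[OF assms(1)] by (simp add: conj_char_def)
qed

lemma cconj_one: "\<xi> \<in> carrier Nhat \<Longrightarrow> cconj \<one> \<xi> = \<xi>"
  using N_carrier by (auto simp: conj_char_def carrier_Nhat extensional_def fun_eq_iff)

lemma cconj_mult: "h \<in> carrier G \<Longrightarrow> cconj h (\<xi> \<otimes>\<^bsub>Nhat\<^esub> \<psi>) = cconj h \<xi> \<otimes>\<^bsub>Nhat\<^esub> cconj h \<psi>"
  using conj_closed by (auto simp: conj_char_def mult_dual fun_eq_iff)

lemma periodic_chars_subgroup: "subgroup (periodic_chars G T N H) Nhat"
proof
  interpret Nh: comm_group Nhat by (rule comm_group_Nhat)
  show "periodic_chars G T N H \<subseteq> carrier Nhat" by (auto simp: periodic_chars_def)
  have "cconj h \<one>\<^bsub>Nhat\<^esub> = \<one>\<^bsub>Nhat\<^esub>" if "h \<in> H" for h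
    using conj_closed H_carrier[OF that] by (auto simp: conj_char_def one_dual fun_eq_iff)
  then have "(\<lambda>h. cconj h \<one>\<^bsub>Nhat\<^esub>) ` H \<subseteq> {\<one>\<^bsub>Nhat\<^esub>}" by auto
  then show "\<one>\<^bsub>Nhat\<^esub> \<in> periodic_chars G T N H"
    unfolding periodic_chars_def using Nh.one_closed finite_subset by blast
  fix \<xi> assume \<xi>: "\<xi> \<in> periodic_chars G T N H"
  show "\<xi> \<otimes>\<^bsub>Nhat\<^esub> \<psi> \<in> periodic_chars G T N H" if \<psi>: "\<psi> \<in> periodic_chars G T N H" for \<psi>
  proof -
    have "(\<lambda>h. cconj h (\<xi> \<otimes>\<^bsub>Nhat\<^esub> \<psi>)) ` H \<subseteq> (\<lambda>(a, b). a \<otimes>\<^bsub>Nhat\<^esub> b) ` ((\<lambda>h. cconj h \<xi>) ` H \<times> (\<lambda>h. cconj h \<psi>) ` H)"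
      using cconj_mult H_carrier by (auto simp: image_iff)
    moreover have "finite ((\<lambda>h. cconj h \<xi>) ` H \<times> (\<lambda>h. cconj h \<psi>) ` H)"
      using \<xi> \<psi> by (intro finite_cartesian_product) (simp_all add: periodic_chars_def)
    ultimately have "finite ((\<lambda>h. cconj h (\<xi> \<otimes>\<^bsub>Nhat\<^esub> \<psi>)) ` H)" using finite_surj by blast
    then show ?thesis using \<xi> \<psi> by (simp add: periodic_chars_def)
  qed
  show "inv\<^bsub>Nhat\<^esub> \<xi> \<in> periodic_chars G T N H"
  proof -
    have c: "\<xi> \<in> carrier Nhat" using \<xi> by (simp add: periodic_chars_def)
    have "cconj h (inv\<^bsub>Nhat\<^esub> \<xi>) = (\<lambda>n\<in>N. cnj (cconj h \<xi> n))" if "h \<in> H" for h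
      using conj_closed[OF H_carrier[OF that]] by (auto simp: inv_Nhat[OF c] conj_char_def fun_eq_iff)
    then have "(\<lambda>h. cconj h (inv\<^bsub>Nhat\<^esub> \<xi>)) ` H \<subseteq> (\<lambda>a. \<lambda>n\<in>N. cnj (a n)) ` (\<lambda>h. cconj h \<xi>) ` H" by auto
    moreover have "finite ((\<lambda>h. cconj h \<xi>) ` H)" using \<xi> by (simp add: periodic_chars_def)
    ultimately have "finite ((\<lambda>h. cconj h (inv\<^bsub>Nhat\<^esub> \<xi>)) ` H)" using finite_surj by blast
    then show ?thesis using c by (simp add: periodic_chars_def)
  qed
qed

lemma periodic_chars_invariant:
  assumes h: "h \<in> H" and \<xi>: "\<xi> \<in> periodic_chars G T N H"
  shows "cconj h \<xi> \<in> periodic_chars G T N H"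
proof -
  have "(\<lambda>k. cconj k (cconj h \<xi>)) ` H \<subseteq> (\<lambda>k. cconj k \<xi>) ` H"
    using h H_closed H_carrier by (auto simp: cconj_cconj)
  moreover have "finite ((\<lambda>k. cconj k \<xi>) ` H)" using \<xi> by (simp add: periodic_chars_def)
  ultimately show ?thesis
    using cconj_closed[OF H_carrier[OF h]] \<xi> finite_subset unfolding periodic_chars_def by blast
qed

lemma finite_periodic_chars_subgroup: "subgroup (finite_periodic_chars G T N H) Nhat"
proof
  interpret Nh: comm_group Nhat by (rule comm_group_Nhat)
  note P = periodic_chars_subgroup
  show "finite_periodic_chars G T N H \<subseteq> carrier Nhat"
    using subgroup.subset[OF P] by (auto simp: finite_periodic_chars_def)
  have "\<one>\<^bsub>Nhat\<^esub> ` N \<subseteq> {1}" by (auto simp: one_dual)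
  then show "\<one>\<^bsub>Nhat\<^esub> \<in> finite_periodic_chars G T N H"
    using subgroup.one_closed[OF P] finite_subset by (auto simp: finite_periodic_chars_def)
  fix \<xi> assume \<xi>: "\<xi> \<in> finite_periodic_chars G T N H"
  show "\<xi> \<otimes>\<^bsub>Nhat\<^esub> \<psi> \<in> finite_periodic_chars G T N H" if \<psi>: "\<psi> \<in> finite_periodic_chars G T N H" for \<psi>
  proof -
    have "(\<xi> \<otimes>\<^bsub>Nhat\<^esub> \<psi>) ` N \<subseteq> (\<lambda>(a, b). a * b) ` (\<xi> ` N \<times> \<psi> ` N)"
      by (auto simp: mult_dual image_iff)
    moreover have "finite (\<xi> ` N \<times> \<psi> ` N)"
      using \<xi> \<psi> by (intro finite_cartesian_product) (simp_all add: finite_periodic_chars_def)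
    ultimately have "finite ((\<xi> \<otimes>\<^bsub>Nhat\<^esub> \<psi>) ` N)" using finite_surj by blast
    then show ?thesis using subgroup.m_closed[OF P] \<xi> \<psi> by (auto simp: finite_periodic_chars_def)
  qed
  have "\<xi> \<in> carrier Nhat" using \<xi> by (simp add: finite_periodic_chars_def periodic_chars_def)
  then have "(inv\<^bsub>Nhat\<^esub> \<xi>) ` N = cnj ` \<xi> ` N" by (auto simp: inv_Nhat image_iff)
  then show "inv\<^bsub>Nhat\<^esub> \<xi> \<in> finite_periodic_chars G T N H"
    using subgroup.m_inv_closed[OF P] \<xi> by (simp add: finite_periodic_chars_def)
qed

lemma finite_periodic_chars_invariant:
  assumes h: "h \<in> H" and \<xi>: "\<xi> \<in> finite_periodic_chars G T N H"
  shows "cconj h \<xi> \<in> finite_periodic_chars G T N H"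
proof -
  have "cconj h \<xi> ` N \<subseteq> \<xi> ` N" using conj_closed[OF H_carrier[OF h]] by (auto simp: conj_char_def)
  then show ?thesis
    using periodic_chars_invariant[OF h] \<xi> finite_subset by (auto simp: finite_periodic_chars_def)
qed

text \<open>The closure of the image of \<open>N\<close> is normal in \<open>K\<close>: it is normalised by the image of \<open>G\<close>, and
  normalising a closed subgroup is a closed condition.\<close>
lemma closure_image_N:
  assumes K: "topological_group K TK" and \<beta>: "continuous_hom G T K TK \<beta>"
    and dense: "TK closure_of (\<beta> ` carrier G) = topspace TK"
  shows "subgroup (TK closure_of (\<beta> ` N)) K"
    and "\<lbrakk>l \<in> carrier K; m \<in> TK closure_of (\<beta> ` N)\<rbrakk> \<Longrightarrow>
      inv\<^bsub>K\<^esub> l \<otimes>\<^bsub>K\<^esub> m \<otimes>\<^bsub>K\<^esub> l \<in> TK closure_of (\<beta> ` N)"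
proof -
  interpret K: topological_group K TK by fact
  interpret \<beta>: group_hom G K \<beta> using \<beta> by unfold_locales (simp add: continuous_hom_def)
  let ?M = "TK closure_of (\<beta> ` N)"
  show sM: "subgroup ?M K"
    by (rule K.subgroup_closure_of[OF \<beta>.subgroup_img_is_subgroup[OF N_subgroup]])
  have step: "inv\<^bsub>K\<^esub> (\<beta> g) \<otimes>\<^bsub>K\<^esub> m \<otimes>\<^bsub>K\<^esub> \<beta> g \<in> ?M" if g: "g \<in> carrier G" and m: "m \<in> ?M" for g m
  proof -
    have "continuous_map TK TK (\<lambda>x. inv\<^bsub>K\<^esub> (\<beta> g) \<otimes>\<^bsub>K\<^esub> x \<otimes>\<^bsub>K\<^esub> \<beta> g)"
      using g by (intro K.continuous_map_mult) (simp_all add: K.topspace_eq)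
    then have "(\<lambda>x. inv\<^bsub>K\<^esub> (\<beta> g) \<otimes>\<^bsub>K\<^esub> x \<otimes>\<^bsub>K\<^esub> \<beta> g) ` ?M
        \<subseteq> TK closure_of ((\<lambda>x. inv\<^bsub>K\<^esub> (\<beta> g) \<otimes>\<^bsub>K\<^esub> x \<otimes>\<^bsub>K\<^esub> \<beta> g) ` \<beta> ` N)"
      by (rule continuous_map_image_closure_subset)
    moreover have "inv\<^bsub>K\<^esub> (\<beta> g) \<otimes>\<^bsub>K\<^esub> \<beta> n \<otimes>\<^bsub>K\<^esub> \<beta> g = \<beta> (inv g \<otimes> n \<otimes> g)" if "n \<in> N" for n
      using g N_carrier[OF that] by simp
    then have "(\<lambda>x. inv\<^bsub>K\<^esub> (\<beta> g) \<otimes>\<^bsub>K\<^esub> x \<otimes>\<^bsub>K\<^esub> \<beta> g) ` \<beta> ` N \<subseteq> \<beta> ` N" using conj_closed[OF g] by auto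
    ultimately show ?thesis using m closure_of_mono by blast
  qed
  show "inv\<^bsub>K\<^esub> l \<otimes>\<^bsub>K\<^esub> m \<otimes>\<^bsub>K\<^esub> l \<in> ?M" if l: "l \<in> carrier K" and m: "m \<in> ?M"
  proof -
    have mK: "m \<in> carrier K" using m subgroup.subset[OF sM] by blast
    have "continuous_map TK TK (\<lambda>x. inv\<^bsub>K\<^esub> x \<otimes>\<^bsub>K\<^esub> m \<otimes>\<^bsub>K\<^esub> x)"
      using mK by (intro K.continuous_map_mult K.continuous_inv) (simp_all add: K.topspace_eq)
    then have "(\<lambda>x. inv\<^bsub>K\<^esub> x \<otimes>\<^bsub>K\<^esub> m \<otimes>\<^bsub>K\<^esub> x) ` (TK closure_of (\<beta> ` carrier G))
        \<subseteq> TK closure_of ((\<lambda>x. inv\<^bsub>K\<^esub> x \<otimes>\<^bsub>K\<^esub> m \<otimes>\<^bsub>K\<^esub> x) ` \<beta> ` carrier G)"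
      by (rule continuous_map_image_closure_subset)
    also have "\<dots> \<subseteq> TK closure_of ?M" using step[OF _ m] by (intro closure_of_mono) auto
    finally show ?thesis using l by (auto simp: dense K.topspace_eq)
  qed
qed

text \<open>The conjugates \<open>F l\<close> of \<open>\<xi>\<close> under \<open>l \<in> K\<close> depend locally constantly on \<open>l\<close>: for \<open>k\<close> near \<open>l\<close>, the
  quotient of \<open>F k\<close> and \<open>F l\<close> is a character of \<open>M\<close> that is uniformly close to \<open>1\<close>. By compactness
  of \<open>K\<close> there are only finitely many conjugates, and the orbit under \<open>H\<close> consists of restrictions
  of some of them.\<close>
theorem restricted_character_periodic:
  assumes K: "compact_group K TK" and \<beta>: "continuous_hom G T K TK \<beta>"
    and dense: "TK closure_of (\<beta> ` carrier G) = topspace TK"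
    and M: "M = TK closure_of (\<beta> ` N)"
    and \<xi>: "continuous_hom (K\<lparr>carrier := M\<rparr>) (subtopology TK M) circle_group circle_topology \<xi>"
  shows "(\<lambda>n\<in>N. \<xi> (\<beta> n)) \<in> periodic_chars G T N H"
proof -
  have tgK: "topological_group K TK" and compK: "compact_space TK" using K by (simp_all add: compact_group_def)
  interpret K: topological_group K TK by fact
  interpret \<beta>: group_hom G K \<beta> using \<beta> by unfold_locales (simp add: continuous_hom_def)
  have c\<beta>: "continuous_map T TK \<beta>" using \<beta> by (simp add: continuous_hom_def)
  have sM: "subgroup M K" and normM: "\<And>l m. l \<in> carrier K \<Longrightarrow> m \<in> M \<Longrightarrow> inv\<^bsub>K\<^esub> l \<otimes>\<^bsub>K\<^esub> m \<otimes>\<^bsub>K\<^esub> l \<in> M"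
    unfolding M using closure_image_N[OF tgK \<beta> dense] by blast+
  have MK: "m \<in> carrier K" if "m \<in> M" for m using that subgroup.subset[OF sM] by blast
  have "\<beta> ` N \<subseteq> topspace TK" using N_carrier by (auto simp: K.topspace_eq)
  then have \<beta>M: "\<beta> n \<in> M" if "n \<in> N" for n using that closure_of_subset unfolding M by blast
  interpret GM: topological_group "K\<lparr>carrier := M\<rparr>" "subtopology TK M" by (rule K.topological_group_subgroup[OF sM])
  have topM: "topspace (subtopology TK M) = M" using GM.topspace_eq by simp
  have c\<xi>: "continuous_map (subtopology TK M) euclidean \<xi>" and norm1: "\<And>m. m \<in> M \<Longrightarrow> norm (\<xi> m) = 1"
    and mult: "\<And>m n. m \<in> M \<Longrightarrow> n \<in> M \<Longrightarrow> \<xi> (m \<otimes>\<^bsub>K\<^esub> n) = \<xi> m * \<xi> n"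
    using \<xi> continuous_hom_circle[of "subtopology TK M" "K\<lparr>carrier := M\<rparr>" \<xi>] topM by auto
  have compM: "compact_space (subtopology TK M)"
    using compK unfolding M by (simp add: closedin_compact_space compact_space_subtopology)
  define F where "F l m = \<xi> (inv\<^bsub>K\<^esub> l \<otimes>\<^bsub>K\<^esub> m \<otimes>\<^bsub>K\<^esub> l)" for l m
  have F_norm: "norm (F l m) = 1" if "l \<in> carrier K" "m \<in> M" for l m using norm1 normM that by (simp add: F_def)
  have F_mult: "F l (m \<otimes>\<^bsub>K\<^esub> n) = F l m * F l n" if l: "l \<in> carrier K" and mn: "m \<in> M" "n \<in> M" for l m n
  proof -
    show ?thesis using K.conj_mult[OF l MK[OF mn(1)] MK[OF mn(2)]] mult[OF normM[OF l mn(1)] normM[OF l mn(2)]] by (simp add: F_def)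
  qed
  have c2: "continuous_map (prod_topology TK (subtopology TK M)) TK (\<lambda>z. snd z)"
    using continuous_map_snd[of TK "subtopology TK M"] by (simp add: continuous_map_in_subtopology)
  have "continuous_map (prod_topology TK (subtopology TK M)) TK (\<lambda>z. inv\<^bsub>K\<^esub> (fst z) \<otimes>\<^bsub>K\<^esub> snd z \<otimes>\<^bsub>K\<^esub> fst z)"
    by (intro K.continuous_map_mult c2 continuous_map_compose2[OF K.continuous_inv] continuous_map_fst)
  then have "continuous_map (prod_topology TK (subtopology TK M)) (subtopology TK M)
      (\<lambda>z. inv\<^bsub>K\<^esub> (fst z) \<otimes>\<^bsub>K\<^esub> snd z \<otimes>\<^bsub>K\<^esub> fst z)"
    using normM by (auto simp: continuous_map_in_subtopology K.topspace_eq)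
  from continuous_map_compose2[OF c\<xi> this]
  have cF: "continuous_map (prod_topology TK (subtopology TK M)) euclidean (\<lambda>(l, m). F l m)"
    by (simp add: F_def case_prod_unfold)
  have loc: "\<exists>U. openin TK U \<and> l \<in> U \<and> (\<forall>k\<in>U. \<forall>m\<in>M. F k m = F l m)" if l: "l \<in> carrier K" for l
  proof -
    have "l \<in> topspace TK" using l by (simp add: K.topspace_eq)
    then obtain U where U: "openin TK U" "l \<in> U"
      "\<forall>k\<in>U. \<forall>m\<in>topspace (subtopology TK M). dist (F k m) (F l m) < 1"
      by (rule compact_uniform_neighbourhood[OF compM cF _ zero_less_one])
    have "F k m = F l m" if k: "k \<in> U" and m: "m \<in> M" for k m
    proof -
      have kK: "k \<in> carrier K" using k openin_subset[OF U(1)] by (auto simp: K.topspace_eq)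
      have unit: "F l n * cnj (F l n) = 1" if "n \<in> M" for n
        using F_norm[OF l that] by (simp flip: complex_norm_square)
      have "F k m * cnj (F l m) = 1"
      proof (rule trivial_if_close_to_1[OF GM.group_axioms])
        show "m \<in> carrier (K\<lparr>carrier := M\<rparr>)" using m by simp
        fix a b assume a: "a \<in> carrier (K\<lparr>carrier := M\<rparr>)"
        then show "norm (F k a * cnj (F l a)) = 1" using F_norm kK l by (simp add: norm_mult)
        have "F k a * cnj (F l a) - 1 = (F k a - F l a) * cnj (F l a)"
          using unit a by (simp add: left_diff_distrib)
        then show "norm (F k a * cnj (F l a) - 1) < 1"
          using U(3) k a F_norm[OF l] topM by (simp add: norm_mult dist_norm)
        assume "b \<in> carrier (K\<lparr>carrier := M\<rparr>)"
        then show "F k (a \<otimes>\<^bsub>K\<lparr>carrier := M\<rparr>\<^esub> b) * cnj (F l (a \<otimes>\<^bsub>K\<lparr>carrier := M\<rparr>\<^esub> b))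
            = F k a * cnj (F l a) * (F k b * cnj (F l b))"
          using a F_mult kK l by simp
      qed
      then have "F k m * (cnj (F l m) * F l m) = F l m" by (simp flip: mult.assoc)
      then show ?thesis using unit[OF m] by (simp add: mult.commute)
    qed
    then show ?thesis using U by blast
  qed
  then obtain U where U: "\<forall>l\<in>carrier K. openin TK (U l) \<and> l \<in> U l \<and> (\<forall>k\<in>U l. \<forall>m\<in>M. F k m = F l m)"
    using bchoice[of "carrier K" "\<lambda>l U. openin TK U \<and> l \<in> U \<and> (\<forall>k\<in>U. \<forall>m\<in>M. F k m = F l m)"] by blast
  have "\<exists>\<F>. finite \<F> \<and> \<F> \<subseteq> U ` carrier K \<and> topspace TK \<subseteq> \<Union>\<F>"
    using compK[unfolded compact_space_alt, rule_format, of "U ` carrier K"] U by (auto simp: K.topspace_eq)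
  then obtain E where E: "finite E" "E \<subseteq> carrier K" "carrier K \<subseteq> \<Union> (U ` E)"
    using finite_subset_image[of _ U "carrier K"] unfolding K.topspace_eq by metis
  have orbit: "cconj h (\<lambda>n\<in>N. \<xi> (\<beta> n)) \<in> (\<lambda>l. \<lambda>n\<in>N. F l (\<beta> n)) ` E" if h: "h \<in> H" for h
  proof -
    have hG: "h \<in> carrier G" by (rule H_carrier[OF h])
    obtain l where l: "l \<in> E" "\<beta> h \<in> U l" using E(3) \<beta>.hom_closed[OF hG] by blast
    have "cconj h (\<lambda>n\<in>N. \<xi> (\<beta> n)) n = (\<lambda>n\<in>N. F l (\<beta> n)) n" for n
    proof (cases "n \<in> N")
      case True
      have "cconj h (\<lambda>n\<in>N. \<xi> (\<beta> n)) n = F (\<beta> h) (\<beta> n)"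
        using True conj_closed[OF hG True] hG N_carrier[OF True] by (simp add: conj_char_def F_def)
      also have "\<dots> = F l (\<beta> n)" using U l E(2) \<beta>M[OF True] by blast
      finally show ?thesis using True by simp
    qed (simp add: conj_char_def)
    then show ?thesis using l(1) by blast
  qed
  have "continuous_map TN (subtopology TK M) \<beta>"
    using continuous_map_from_subtopology[OF c\<beta>] \<beta>M topspace_TN by (auto simp: continuous_map_in_subtopology)
  from continuous_map_compose2[OF c\<xi> this] have "continuous_map TN euclidean (\<lambda>n. \<xi> (\<beta> n))" .
  then have "continuous_map TN euclidean (\<lambda>n\<in>N. \<xi> (\<beta> n))"
    by (rule continuous_map_eq) (auto simp: topspace_TN)
  moreover have "\<xi> (\<beta> (m \<otimes> n)) = \<xi> (\<beta> m) * \<xi> (\<beta> n)" if "m \<in> N" "n \<in> N" for m n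
    using mult[OF \<beta>M[OF that(1)] \<beta>M[OF that(2)]] that N_carrier by simp
  ultimately have "(\<lambda>n\<in>N. \<xi> (\<beta> n)) \<in> carrier Nhat"
    using norm1[OF \<beta>M] N_closed by (auto simp: carrier_Nhat)
  moreover have "finite ((\<lambda>h. cconj h (\<lambda>n\<in>N. \<xi> (\<beta> n))) ` H)"
    using orbit E(1) by (intro finite_subset[OF _ finite_imageI[OF E(1)]]) blast
  ultimately show ?thesis by (simp add: periodic_chars_def)
qed

end

section \<open>The induced action\<close>

text \<open>Covers the group of all characters with finite orbit and the subgroup of those with finite image.\<close>
locale invariant_characters = abelian_semidirect_product G T N H
  for G :: "('g, 'm) monoid_scheme" (structure) and T :: "'g topology" and N H :: "'g set" +
  fixes D :: "('g \<Rightarrow> complex) set"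
  assumes D_subgroup: "subgroup D Nhat"
    and D_periodic: "D \<subseteq> periodic_chars G T N H"
    and D_invariant: "h \<in> H \<Longrightarrow> \<xi> \<in> D \<Longrightarrow> cconj h \<xi> \<in> D"
begin

abbreviation GD :: "('g \<Rightarrow> complex) monoid" where "GD \<equiv> Nhat\<lparr>carrier := D\<rparr>"
abbreviation A :: "(('g \<Rightarrow> complex) \<Rightarrow> complex) monoid" where "A \<equiv> discrete_dual_group G T N D"
abbreviation TA :: "(('g \<Rightarrow> complex) \<Rightarrow> complex) topology" where "TA \<equiv> discrete_dual_topology G T N D"

lemma A_eq: "A = ddual GD" and TA_eq: "TA = ddual_topology GD"
  by (simp_all add: discrete_dual_group_def discrete_dual_topology_def)

lemma D_Nhat: "\<xi> \<in> D \<Longrightarrow> \<xi> \<in> carrier Nhat"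
  using subgroup.subset[OF D_subgroup] by blast

lemma comm_group_GD: "comm_group GD"
proof -
  interpret Nh: comm_group Nhat by (rule comm_group_Nhat)
  have "group GD" by (rule Nh.subgroup_imp_group[OF D_subgroup])
  then show ?thesis
    by (rule group.group_comm_groupI) (use D_Nhat Nh.m_comm in auto)
qed

lemma compact_abelian_A: "compact_abelian_group A TA"
  unfolding A_eq TA_eq by (rule compact_abelian_ddual[OF comm_group_GD])

lemma compact_group_A: "compact_group A TA"
proof -
  interpret A: compact_abelian_group A TA by (rule compact_abelian_A)
  show ?thesis
    unfolding compact_group_def using A.compact A.Hausdorff A.topological_group_axioms by blast
qed

lemma carrier_A:
  "a \<in> carrier A \<longleftrightarrow> a \<in> extensional D \<and> (\<forall>\<xi>\<in>D. norm (a \<xi>) = 1) \<and>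
     (\<forall>\<xi>\<in>D. \<forall>\<psi>\<in>D. a (\<xi> \<otimes>\<^bsub>Nhat\<^esub> \<psi>) = a \<xi> * a \<psi>)"
  unfolding A_eq carrier_ddual by simp

lemma mult_A: "a \<otimes>\<^bsub>A\<^esub> b = (\<lambda>\<xi>\<in>D. a \<xi> * b \<xi>)" and one_A: "\<one>\<^bsub>A\<^esub> = (\<lambda>\<xi>\<in>D. 1)"
  unfolding A_eq mult_dual one_dual by simp_all

lemma A_eqI: "a \<in> carrier A \<Longrightarrow> b \<in> carrier A \<Longrightarrow> (\<And>\<xi>. \<xi> \<in> D \<Longrightarrow> a \<xi> = b \<xi>) \<Longrightarrow> a = b"
  by (rule extensionalityI[of _ D]) (auto simp: carrier_A)

lemma topspace_TA: "topspace TA = carrier A"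
  unfolding A_eq TA_eq by (rule topspace_dual_topology)

lemma continuous_map_TA:
  "continuous_map Z TA f \<longleftrightarrow> f ` topspace Z \<subseteq> carrier A \<and> (\<forall>\<xi>\<in>D. continuous_map Z euclidean (\<lambda>z. f z \<xi>))"
  using continuous_map_ddual[of Z GD f] unfolding A_eq TA_eq by simp

lemma continuous_map_TA_eval: "\<xi> \<in> D \<Longrightarrow> continuous_map TA euclidean (\<lambda>a. a \<xi>)"
  using continuous_map_ddual_eval[of \<xi> GD] unfolding TA_eq by simp

abbreviation orbit :: "('g \<Rightarrow> complex) \<Rightarrow> ('g \<Rightarrow> complex) set" where
  "orbit \<xi> \<equiv> (\<lambda>h. cconj h \<xi>) ` H"

lemma finite_orbit: "\<xi> \<in> D \<Longrightarrow> finite (orbit \<xi>)"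
  using D_periodic by (auto simp: periodic_chars_def)

sublocale finite_partition D orbit
proof
  fix \<xi> assume \<xi>: "\<xi> \<in> D"
  show "finite (orbit \<xi>)" by (rule finite_orbit[OF \<xi>])
  show "orbit \<xi> \<subseteq> D" using D_invariant \<xi> by auto
  show "\<xi> \<in> orbit \<xi>" using cconj_one[OF D_Nhat[OF \<xi>]] H_closed(2) by (metis imageI)
  fix \<psi> assume "\<psi> \<in> orbit \<xi>"
  then obtain h where h: "h \<in> H" "\<psi> = cconj h \<xi>" by blast
  have hG: "h \<in> carrier G" by (rule H_carrier[OF h(1)])
  have "cconj k \<psi> \<in> orbit \<xi>" if "k \<in> H" for k
    using cconj_cconj[OF H_carrier[OF that] hG] H_closed(1)[OF that h(1)] h(2) by simp
  moreover have "cconj k \<xi> \<in> orbit \<psi>" if k: "k \<in> H" for k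
  proof -
    have kG: "k \<in> carrier G" by (rule H_carrier[OF k])
    have "cconj (k \<otimes> inv h) \<psi> = cconj (k \<otimes> inv h \<otimes> h) \<xi>"
      using cconj_cconj[of "k \<otimes> inv h" h] h(2) hG kG by simp
    also have "k \<otimes> inv h \<otimes> h = k" using hG kG by (simp add: m_assoc)
    finally show ?thesis using H_closed(1)[OF k H_closed(3)[OF h(1)]] by (metis imageI)
  qed
  ultimately show "orbit \<psi> = orbit \<xi>" by blast
qed

definition H_perm :: "'g \<Rightarrow> ('g \<Rightarrow> complex) \<Rightarrow> ('g \<Rightarrow> complex)" where
  "H_perm h = (\<lambda>\<xi>\<in>D. cconj h \<xi>)"

lemma H_perm_perms: "h \<in> H \<Longrightarrow> H_perm h \<in> perms"
proof -
  assume h: "h \<in> H"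
  have hG: "h \<in> carrier G" by (rule H_carrier[OF h])
  have "inj_on (H_perm h) D"
  proof (rule inj_on_inverseI)
    fix \<xi> assume \<xi>: "\<xi> \<in> D"
    show "cconj (inv h) (H_perm h \<xi>) = \<xi>"
      using \<xi> cconj_cconj[of "inv h" h] hG cconj_one[OF D_Nhat[OF \<xi>]] by (simp add: H_perm_def)
  qed
  then show ?thesis using h by (auto simp: perms_iff H_perm_def)
qed

text \<open>The sets on which \<open>cconj k \<xi>\<close> has a given value are closed and finite in number.\<close>
lemma stabilizer_open:
  assumes \<xi>: "\<xi> \<in> D" and h: "h \<in> H"
  shows "\<exists>V. openin TH V \<and> h \<in> V \<and> (\<forall>k\<in>V. cconj k \<xi> = cconj h \<xi>)"
proof -
  have "closedin TH {k \<in> topspace TH. cconj k \<xi> = \<psi>}" if \<psi>: "\<psi> \<in> orbit \<xi>" for \<psi>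
  proof -
    have c: "continuous_map TH euclidean (\<lambda>k. \<xi> (inv k \<otimes> n \<otimes> k))" if n: "n \<in> N" for n
    proof -
      have id: "continuous_map TH T (\<lambda>k. k)"
        using continuous_map_from_subtopology[OF continuous_map_id[of T], of H] by (simp add: id_def)
      have "n \<in> topspace T" using N_carrier[OF n] by (simp add: topspace_eq)
      then have "continuous_map TH T (\<lambda>k. n)" by (simp only: continuous_map_const simp_thms)
      from continuous_map_mult[OF continuous_map_mult[OF continuous_map_compose2[OF continuous_inv id] this] id]
      have "continuous_map TH T (\<lambda>k. inv k \<otimes> n \<otimes> k)" .
      then have "continuous_map TH TN (\<lambda>k. inv k \<otimes> n \<otimes> k)"
        using conj_closed[OF H_carrier n] topspace_TH by (auto simp: continuous_map_in_subtopology)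
      moreover have "continuous_map TN euclidean \<xi>" using D_Nhat[OF \<xi>] by (simp add: carrier_Nhat)
      ultimately show ?thesis by (rule continuous_map_compose2[rotated])
    qed
    have "closedin TH {k \<in> topspace TH. \<forall>n\<in>N. \<xi> (inv k \<otimes> n \<otimes> k) = \<psi> n}"
      by (intro closedin_ball closedin_continuous_maps_eq[OF Hausdorff_space_euclidean] c)
        simp_all
    moreover have "cconj k \<xi> = \<psi> \<longleftrightarrow> (\<forall>n\<in>N. \<xi> (inv k \<otimes> n \<otimes> k) = \<psi> n)" for k
    proof -
      have "\<psi> \<in> extensional N" using \<psi> by (auto simp: conj_char_def)
      then show ?thesis by (auto simp: conj_char_def fun_eq_iff extensional_def)
    qed
    ultimately show ?thesis by simp
  qed
  then have "closedin TH (\<Union>\<psi>\<in>orbit \<xi> - {cconj h \<xi>}. {k \<in> topspace TH. cconj k \<xi> = \<psi>})"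
    using finite_orbit[OF \<xi>] by (intro closedin_Union) auto
  then have op: "openin TH (topspace TH - (\<Union>\<psi>\<in>orbit \<xi> - {cconj h \<xi>}. {k \<in> topspace TH. cconj k \<xi> = \<psi>}))"
    by (rule openin_diff[OF openin_topspace])
  show ?thesis
  proof (rule exI, intro conjI ballI, rule op)
    show "h \<in> topspace TH - (\<Union>\<psi>\<in>orbit \<xi> - {cconj h \<xi>}. {k \<in> topspace TH. cconj k \<xi> = \<psi>})"
      using h unfolding topspace_TH by auto
    fix k assume "k \<in> topspace TH - (\<Union>\<psi>\<in>orbit \<xi> - {cconj h \<xi>}. {k \<in> topspace TH. cconj k \<xi> = \<psi>})"
    then show "cconj k \<xi> = cconj h \<xi>" unfolding topspace_TH by auto
  qed
qed

lemma H_perm_continuous_hom: "continuous_hom GH TH perm_group perm_topology H_perm"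
  unfolding continuous_hom_def
proof
  have carrier: "carrier perm_group = perms" by (simp add: perm_group_def)
  show "H_perm \<in> hom GH perm_group"
  proof (rule homI)
    show "H_perm h \<in> carrier perm_group" if "h \<in> carrier GH" for h using H_perm_perms that by (simp add: carrier)
    fix h k assume "h \<in> carrier GH" "k \<in> carrier GH"
    then have hk: "h \<in> H" "k \<in> H" by simp_all
    have mem: "H_perm h \<otimes>\<^bsub>perm_group\<^esub> H_perm k \<in> perms"
      using subgroup.m_closed[OF subgroup_perms H_perm_perms[OF hk(1)] H_perm_perms[OF hk(2)]] by (simp add: perm_group_def)
    have "H_perm (h \<otimes> k) = H_perm h \<otimes>\<^bsub>perm_group\<^esub> H_perm k"
    proof (rule perms_eqI[OF H_perm_perms[OF H_closed(1)[OF hk]] mem])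
      fix \<xi> assume \<xi>: "\<xi> \<in> D"
      show "H_perm (h \<otimes> k) \<xi> = (H_perm h \<otimes>\<^bsub>perm_group\<^esub> H_perm k) \<xi>"
        using \<xi> hk D_invariant[OF hk(2) \<xi>] cconj_cconj[OF H_carrier[OF hk(1)] H_carrier[OF hk(2)]]
        by (simp add: perms_mult H_perm_perms) (simp add: H_perm_def)
    qed
    then show "H_perm (h \<otimes>\<^bsub>GH\<^esub> k) = H_perm h \<otimes>\<^bsub>perm_group\<^esub> H_perm k" by simp
  qed
  show "continuous_map TH perm_topology H_perm"
    unfolding continuous_map_perm_topology
  proof (intro conjI ballI)
    show "H_perm \<in> topspace TH \<rightarrow> perms" using H_perm_perms topspace_TH by auto
    fix \<xi> assume \<xi>: "\<xi> \<in> D"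
    show "continuous_map TH (discrete_topology (orbit \<xi>)) (\<lambda>h. H_perm h \<xi>)"
    proof (rule locally_constant_continuous)
      fix h assume "h \<in> topspace TH"
      then have h: "h \<in> H" by (simp only: topspace_TH)
      then show "H_perm h \<xi> \<in> topspace (discrete_topology (orbit \<xi>))" using \<xi> by (simp add: H_perm_def)
      show "\<exists>V. openin TH V \<and> h \<in> V \<and> (\<forall>k\<in>V. H_perm k \<xi> = H_perm h \<xi>)"
        using stabilizer_open[OF \<xi> h] \<xi> by (simp add: H_perm_def)
    qed
  qed
qed

text \<open>An element \<open>k\<close> acts on \<open>a\<close> by composition with the permutation \<open>\<phi> (inv k)\<close> of \<open>D\<close>. That \<open>\<phi> k\<close> respects the
  multiplication of \<open>D\<close> can be read off three of its values, which it shares with \<open>\<phi> (\<iota> h)\<close> for some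
  \<open>h \<in> H\<close>. The action is continuous because \<open>k\<close> enters the value at \<open>\<xi>\<close> only through the locally
  constant \<open>\<phi> (inv k) \<xi>\<close>.\<close>
theorem induced_action_exists:
  assumes K: "topological_group K TK" and \<iota>: "continuous_hom GH TH K TK \<iota>"
    and dense: "TK closure_of (\<iota> ` H) = topspace TK"
    and \<phi>: "continuous_hom K TK perm_group perm_topology \<phi>" and \<phi>\<iota>: "\<And>h. h \<in> H \<Longrightarrow> \<phi> (\<iota> h) = H_perm h"
  shows "\<exists>\<theta>. induced_action G T N H D K TK \<iota> \<theta>"
proof -
  interpret K: topological_group K TK by fact
  interpret H: topological_group GH TH by (rule topological_group_H)
  interpret \<iota>: group_hom GH K \<iota> using \<iota> by unfold_locales (simp add: continuous_hom_def)
  interpret P: topological_group perm_group perm_topology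
    using profinite_perm_group by (simp add: profinite_group_def compact_group_def)
  interpret \<phi>: group_hom K perm_group \<phi> using \<phi> by unfold_locales (simp add: continuous_hom_def)
  have \<phi>_perms: "\<phi> k \<in> perms" if "k \<in> carrier K" for k using \<phi>.hom_closed[OF that] by (simp add: perm_group_def)
  have \<phi>_D: "\<phi> k \<xi> \<in> D" if "k \<in> carrier K" "\<xi> \<in> D" for k \<xi> by (rule perms_closed[OF \<phi>_perms[OF that(1)] that(2)])
  have \<phi>_cont: "continuous_map TK (discrete_topology (orbit \<xi>)) (\<lambda>k. \<phi> k \<xi>)" if "\<xi> \<in> D" for \<xi>
    using \<phi> that unfolding continuous_hom_def continuous_map_perm_topology by blast
  have \<phi>_loc: "openin TK {l \<in> topspace TK. \<phi> l \<xi> = v}" if "\<xi> \<in> D" for \<xi> v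
    by (rule openin_discrete_fibre[OF \<phi>_cont[OF that]])
  have D_mult: "\<xi> \<otimes>\<^bsub>Nhat\<^esub> \<psi> \<in> D" if "\<xi> \<in> D" "\<psi> \<in> D" for \<xi> \<psi> by (rule subgroup.m_closed[OF D_subgroup that])
  have \<phi>_mult: "\<phi> k (\<xi> \<otimes>\<^bsub>Nhat\<^esub> \<psi>) = \<phi> k \<xi> \<otimes>\<^bsub>Nhat\<^esub> \<phi> k \<psi>"
    if k: "k \<in> carrier K" and \<xi>: "\<xi> \<in> D" and \<psi>: "\<psi> \<in> D" for k \<xi> \<psi>
  proof -
    define V where "V = {l \<in> topspace TK. \<phi> l (\<xi> \<otimes>\<^bsub>Nhat\<^esub> \<psi>) = \<phi> k (\<xi> \<otimes>\<^bsub>Nhat\<^esub> \<psi>)}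
        \<inter> {l \<in> topspace TK. \<phi> l \<xi> = \<phi> k \<xi>} \<inter> {l \<in> topspace TK. \<phi> l \<psi> = \<phi> k \<psi>}"
    have "openin TK V" unfolding V_def by (intro openin_Int \<phi>_loc D_mult \<xi> \<psi>)
    moreover have "k \<in> V" using k by (simp add: V_def K.topspace_eq)
    moreover have "k \<in> TK closure_of (\<iota> ` H)" using k by (simp add: dense K.topspace_eq)
    ultimately obtain h where h: "h \<in> H" "\<iota> h \<in> V" unfolding in_closure_of by blast
    have "H_perm h (\<xi> \<otimes>\<^bsub>Nhat\<^esub> \<psi>) = H_perm h \<xi> \<otimes>\<^bsub>Nhat\<^esub> H_perm h \<psi>"
      using \<xi> \<psi> D_mult cconj_mult[OF H_carrier[OF h(1)]] by (simp add: H_perm_def)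
    moreover have "\<phi> (\<iota> h) (\<xi> \<otimes>\<^bsub>Nhat\<^esub> \<psi>) = \<phi> k (\<xi> \<otimes>\<^bsub>Nhat\<^esub> \<psi>)" "\<phi> (\<iota> h) \<xi> = \<phi> k \<xi>" "\<phi> (\<iota> h) \<psi> = \<phi> k \<psi>"
      using h(2) by (simp_all add: V_def)
    ultimately show ?thesis unfolding \<phi>\<iota>[OF h(1)] by simp
  qed
  define \<theta> where "\<theta> k a = (\<lambda>\<xi>\<in>D. a (\<phi> (inv\<^bsub>K\<^esub> k) \<xi>))" for k and a :: "('g \<Rightarrow> complex) \<Rightarrow> complex"
  have \<theta>_closed: "\<theta> k a \<in> carrier A" if "k \<in> carrier K" "a \<in> carrier A" for k a
    using that \<phi>_D[OF K.inv_closed[OF that(1)]] \<phi>_mult[OF K.inv_closed[OF that(1)]] D_mult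
    by (auto simp: \<theta>_def carrier_A)
  have \<theta>_one: "\<theta> \<one>\<^bsub>K\<^esub> a = a" if "a \<in> carrier A" for a
  proof -
    have "\<phi> \<one>\<^bsub>K\<^esub> \<xi> = \<xi>" if "\<xi> \<in> D" for \<xi> using that by (simp add: perm_group_def BijGroup_def)
    then show ?thesis using that by (intro A_eqI \<theta>_closed) (simp_all add: \<theta>_def)
  qed
  have \<theta>_comp: "\<theta> (k \<otimes>\<^bsub>K\<^esub> l) a = \<theta> k (\<theta> l a)" if "k \<in> carrier K" "l \<in> carrier K" for k l a
  proof
    fix \<xi>
    have "\<phi> (inv\<^bsub>K\<^esub> (k \<otimes>\<^bsub>K\<^esub> l)) \<xi> = \<phi> (inv\<^bsub>K\<^esub> l) (\<phi> (inv\<^bsub>K\<^esub> k) \<xi>)" if \<xi>: "\<xi> \<in> D"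
    proof -
      have "\<phi> (inv\<^bsub>K\<^esub> l \<otimes>\<^bsub>K\<^esub> inv\<^bsub>K\<^esub> k) = \<phi> (inv\<^bsub>K\<^esub> l) \<otimes>\<^bsub>perm_group\<^esub> \<phi> (inv\<^bsub>K\<^esub> k)"
        using \<open>k \<in> carrier K\<close> \<open>l \<in> carrier K\<close> by (intro \<phi>.hom_mult) simp_all
      then show ?thesis
        using perms_mult[OF \<phi>_perms \<phi>_perms \<xi>, of "inv\<^bsub>K\<^esub> l" "inv\<^bsub>K\<^esub> k"] \<open>k \<in> carrier K\<close> \<open>l \<in> carrier K\<close>
        by (simp add: K.inv_mult_group)
    qed
    then show "\<theta> (k \<otimes>\<^bsub>K\<^esub> l) a \<xi> = \<theta> k (\<theta> l a) \<xi>"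
      using \<phi>_D[OF K.inv_closed[OF that(1)]] by (simp add: \<theta>_def)
  qed
  have \<theta>_iso: "\<theta> k \<in> iso A A" if k: "k \<in> carrier K" for k
  proof (rule isoI)
    show "\<theta> k \<in> hom A A"
      using \<theta>_closed[OF k] \<phi>_D[OF K.inv_closed[OF k]] by (intro homI) (auto simp: mult_A \<theta>_def)
    show "bij_betw (\<theta> k) (carrier A) (carrier A)"
    proof (rule bij_betwI[where g = "\<theta> (inv\<^bsub>K\<^esub> k)"])
      show "\<theta> (inv\<^bsub>K\<^esub> k) (\<theta> k a) = a" if "a \<in> carrier A" for a
        using \<theta>_comp[of "inv\<^bsub>K\<^esub> k" k a] \<theta>_one[OF that] k by simp
      show "\<theta> k (\<theta> (inv\<^bsub>K\<^esub> k) a) = a" if "a \<in> carrier A" for a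
        using \<theta>_comp[of k "inv\<^bsub>K\<^esub> k" a] \<theta>_one[OF that] k by simp
    qed (use \<theta>_closed k in auto)
  qed
  have \<theta>_cont: "continuous_map (prod_topology TK TA) TA (\<lambda>(k, a). \<theta> k a)"
    unfolding continuous_map_TA
  proof (intro conjI ballI)
    show "(\<lambda>(k, a). \<theta> k a) ` topspace (prod_topology TK TA) \<subseteq> carrier A"
      using \<theta>_closed by (auto simp: K.topspace_eq topspace_TA)
    fix \<xi> assume \<xi>: "\<xi> \<in> D"
    show "continuous_map (prod_topology TK TA) euclidean (\<lambda>z. (case z of (k, a) \<Rightarrow> \<theta> k a) \<xi>)"
    proof (rule locally_equal_continuous)
      fix z assume "z \<in> topspace (prod_topology TK TA)"
      then obtain k a where z: "z = (k, a)" "k \<in> carrier K" "a \<in> carrier A" by (auto simp: K.topspace_eq topspace_TA)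
      define \<psi> where "\<psi> = \<phi> (inv\<^bsub>K\<^esub> k) \<xi>"
      define W where "W = {l \<in> topspace TK. \<phi> (inv\<^bsub>K\<^esub> l) \<xi> = \<psi>}"
      have "openin TK W"
        unfolding W_def
        by (rule openin_discrete_fibre[OF continuous_map_compose2[OF \<phi>_cont[OF \<xi>] K.continuous_inv]])
      then have "openin (prod_topology TK TA) (W \<times> topspace TA)" by (simp add: openin_prod_Times_iff)
      moreover have "z \<in> W \<times> topspace TA" using z by (simp add: W_def \<psi>_def K.topspace_eq topspace_TA)
      moreover have "\<psi> \<in> D" unfolding \<psi>_def by (rule \<phi>_D[OF K.inv_closed[OF z(2)] \<xi>])
      then have "continuous_map (prod_topology TK TA) euclidean (\<lambda>w. (snd w) \<psi>)"
        by (rule continuous_map_compose2[OF continuous_map_TA_eval continuous_map_snd])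
      moreover have "\<forall>w\<in>W \<times> topspace TA. (case w of (k, a) \<Rightarrow> \<theta> k a) \<xi> = (snd w) \<psi>"
        using \<xi> by (auto simp: W_def \<theta>_def)
      ultimately show "\<exists>V g. openin (prod_topology TK TA) V \<and> z \<in> V \<and>
          continuous_map (prod_topology TK TA) euclidean g \<and> (\<forall>w\<in>V. (case w of (k, a) \<Rightarrow> \<theta> k a) \<xi> = g w)"
        by blast
    qed
  qed
  have "\<theta> (\<iota> h) a = dual_action G N D h a" if h: "h \<in> H" for h a
  proof -
    have "inv\<^bsub>K\<^esub> (\<iota> h) = \<iota> (inv h)"
      using \<iota>.hom_inv[of h] h m_inv_consistent[OF H_subgroup h] by simp
    then have eq: "\<phi> (inv\<^bsub>K\<^esub> (\<iota> h)) = H_perm (inv h)" using \<phi>\<iota>[OF H_closed(3)[OF h]] by simp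
    show ?thesis unfolding \<theta>_def dual_action_def eq by (intro restrict_ext) (simp add: H_perm_def)
  qed
  with \<theta>_iso \<theta>_one \<theta>_comp \<theta>_cont have "induced_action G T N H D K TK \<iota> \<theta>"
    unfolding induced_action_def continuous_action_def by blast
  then show ?thesis by blast
qed

section \<open>The comparison map\<close>

definition evaluation :: "'g \<Rightarrow> ('g \<Rightarrow> complex) \<Rightarrow> complex" where
  "evaluation n = (\<lambda>\<xi>\<in>D. \<xi> n)"

lemma evaluation_A: "n \<in> N \<Longrightarrow> evaluation n \<in> carrier A"
  using D_Nhat subgroup.m_closed[OF D_subgroup]
  by (auto simp: carrier_A evaluation_def carrier_Nhat mult_dual)

lemma evaluation_mult: "m \<in> N \<Longrightarrow> n \<in> N \<Longrightarrow> evaluation (m \<otimes> n) = evaluation m \<otimes>\<^bsub>A\<^esub> evaluation n"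
  using D_Nhat by (auto simp: mult_A evaluation_def carrier_Nhat fun_eq_iff)

text \<open>A character in \<open>D\<close> that is killed by all evaluations takes only the value \<open>1\<close>.\<close>
lemma evaluation_dense: "TA closure_of (evaluation ` N) = carrier A"
proof -
  interpret A: compact_abelian_group A TA by (rule compact_abelian_A)
  interpret GN: group GN by (rule subgroup_imp_group[OF N_subgroup])
  interpret ev: group_hom GN A evaluation
    by unfold_locales (auto intro!: homI simp: evaluation_A evaluation_mult)
  have "subgroup (evaluation ` N) A" using ev.img_is_subgroup by simp
  moreover have "\<xi> = \<one>\<^bsub>GD\<^esub>" if \<xi>: "\<xi> \<in> carrier GD" and triv: "\<forall>a\<in>evaluation ` N. a \<xi> = 1" for \<xi>
  proof -
    have "\<xi> n = 1" if "n \<in> N" for n using triv that \<xi> by (auto simp: evaluation_def)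
    then show ?thesis using D_Nhat[of \<xi>] \<xi> by (auto simp: one_dual carrier_Nhat extensional_def fun_eq_iff)
  qed
  ultimately show ?thesis
    using dense_in_ddual[OF comm_group_GD, of "evaluation ` N"] unfolding A_eq TA_eq by blast
qed

lemma dense_image_point:
  assumes "TK closure_of S = topspace TK" "Hausdorff_space Y"
    and "continuous_map TK Y f" "continuous_map TK Y g" "\<And>x. x \<in> S \<Longrightarrow> f x = g x" "x \<in> topspace TK"
  shows "f x = g x"
  using forall_in_closure_of_eq[OF _ assms(2-4), of x S] assms(1,5,6) by blast

text \<open>The assumption \<open>lift\<close> is the universal property of \<open>BG\<close> for the target \<open>A \<rtimes> BH\<close>, and \<open>j\<close> comes from the
  universal property of \<open>BH\<close>; \<open>restr\<close> says that \<open>D\<close> is large enough to see all characters of the closure \<open>M\<close>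
  of the image of \<open>N\<close>. All identities for \<open>\<Phi>\<close> on \<open>M\<close> and on the image of \<open>j\<close> are checked on dense
  subsets.\<close>
theorem comparison:
  assumes BG: "compact_group BG TBG" and \<beta>: "continuous_hom G T BG TBG \<beta>"
    and \<beta>_dense: "TBG closure_of (\<beta> ` carrier G) = topspace TBG"
    and BH: "compact_group BH TBH" and \<iota>: "continuous_hom GH TH BH TBH \<iota>"
    and \<iota>_dense: "TBH closure_of (\<iota> ` H) = topspace TBH"
    and j: "continuous_hom BH TBH BG TBG j" "\<And>h. h \<in> H \<Longrightarrow> j (\<iota> h) = \<beta> h"
    and \<theta>: "induced_action G T N H D BH TBH \<iota> \<theta>"
    and lift: "\<And>f. continuous_hom G T (semidirect_product A BH \<theta>) (prod_topology TA TBH) f \<Longrightarrow>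
      \<exists>\<Phi>. continuous_hom BG TBG (semidirect_product A BH \<theta>) (prod_topology TA TBH) \<Phi> \<and>
        (\<forall>x\<in>carrier G. \<Phi> (\<beta> x) = f x)"
    and restr: "\<And>\<xi>. continuous_hom (BG\<lparr>carrier := TBG closure_of (\<beta> ` N)\<rparr>) (subtopology TBG (TBG closure_of (\<beta> ` N)))
        circle_group circle_topology \<xi> \<Longrightarrow> (\<lambda>n\<in>N. \<xi> (\<beta> n)) \<in> D"
  shows "topological_group_isomorphic BG TBG (semidirect_product A BH \<theta>) (prod_topology TA TBH)"
proof -
  let ?S = "semidirect_product A BH \<theta>" and ?TS = "prod_topology TA TBH"
  interpret BG: topological_group BG TBG using BG by (simp add: compact_group_def)
  interpret BH: topological_group BH TBH using BH by (simp add: compact_group_def)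
  interpret A: compact_abelian_group A TA by (rule compact_abelian_A)
  interpret H: topological_group GH TH by (rule topological_group_H)
  interpret \<beta>: group_hom G BG \<beta> using \<beta> by unfold_locales (simp add: continuous_hom_def)
  interpret \<iota>: group_hom GH BH \<iota> using \<iota> by unfold_locales (simp add: continuous_hom_def)
  interpret j: group_hom BH BG j using j(1) by unfold_locales (simp add: continuous_hom_def)
  have cact: "continuous_action BH TBH A TA \<theta>"
    and \<theta>_eq: "\<And>h a. h \<in> H \<Longrightarrow> a \<in> carrier A \<Longrightarrow> \<theta> (\<iota> h) a = dual_action G N D h a"
    using \<theta> unfolding induced_action_def by blast+
  have cS: "compact_group ?S ?TS" by (rule compact_group_semidirect_product[OF compact_group_A BH cact])
  interpret S: topological_group ?S ?TS using cS by (simp add: compact_group_def)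
  have c\<beta>: "continuous_map T TBG \<beta>" and c\<iota>: "continuous_map TH TBH \<iota>" and cj: "continuous_map TBH TBG j"
    using \<beta> \<iota> j(1) by (simp_all add: continuous_hom_def)
  have Haus: "Hausdorff_space TBG" "Hausdorff_space ?TS" and comp: "compact_space TBG" "compact_space TBH"
    using BG BH cS by (simp_all add: compact_group_def)
  have HausA: "Hausdorff_space TA" by (rule A.Hausdorff)
  have carrier_S: "carrier ?S = carrier A \<times> carrier BH" and one_S: "\<one>\<^bsub>?S\<^esub> = (\<one>\<^bsub>A\<^esub>, \<one>\<^bsub>BH\<^esub>)"
    and mult_S: "\<And>a k b l. (a, k) \<otimes>\<^bsub>?S\<^esub> (b, l) = (a \<otimes>\<^bsub>A\<^esub> \<theta> k b, k \<otimes>\<^bsub>BH\<^esub> l)"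
    by (simp_all add: semidirect_product_def)
  have \<iota>_closed: "\<iota> h \<in> carrier BH" if "h \<in> H" for h using \<iota>.hom_closed that by simp
  \<comment> \<open>the homomorphism \<open>n * h \<mapsto> (evaluation n, \<iota> h)\<close> on \<open>G\<close>\<close>
  have "homeomorphic_map (prod_topology TN TH) T (\<lambda>(n, h). n \<otimes> h)"
    using sdp by (simp add: topological_semidirect_product_def)
  then obtain r where "homeomorphic_maps (prod_topology TN TH) T (\<lambda>(n, h). n \<otimes> h) r"
    unfolding homeomorphic_map_maps by blast
  then have cr: "continuous_map T (prod_topology TN TH) r"
    and r1: "\<And>n h. n \<in> N \<Longrightarrow> h \<in> H \<Longrightarrow> r (n \<otimes> h) = (n, h)"
    and r2: "\<And>g. g \<in> carrier G \<Longrightarrow> fst (r g) \<otimes> snd (r g) = g"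
    unfolding homeomorphic_maps_def topspace_prod_topology topspace_TN topspace_TH
    by (auto simp: topspace_eq case_prod_unfold)
  have r_mem: "fst (r g) \<in> N \<and> snd (r g) \<in> H" if "g \<in> carrier G" for g
    using continuous_map_image_subset_topspace[OF cr] that
    unfolding topspace_prod_topology topspace_TN topspace_TH by (auto simp: topspace_eq)
  define f where "f g = (evaluation (fst (r g)), \<iota> (snd (r g)))" for g
  have f_prod: "f (n \<otimes> h) = (evaluation n, \<iota> h)" if "n \<in> N" "h \<in> H" for n h
    using r1[OF that] by (simp add: f_def)
  have "f \<in> hom G ?S"
  proof (rule homI)
    show "f g \<in> carrier ?S" if "g \<in> carrier G" for g
      using r_mem[OF that] evaluation_A \<iota>_closed by (simp add: f_def carrier_S)
    fix g g' assume g: "g \<in> carrier G" "g' \<in> carrier G"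
    define n h n' h' where nh: "n = fst (r g)" "h = snd (r g)" "n' = fst (r g')" "h' = snd (r g')"
    have mem: "n \<in> N" "h \<in> H" "n' \<in> N" "h' \<in> H" using r_mem[OF g(1)] r_mem[OF g(2)] by (simp_all add: nh)
    have inG: "n \<in> carrier G" "h \<in> carrier G" "n' \<in> carrier G" "h' \<in> carrier G"
      using mem N_carrier H_carrier by blast+
    have eq: "g = n \<otimes> h" "g' = n' \<otimes> h'" using r2 g by (simp_all add: nh)
    define n'' where "n'' = inv (inv h) \<otimes> n' \<otimes> inv h"
    have n'': "n'' \<in> N" unfolding n''_def by (rule conj_closed[OF _ mem(3)]) (simp add: inG)
    have "inv h \<otimes> (h \<otimes> h') = h'" using inG by (simp add: m_assoc[symmetric])
    then have "g \<otimes> g' = (n \<otimes> n'') \<otimes> (h \<otimes> h')" using inG by (simp add: eq n''_def m_assoc)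
    then have "f (g \<otimes> g') = (evaluation (n \<otimes> n''), \<iota> (h \<otimes> h'))"
      using f_prod[OF N_closed(1)[OF mem(1) n''] H_closed(1)[OF mem(2,4)]] by simp
    also have "\<dots> = (evaluation n \<otimes>\<^bsub>A\<^esub> evaluation n'', \<iota> h \<otimes>\<^bsub>BH\<^esub> \<iota> h')"
      using evaluation_mult[OF mem(1) n''] \<iota>.hom_mult[of h h'] mem by simp
    also have "evaluation n'' = \<theta> (\<iota> h) (evaluation n')"
      unfolding \<theta>_eq[OF mem(2) evaluation_A[OF mem(3)]]
      using D_invariant[OF H_closed(3)[OF mem(2)]] mem(3)
      by (auto simp: dual_action_def evaluation_def n''_def conj_char_def fun_eq_iff)
    finally show "f (g \<otimes> g') = f g \<otimes>\<^bsub>?S\<^esub> f g'"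
      using f_prod[OF mem(1,2)] f_prod[OF mem(3,4)] by (simp add: eq mult_S)
  qed
  moreover have "continuous_map T ?TS f"
    unfolding f_def[abs_def]
  proof (rule continuous_map_pairedI)
    have c1: "continuous_map T TN (\<lambda>g. fst (r g))" and c2: "continuous_map T TH (\<lambda>g. snd (r g))"
      by (rule continuous_map_compose2[OF continuous_map_fst cr], rule continuous_map_compose2[OF continuous_map_snd cr])
    show "continuous_map T TBH (\<lambda>g. \<iota> (snd (r g)))" by (rule continuous_map_compose2[OF c\<iota> c2])
    show "continuous_map T TA (\<lambda>g. evaluation (fst (r g)))"
      unfolding continuous_map_TA
    proof (intro conjI ballI)
      show "(\<lambda>g. evaluation (fst (r g))) ` topspace T \<subseteq> carrier A"
        using r_mem evaluation_A by (auto simp: topspace_eq)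
      fix \<xi> assume \<xi>: "\<xi> \<in> D"
      have "continuous_map TN euclidean \<xi>" using D_Nhat[OF \<xi>] by (simp add: carrier_Nhat)
      from continuous_map_compose2[OF this c1]
      show "continuous_map T euclidean (\<lambda>g. evaluation (fst (r g)) \<xi>)" using \<xi> by (simp add: evaluation_def)
    qed
  qed
  ultimately have "continuous_hom G T ?S ?TS f" by (simp add: continuous_hom_def)
  from lift[OF this] obtain \<Phi> where \<Phi>: "continuous_hom BG TBG ?S ?TS \<Phi>" and \<Phi>\<beta>: "\<And>g. g \<in> carrier G \<Longrightarrow> \<Phi> (\<beta> g) = f g"
    by blast
  interpret \<Phi>: group_hom BG ?S \<Phi> using \<Phi> by unfold_locales (simp add: continuous_hom_def)
  have c\<Phi>: "continuous_map TBG ?TS \<Phi>" using \<Phi> by (simp add: continuous_hom_def)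
  have f_N: "f n = (evaluation n, \<one>\<^bsub>BH\<^esub>)" if "n \<in> N" for n
    using f_prod[OF that H_closed(2)] N_carrier[OF that] \<iota>.hom_one by simp
  have "evaluation \<one> = \<one>\<^bsub>A\<^esub>"
  proof -
    have "\<xi> \<one> = 1" if "\<xi> \<in> D" for \<xi>
    proof -
      have "\<xi> (\<one> \<otimes> \<one>) = \<xi> \<one> * \<xi> \<one>" "norm (\<xi> \<one>) = 1" using D_Nhat[OF that] N_closed(2) unfolding carrier_Nhat by blast+
      then show ?thesis by auto
    qed
    then show ?thesis by (auto simp: evaluation_def one_A fun_eq_iff)
  qed
  then have f_H: "f h = (\<one>\<^bsub>A\<^esub>, \<iota> h)" if "h \<in> H" for h
    using f_prod[OF N_closed(2) that] H_carrier[OF that] by simp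
  \<comment> \<open>surjectivity: the image is closed and contains a dense subset\<close>
  have "closedin ?TS (\<Phi> ` topspace TBG)"
    using comp(1) c\<Phi> Haus(2) unfolding compact_space_def
    by (intro compactin_imp_closedin image_compactin)
  moreover have "evaluation ` N \<times> \<iota> ` H \<subseteq> \<Phi> ` topspace TBG"
  proof clarify
    fix n h assume nh: "n \<in> N" "h \<in> H"
    have g: "n \<otimes> h \<in> carrier G" using N_carrier[OF nh(1)] H_carrier[OF nh(2)] by simp
    have "\<Phi> (\<beta> (n \<otimes> h)) = (evaluation n, \<iota> h)" using \<Phi>\<beta>[OF g] f_prod[OF nh] by simp
    moreover have "\<beta> (n \<otimes> h) \<in> topspace TBG" using \<beta>.hom_closed[OF g] by (simp add: BG.topspace_eq)
    ultimately show "(evaluation n, \<iota> h) \<in> \<Phi> ` topspace TBG" by (metis imageI)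
  qed
  ultimately have "?TS closure_of (evaluation ` N \<times> \<iota> ` H) \<subseteq> \<Phi> ` topspace TBG"
    by (rule closure_of_minimal[rotated])
  then have surj: "carrier ?S \<subseteq> \<Phi> ` carrier BG"
    unfolding closure_of_Times evaluation_dense \<iota>_dense by (simp add: carrier_S BG.topspace_eq BH.topspace_eq)
  \<comment> \<open>injectivity: the kernel lies in \<open>M\<close>, where \<open>\<Phi>\<close> records the values of all characters\<close>
  define M where "M = TBG closure_of (\<beta> ` N)"
  have tgBG: "topological_group BG TBG" by (rule BG.topological_group_axioms)
  have sM: "subgroup M BG" unfolding M_def by (rule closure_image_N(1)[OF tgBG \<beta> \<beta>_dense])
  have MBG: "m \<in> carrier BG" if "m \<in> M" for m using that subgroup.subset[OF sM] by blast
  have "\<beta> ` N \<subseteq> topspace TBG" using N_carrier by (auto simp: BG.topspace_eq)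
  then have \<beta>M: "\<beta> n \<in> M" if "n \<in> N" for n using that closure_of_subset unfolding M_def by blast
  have topM: "topspace (subtopology TBG M) = M" using MBG by (auto simp: BG.topspace_eq)
  have denseM: "subtopology TBG M closure_of (\<beta> ` N) = topspace (subtopology TBG M)"
    unfolding topM using \<beta>M by (auto simp: closure_of_subtopology M_def Int_absorb1 image_subset_iff)
  have decomp: "\<exists>m\<in>M. \<exists>y\<in>carrier BH. x = m \<otimes>\<^bsub>BG\<^esub> j y" if x: "x \<in> carrier BG" for x
  proof -
    define P where "P = (\<lambda>z. fst z \<otimes>\<^bsub>BG\<^esub> j (snd z)) ` (M \<times> topspace TBH)"
    have cM: "compactin TBG M" unfolding M_def by (rule closedin_compact_space[OF comp(1)]) simp
    have "compactin (prod_topology TBG TBH) (M \<times> topspace TBH)"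
      using cM comp(2) by (simp add: compactin_Times compact_space_def)
    moreover have "continuous_map (prod_topology TBG TBH) TBG (\<lambda>z. fst z \<otimes>\<^bsub>BG\<^esub> j (snd z))"
      by (intro BG.continuous_map_mult continuous_map_compose2[OF cj] continuous_map_fst continuous_map_snd)
    ultimately have "compactin TBG P" unfolding P_def by (rule image_compactin)
    then have "closedin TBG P" using Haus(1) compactin_imp_closedin by blast
    moreover have "\<beta> ` carrier G \<subseteq> P"
    proof clarify
      fix g assume g: "g \<in> carrier G"
      have mem: "fst (r g) \<in> N" "snd (r g) \<in> H" using r_mem[OF g] by simp_all
      have "\<beta> g = \<beta> (fst (r g)) \<otimes>\<^bsub>BG\<^esub> \<beta> (snd (r g))"
        using \<beta>.hom_mult[OF N_carrier[OF mem(1)] H_carrier[OF mem(2)]] r2[OF g] by simp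
      then have "\<beta> g = \<beta> (fst (r g)) \<otimes>\<^bsub>BG\<^esub> j (\<iota> (snd (r g)))" using j(2)[OF mem(2)] by simp
      then show "\<beta> g \<in> P"
        unfolding P_def using \<beta>M[OF mem(1)] \<iota>_closed[OF mem(2)]
        by (intro image_eqI[of _ _ "(\<beta> (fst (r g)), \<iota> (snd (r g)))"]) (simp_all add: BH.topspace_eq)
    qed
    ultimately have "topspace TBG \<subseteq> P" using closure_of_minimal[of "\<beta> ` carrier G" P TBG] unfolding \<beta>_dense by blast
    then have "x \<in> P" using x by (auto simp: BG.topspace_eq)
    then obtain z where "z \<in> M \<times> carrier BH" "x = fst z \<otimes>\<^bsub>BG\<^esub> j (snd z)" unfolding P_def BH.topspace_eq by blast
    then show ?thesis by (intro bexI[of _ "fst z"] bexI[of _ "snd z"]) auto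
  qed
  have \<Phi>j: "\<Phi> (j y) = (\<one>\<^bsub>A\<^esub>, y)" if y: "y \<in> carrier BH" for y
  proof (rule dense_image_point[OF \<iota>_dense Haus(2), where f = "\<lambda>y. \<Phi> (j y)" and g = "\<lambda>y. (\<one>\<^bsub>A\<^esub>, y)"])
    show "continuous_map TBH ?TS (\<lambda>y. \<Phi> (j y))" by (rule continuous_map_compose2[OF c\<Phi> cj])
    show "continuous_map TBH ?TS (\<lambda>y. (\<one>\<^bsub>A\<^esub>, y))"
      using continuous_map_id[of TBH] by (intro continuous_map_pairedI) (simp_all add: A.topspace_eq id_def)
    show "\<Phi> (j x) = (\<one>\<^bsub>A\<^esub>, x)" if "x \<in> \<iota> ` H" for x
      using that j(2) \<Phi>\<beta> f_H H_carrier by auto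
    show "y \<in> topspace TBH" using y by (simp add: BH.topspace_eq)
  qed
  have c\<Phi>M: "continuous_map (subtopology TBG M) ?TS \<Phi>" by (rule continuous_map_from_subtopology[OF c\<Phi>])
  have \<Phi>M_snd: "snd (\<Phi> m) = \<one>\<^bsub>BH\<^esub>" if m: "m \<in> M" for m
  proof (rule dense_image_point[OF denseM, where f = "\<lambda>m. snd (\<Phi> m)" and g = "\<lambda>m. \<one>\<^bsub>BH\<^esub>" and Y = TBH])
    show "Hausdorff_space TBH" using BH by (simp add: compact_group_def)
    show "continuous_map (subtopology TBG M) TBH (\<lambda>m. snd (\<Phi> m))" by (rule continuous_map_compose2[OF continuous_map_snd c\<Phi>M])
    show "continuous_map (subtopology TBG M) TBH (\<lambda>m. \<one>\<^bsub>BH\<^esub>)" by (simp only: continuous_map_const BH.topspace_eq BH.one_closed simp_thms)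
    show "snd (\<Phi> x) = \<one>\<^bsub>BH\<^esub>" if "x \<in> \<beta> ` N" for x using that \<Phi>\<beta> f_N N_carrier by auto
    show "m \<in> topspace (subtopology TBG M)" using m by (simp only: topM)
  qed
  interpret GM: topological_group "BG\<lparr>carrier := M\<rparr>" "subtopology TBG M" by (rule BG.topological_group_subgroup[OF sM])
  have M_comm: "m \<otimes>\<^bsub>BG\<^esub> m' = m' \<otimes>\<^bsub>BG\<^esub> m" if m: "m \<in> M" and m': "m' \<in> M" for m m'
  proof -
    have comm: "x \<otimes>\<^bsub>BG\<^esub> y = y \<otimes>\<^bsub>BG\<^esub> x" if y: "y \<in> M" and hyp: "\<And>n. n \<in> N \<Longrightarrow> \<beta> n \<otimes>\<^bsub>BG\<^esub> y = y \<otimes>\<^bsub>BG\<^esub> \<beta> n" and x: "x \<in> M" for x y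
    proof (rule dense_image_point[OF denseM Haus(1), where f = "\<lambda>x. x \<otimes>\<^bsub>BG\<^esub> y" and g = "\<lambda>x. y \<otimes>\<^bsub>BG\<^esub> x"])
      have id: "continuous_map (subtopology TBG M) TBG (\<lambda>x. x)"
        using continuous_map_from_subtopology[OF continuous_map_id[of TBG], of M] by (simp add: id_def)
      have "y \<in> topspace TBG" using MBG[OF y] by (simp add: BG.topspace_eq)
      then have c: "continuous_map (subtopology TBG M) TBG (\<lambda>x. y)" by (simp only: continuous_map_const simp_thms)
      show "continuous_map (subtopology TBG M) TBG (\<lambda>x. x \<otimes>\<^bsub>BG\<^esub> y)" "continuous_map (subtopology TBG M) TBG (\<lambda>x. y \<otimes>\<^bsub>BG\<^esub> x)"
        by (rule BG.continuous_map_mult[OF id c], rule BG.continuous_map_mult[OF c id])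
      show "x \<in> topspace (subtopology TBG M)" using x by (simp only: topM)
      show "x \<otimes>\<^bsub>BG\<^esub> y = y \<otimes>\<^bsub>BG\<^esub> x" if "x \<in> \<beta> ` N" for x using that hyp by auto
    qed
    have "\<beta> n \<otimes>\<^bsub>BG\<^esub> \<beta> k = \<beta> k \<otimes>\<^bsub>BG\<^esub> \<beta> n" if nk: "n \<in> N" "k \<in> N" for n k
    proof -
      have "n \<otimes> k = k \<otimes> n" using comm_groupE(4)[OF N_abelian, of n k] nk by simp
      then show ?thesis using nk N_carrier \<beta>.hom_mult by metis
    qed
    then have "\<beta> n \<otimes>\<^bsub>BG\<^esub> x = x \<otimes>\<^bsub>BG\<^esub> \<beta> n" if "n \<in> N" "x \<in> M" for n x
      using comm[OF \<beta>M[OF that(1)] _ that(2)] that(1) by simp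
    then show ?thesis using comm[OF m' _ m] m' by blast
  qed
  interpret GM: compact_abelian_group "BG\<lparr>carrier := M\<rparr>" "subtopology TBG M"
  proof
    show "compact_space (subtopology TBG M)"
      using comp(1) unfolding M_def by (simp add: closedin_compact_space compact_space_subtopology)
    show "Hausdorff_space (subtopology TBG M)" by (rule Hausdorff_space_subtopology[OF Haus(1)])
  qed (simp add: M_comm)
  have \<Phi>M_fst: "(fst (\<Phi> m)) (\<lambda>n\<in>N. \<xi> (\<beta> n)) = \<xi> m"
    if \<xi>: "continuous_hom (BG\<lparr>carrier := M\<rparr>) (subtopology TBG M) circle_group circle_topology \<xi>" and m: "m \<in> M" for \<xi> m
  proof -
    define \<eta> where "\<eta> = (\<lambda>n\<in>N. \<xi> (\<beta> n))"
    have \<eta>: "\<eta> \<in> D" unfolding \<eta>_def using restr[folded M_def, OF \<xi>] .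
    have c\<xi>: "continuous_map (subtopology TBG M) euclidean \<xi>"
      using \<xi> by (simp add: continuous_hom_def continuous_map_circle)
    have "(fst (\<Phi> m)) \<eta> = \<xi> m"
    proof (rule dense_image_point[OF denseM Hausdorff_space_euclidean _ c\<xi>, where f = "\<lambda>m. (fst (\<Phi> m)) \<eta>"])
      show "continuous_map (subtopology TBG M) euclidean (\<lambda>m. (fst (\<Phi> m)) \<eta>)"
        by (rule continuous_map_compose2[OF continuous_map_TA_eval[OF \<eta>] continuous_map_compose2[OF continuous_map_fst c\<Phi>M]])
      show "(fst (\<Phi> x)) \<eta> = \<xi> x" if x: "x \<in> \<beta> ` N" for x
      proof -
        obtain n where n: "n \<in> N" "x = \<beta> n" using x by blast
        then have "fst (\<Phi> x) = evaluation n" using \<Phi>\<beta>[OF N_carrier[OF n(1)]] f_N by simp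
        then show ?thesis using n \<eta> by (simp add: evaluation_def) (simp add: \<eta>_def)
      qed
      show "m \<in> topspace (subtopology TBG M)" using m by (simp only: topM)
    qed
    then show ?thesis by (simp add: \<eta>_def)
  qed
  have kernel: "x = \<one>\<^bsub>BG\<^esub>" if x: "x \<in> carrier BG" and \<Phi>x: "\<Phi> x = \<one>\<^bsub>?S\<^esub>" for x
  proof -
    obtain m y where my: "m \<in> M" "y \<in> carrier BH" "x = m \<otimes>\<^bsub>BG\<^esub> j y" using decomp[OF x] by blast
    have "\<Phi> x = \<Phi> m \<otimes>\<^bsub>?S\<^esub> (\<one>\<^bsub>A\<^esub>, y)"
      using \<Phi>.hom_mult[OF MBG[OF my(1)] j.hom_closed[OF my(2)]] \<Phi>j[OF my(2)] my(3) by simp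
    then have "snd (\<Phi> x) = y"
      using \<Phi>M_snd[OF my(1)] my(2) by (cases "\<Phi> m") (simp add: mult_S)
    then have "y = \<one>\<^bsub>BH\<^esub>" using \<Phi>x by (simp add: one_S)
    then have xm: "x = m" using my MBG by simp
    show ?thesis
    proof (rule ccontr)
      assume "x \<noteq> \<one>\<^bsub>BG\<^esub>"
      then have "m \<in> carrier (BG\<lparr>carrier := M\<rparr>)" "m \<noteq> \<one>\<^bsub>BG\<lparr>carrier := M\<rparr>\<^esub>" using xm my(1) by simp_all
      then obtain \<xi> where \<xi>: "continuous_map (subtopology TBG M) euclidean \<xi>"
        "\<forall>x\<in>carrier (BG\<lparr>carrier := M\<rparr>). \<forall>y\<in>carrier (BG\<lparr>carrier := M\<rparr>). \<xi> (x \<otimes>\<^bsub>BG\<lparr>carrier := M\<rparr>\<^esub> y) = \<xi> x * \<xi> y"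
        "\<forall>x\<in>carrier (BG\<lparr>carrier := M\<rparr>). norm (\<xi> x) = 1" "\<xi> m \<noteq> (1::complex)"
        by (rule GM.characters_separate_points)
      have "continuous_hom (BG\<lparr>carrier := M\<rparr>) (subtopology TBG M) circle_group circle_topology \<xi>"
        unfolding continuous_hom_circle[OF GM.topspace_eq] using \<xi> by blast
      from \<Phi>M_fst[OF this my(1)] restr[folded M_def, OF this]
      have "\<xi> m = 1" using \<Phi>x xm by (simp add: one_S one_A)
      then show False using \<xi>(4) by simp
    qed
  qed
  have iso: "\<Phi> \<in> iso BG ?S" unfolding \<Phi>.iso_iff using surj kernel by blast
  have "homeomorphic_map TBG ?TS \<Phi>"
  proof (rule continuous_imp_homeomorphic_map[OF c\<Phi> comp(1) Haus(2)])
    show "\<Phi> ` topspace TBG = topspace ?TS" "inj_on \<Phi> (topspace TBG)"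
      using iso unfolding BG.topspace_eq S.topspace_eq iso_def bij_betw_def by blast+
  qed
  with iso show ?thesis unfolding topological_group_isomorphic_def by blast
qed

end

section \<open>The dual of the characters with finite image is profinite\<close>
lemma group_circle: "group circle_group"
proof (rule groupI)
  fix z assume "z \<in> carrier circle_group"
  then have "norm z = 1" "z \<noteq> 0" by auto
  then show "\<exists>w\<in>carrier circle_group. w \<otimes>\<^bsub>circle_group\<^esub> z = \<one>\<^bsub>circle_group\<^esub>"
    by (intro bexI[of _ "inverse z"]) (auto simp: circle_group_def norm_inverse)
qed (auto simp: circle_group_def norm_mult)

lemma (in abelian_semidirect_product) finite_image_root_of_unity:
  assumes \<xi>: "\<xi> \<in> carrier Nhat" "finite (\<xi> ` N)" and n: "n \<in> N"
  shows "\<xi> n ^ card (\<xi> ` N) = 1"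
proof -
  interpret circle: group circle_group by (rule group_circle)
  interpret GN: group GN by (rule subgroup_imp_group[OF N_subgroup])
  interpret \<xi>: group_hom GN circle_group \<xi>
    using \<xi>(1) by unfold_locales (auto intro!: homI simp: carrier_Nhat)
  have "subgroup (\<xi> ` N) circle_group" using \<xi>.img_is_subgroup by simp
  then interpret im: group "circle_group\<lparr>carrier := \<xi> ` N\<rparr>" by (rule circle.subgroup_imp_group)
  have "z [^]\<^bsub>circle_group\<lparr>carrier := \<xi> ` N\<rparr>\<^esub> k = z ^ k" for z and k :: nat
    by (induction k) (simp_all add: circle_group_def nat_pow_def mult.commute)
  then show ?thesis
    using im.pow_order_eq_1[of "\<xi> n"] n by (simp add: order_def circle_group_def)
qed

text \<open>If \<open>\<xi>\<close> has finite order \<open>k\<close>, the coordinate \<open>a \<mapsto> a \<xi>\<close> takes its values in the finite set of \<open>k\<close>-th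
  roots of unity.\<close>
lemma (in invariant_characters) totally_disconnected_TA:
  assumes fin: "\<And>\<xi>. \<xi> \<in> D \<Longrightarrow> finite (\<xi> ` N)"
  shows "totally_disconnected_space TA"
proof (rule totally_disconnected_by_coordinates)
  fix \<xi> assume \<xi>: "\<xi> \<in> D"
  define k where "k = card (\<xi> ` N)"
  have k: "k > 0" using fin[OF \<xi>] N_closed(2) by (auto simp: k_def card_gt_0_iff)
  interpret GD: comm_group GD by (rule comm_group_GD)
  have pow: "\<xi> [^]\<^bsub>GD\<^esub> i \<in> D" and pow_val: "(\<xi> [^]\<^bsub>GD\<^esub> i) n = \<xi> n ^ i" if "n \<in> N" for i :: nat and n
  proof -
    show "\<xi> [^]\<^bsub>GD\<^esub> i \<in> D" using GD.nat_pow_closed[of \<xi> i] \<xi> by simp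
    show "(\<xi> [^]\<^bsub>GD\<^esub> i) n = \<xi> n ^ i"
      using \<open>n \<in> N\<close> by (induction i) (simp_all add: mult_dual one_dual mult.commute)
  qed
  have "\<xi> [^]\<^bsub>GD\<^esub> k = \<one>\<^bsub>Nhat\<^esub>"
  proof (rule Nhat_eqI)
    show "\<xi> [^]\<^bsub>GD\<^esub> k \<in> carrier Nhat" by (rule D_Nhat[OF pow[OF N_closed(2)]])
    show "\<one>\<^bsub>Nhat\<^esub> \<in> carrier Nhat" by (rule D_Nhat[OF subgroup.one_closed[OF D_subgroup]])
    show "(\<xi> [^]\<^bsub>GD\<^esub> k) n = \<one>\<^bsub>Nhat\<^esub> n" if "n \<in> N" for n
      using pow_val[OF that] finite_image_root_of_unity[OF D_Nhat[OF \<xi>] fin[OF \<xi>] that] that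
      by (simp add: k_def one_dual)
  qed
  moreover have o: "\<one>\<^bsub>Nhat\<^esub> \<in> D" by (rule subgroup.one_closed[OF D_subgroup])
  have a_one: "a \<one>\<^bsub>Nhat\<^esub> = 1" if a: "a \<in> carrier A" for a
  proof -
    have "a (\<one>\<^bsub>Nhat\<^esub> \<otimes>\<^bsub>Nhat\<^esub> \<one>\<^bsub>Nhat\<^esub>) = a \<one>\<^bsub>Nhat\<^esub> * a \<one>\<^bsub>Nhat\<^esub>" "norm (a \<one>\<^bsub>Nhat\<^esub>) = 1"
      using a o unfolding carrier_A by blast+
    moreover have "\<one>\<^bsub>Nhat\<^esub> \<otimes>\<^bsub>Nhat\<^esub> \<one>\<^bsub>Nhat\<^esub> = \<one>\<^bsub>Nhat\<^esub>" using GD.l_one[of "\<one>\<^bsub>Nhat\<^esub>"] o by simp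
    ultimately show ?thesis by auto
  qed
  have "a (\<xi> [^]\<^bsub>GD\<^esub> i) = a \<xi> ^ i" if "a \<in> carrier A" for a and i :: nat
    using a_one that pow[OF N_closed(2)] \<xi> by (induction i) (simp_all add: carrier_A mult.commute)
  ultimately have root: "a \<xi> ^ k = 1" if "a \<in> carrier A" for a
    using a_one that by metis
  have "totally_disconnected_space (top_of_set {z::complex. z ^ k = 1})"
    unfolding totally_disconnected_space_def
  proof (intro allI impI)
    fix S assume "connectedin (top_of_set {z::complex. z ^ k = 1}) S"
    then have "connected S" "S \<subseteq> {z. z ^ k = 1}" by (simp_all add: connectedin_subtopology)
    moreover have "finite S" using calculation(2) finite_roots_unity[of k] k finite_subset by fastforce
    ultimately show "\<exists>x. S \<subseteq> {x}" using connected_finite_iff_sing by blast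
  qed
  moreover have "continuous_map TA (top_of_set {z. z ^ k = 1}) (\<lambda>a. a \<xi>)"
    using continuous_map_TA_eval[OF \<xi>] root by (auto simp: continuous_map_in_subtopology topspace_TA)
  ultimately show "totally_disconnected_space (top_of_set {z::complex. z ^ card (\<xi> ` N) = 1}) \<and>
      continuous_map TA (top_of_set {z. z ^ card (\<xi> ` N) = 1}) (\<lambda>a. a \<xi>)"
    by (simp add: k_def)
next
  fix a b assume "a \<in> topspace TA" "b \<in> topspace TA" "\<And>\<xi>. \<xi> \<in> D \<Longrightarrow> a \<xi> = b \<xi>"
  then show "a = b" by (intro A_eqI) (simp_all add: topspace_TA)
qed

section \<open>Bohr compactification and profinite completion of a semidirect product\<close>
theorem corollary4:
  fixes G :: "'g monoid" and T :: "'g topology" and N H :: "'g set"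
  assumes "topological_group G T"
    and "locally_compact_space T"
    and "topological_semidirect_product G T N H"
    and "comm_group (G\<lparr>carrier := N\<rparr>)"
  shows
    "(\<forall>(BG :: 'bg monoid) TBG \<beta>G (BH :: 'bh monoid) TBH \<beta>H.
        bohr_compactification G T BG TBG \<beta>G \<and>
        bohr_compactification (G\<lparr>carrier := H\<rparr>) (subtopology T H) BH TBH \<beta>H \<longrightarrow>
        (let D = periodic_chars G T N H;
             A = discrete_dual_group G T N D;
             TA = discrete_dual_topology G T N D
         in (\<exists>\<theta>. induced_action G T N H D BH TBH \<beta>H \<theta>) \<and>
            (\<forall>\<theta>. induced_action G T N H D BH TBH \<beta>H \<theta> \<longrightarrow>
               topological_group_isomorphic BG TBG
                 (semidirect_product A BH \<theta>) (prod_topology TA TBH)))) \<and>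
     (\<forall>(PG :: 'pg monoid) TPG \<alpha>G (PH :: 'ph monoid) TPH \<alpha>H.
        profinite_completion G T PG TPG \<alpha>G \<and>
        profinite_completion (G\<lparr>carrier := H\<rparr>) (subtopology T H) PH TPH \<alpha>H \<longrightarrow>
        (let E = finite_periodic_chars G T N H;
             B = discrete_dual_group G T N E;
             TB = discrete_dual_topology G T N E
         in (\<exists>\<theta>. induced_action G T N H E PH TPH \<alpha>H \<theta>) \<and>
            (\<forall>\<theta>. induced_action G T N H E PH TPH \<alpha>H \<theta> \<longrightarrow>
               topological_group_isomorphic PG TPG
                 (semidirect_product B PH \<theta>) (prod_topology TB TPH))))"
proof -
  interpret S: abelian_semidirect_product G T N H
    using assms by (simp add: abelian_semidirect_product_def abelian_semidirect_product_axioms_def)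
  have tgH: "topological_group (G\<lparr>carrier := H\<rparr>) (subtopology T H)" by (rule S.topological_group_H)
  show ?thesis
    unfolding Let_def
  proof (intro conjI allI impI; elim conjE)
    fix BG :: "'bg monoid" and TBG \<beta>G and BH :: "'bh monoid" and TBH \<beta>H
    assume BG: "bohr_compactification G T BG TBG \<beta>G"
      and BH: "bohr_compactification (G\<lparr>carrier := H\<rparr>) (subtopology T H) BH TBH \<beta>H"
    interpret D: invariant_characters G T N H "periodic_chars G T N H"
      by (intro invariant_characters.intro invariant_characters_axioms.intro S.abelian_semidirect_product_axioms
          S.periodic_chars_subgroup order_refl S.periodic_chars_invariant)
    have BG': "compact_group BG TBG" "continuous_hom G T BG TBG \<beta>G" "TBG closure_of (\<beta>G ` carrier G) = topspace TBG"
      and BH': "compact_group BH TBH" "continuous_hom (G\<lparr>carrier := H\<rparr>) (subtopology T H) BH TBH \<beta>H"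
        "TBH closure_of (\<beta>H ` H) = topspace TBH"
      using BG BH by (simp_all add: bohr_compactification_def)
    have perm: "compact_group D.perm_group D.perm_topology"
      using D.profinite_perm_group by (simp add: profinite_group_def)
    from bohr_compactification_universal[OF tgH BH perm D.H_perm_continuous_hom]
    obtain \<phi> where \<phi>: "continuous_hom BH TBH D.perm_group D.perm_topology \<phi>" "\<And>h. h \<in> H \<Longrightarrow> \<phi> (\<beta>H h) = D.H_perm h"
      by auto
    have "topological_group BH TBH" using BH'(1) by (simp add: compact_group_def)
    from D.induced_action_exists[OF this BH'(2,3) \<phi>]
    show "\<exists>\<theta>. induced_action G T N H (periodic_chars G T N H) BH TBH \<beta>H \<theta>" .
    fix \<theta> assume \<theta>: "induced_action G T N H (periodic_chars G T N H) BH TBH \<beta>H \<theta>"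
    have "continuous_hom (G\<lparr>carrier := H\<rparr>) (subtopology T H) BG TBG \<beta>G"
      using BG'(2) S.H_carrier by (auto simp: continuous_hom_def hom_def continuous_map_from_subtopology)
    from bohr_compactification_universal[OF tgH BH BG'(1) this]
    obtain j where j: "continuous_hom BH TBH BG TBG j" "\<And>h. h \<in> H \<Longrightarrow> j (\<beta>H h) = \<beta>G h" by auto
    have cact: "continuous_action BH TBH D.A D.TA \<theta>" using \<theta> by (simp add: induced_action_def)
    show "topological_group_isomorphic BG TBG (semidirect_product D.A BH \<theta>) (prod_topology D.TA TBH)"
    proof (rule D.comparison[OF BG' BH' j \<theta>])
      show "\<exists>\<Phi>. continuous_hom BG TBG (semidirect_product D.A BH \<theta>) (prod_topology D.TA TBH) \<Phi> \<and>
          (\<forall>x\<in>carrier G. \<Phi> (\<beta>G x) = f x)"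
        if "continuous_hom G T (semidirect_product D.A BH \<theta>) (prod_topology D.TA TBH) f" for f
        by (rule bohr_compactification_universal[OF assms(1) BG
              compact_group_semidirect_product[OF D.compact_group_A BH'(1) cact] that])
      show "(\<lambda>n\<in>N. \<xi> (\<beta>G n)) \<in> periodic_chars G T N H"
        if "continuous_hom (BG\<lparr>carrier := TBG closure_of (\<beta>G ` N)\<rparr>) (subtopology TBG (TBG closure_of (\<beta>G ` N)))
          circle_group circle_topology \<xi>" for \<xi>
        by (rule S.restricted_character_periodic[OF BG' refl that])
    qed
  next
    fix PG :: "'pg monoid" and TPG \<alpha>G and PH :: "'ph monoid" and TPH \<alpha>H
    assume PG: "profinite_completion G T PG TPG \<alpha>G"
      and PH: "profinite_completion (G\<lparr>carrier := H\<rparr>) (subtopology T H) PH TPH \<alpha>H"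
    interpret E: invariant_characters G T N H "finite_periodic_chars G T N H"
      by (intro invariant_characters.intro invariant_characters_axioms.intro S.abelian_semidirect_product_axioms
          S.finite_periodic_chars_subgroup S.finite_periodic_chars_invariant)
        (simp add: finite_periodic_chars_def)
    have PG': "compact_group PG TPG" "continuous_hom G T PG TPG \<alpha>G" "TPG closure_of (\<alpha>G ` carrier G) = topspace TPG"
      and PH': "compact_group PH TPH" "continuous_hom (G\<lparr>carrier := H\<rparr>) (subtopology T H) PH TPH \<alpha>H"
        "TPH closure_of (\<alpha>H ` H) = topspace TPH"
      and td: "totally_disconnected_space TPG" "totally_disconnected_space TPH"
      using PG PH by (simp_all add: profinite_completion_def profinite_group_def)
    from profinite_completion_universal[OF tgH PH E.profinite_perm_group E.H_perm_continuous_hom]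
    obtain \<phi> where \<phi>: "continuous_hom PH TPH E.perm_group E.perm_topology \<phi>" "\<And>h. h \<in> H \<Longrightarrow> \<phi> (\<alpha>H h) = E.H_perm h"
      by auto
    have "topological_group PH TPH" using PH'(1) by (simp add: compact_group_def)
    from E.induced_action_exists[OF this PH'(2,3) \<phi>]
    show "\<exists>\<theta>. induced_action G T N H (finite_periodic_chars G T N H) PH TPH \<alpha>H \<theta>" .
    fix \<theta> assume \<theta>: "induced_action G T N H (finite_periodic_chars G T N H) PH TPH \<alpha>H \<theta>"
    have "continuous_hom (G\<lparr>carrier := H\<rparr>) (subtopology T H) PG TPG \<alpha>G"
      using PG'(2) S.H_carrier by (auto simp: continuous_hom_def hom_def continuous_map_from_subtopology)
    moreover have "profinite_group PG TPG" using PG by (simp add: profinite_completion_def)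
    ultimately obtain j where j: "continuous_hom PH TPH PG TPG j" "\<And>h. h \<in> H \<Longrightarrow> j (\<alpha>H h) = \<alpha>G h"
      using profinite_completion_universal[OF tgH PH, of PG TPG \<alpha>G] by auto
    have cact: "continuous_action PH TPH E.A E.TA \<theta>" using \<theta> by (simp add: induced_action_def)
    have "totally_disconnected_space E.TA"
      by (rule E.totally_disconnected_TA) (simp add: finite_periodic_chars_def)
    then have prof: "profinite_group (semidirect_product E.A PH \<theta>) (prod_topology E.TA TPH)"
      using compact_group_semidirect_product[OF E.compact_group_A PH'(1) cact] td(2)
      by (simp add: profinite_group_def totally_disconnected_prod_topology)
    show "topological_group_isomorphic PG TPG (semidirect_product E.A PH \<theta>) (prod_topology E.TA TPH)"
    proof (rule E.comparison[OF PG' PH' j \<theta>])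
      show "\<exists>\<Phi>. continuous_hom PG TPG (semidirect_product E.A PH \<theta>) (prod_topology E.TA TPH) \<Phi> \<and>
          (\<forall>x\<in>carrier G. \<Phi> (\<alpha>G x) = f x)"
        if "continuous_hom G T (semidirect_product E.A PH \<theta>) (prod_topology E.TA TPH) f" for f
        by (rule profinite_completion_universal[OF assms(1) PG prof that])
      fix \<xi>
      define M where "M = TPG closure_of (\<alpha>G ` N)"
      assume "continuous_hom (PG\<lparr>carrier := TPG closure_of (\<alpha>G ` N)\<rparr>) (subtopology TPG (TPG closure_of (\<alpha>G ` N)))
          circle_group circle_topology \<xi>"
      then have \<xi>: "continuous_hom (PG\<lparr>carrier := M\<rparr>) (subtopology TPG M) circle_group circle_topology \<xi>"
        by (simp add: M_def)
      have per: "(\<lambda>n\<in>N. \<xi> (\<alpha>G n)) \<in> periodic_chars G T N H"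
        by (rule S.restricted_character_periodic[OF PG' M_def \<xi>])
      have tgPG: "topological_group PG TPG" using PG'(1) by (simp add: compact_group_def)
      have sM: "subgroup M PG" unfolding M_def by (rule S.closure_image_N(1)[OF tgPG PG'(2,3)])
      have "profinite_group (PG\<lparr>carrier := M\<rparr>) (subtopology TPG M)"
        using PG'(1) topological_group.topological_group_subgroup[OF tgPG sM] totally_disconnected_space_subtopology[OF td(1)]
        by (simp add: profinite_group_def compact_group_def Hausdorff_space_subtopology M_def
            closedin_compact_space compact_space_subtopology)
      then have "finite (\<xi> ` M)" using profinite_character_finite_image[OF _ \<xi>] by simp
      moreover have "\<alpha>G ` N \<subseteq> M"
        unfolding M_def using PG'(2) S.N_carrier tgPG
        by (intro closure_of_subset) (auto simp: continuous_hom_def hom_def topological_group.topspace_eq)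
      then have "(\<lambda>n\<in>N. \<xi> (\<alpha>G n)) ` N \<subseteq> \<xi> ` M" by auto
      ultimately show "(\<lambda>n\<in>N. \<xi> (\<alpha>G n)) \<in> finite_periodic_chars G T N H"
        using per finite_subset by (auto simp: finite_periodic_chars_def)
    qed
  qed
qed

end
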